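(* Let $K=\mathbb{F}_q$ be a finite field of characteristic $p$, let $N\ge 1$ with $p\ge N$, let $\mathfrak{g}$ be a Lie subalgebra (over $K$) of $\mathfrak{ut}(N,K)$, and let $G=\exp(\mathfrak{g})$. Let $\mathfrak{h}$ be a Lie subalgebra of $\mathfrak{g}$, $H=\exp(\mathfrak{h})$, and $\pi:\mathfrak{g}^*\to\mathfrak{h}^*$ the natural projection (restriction of linear forms to $\mathfrak{h}$). Let $\Omega\subset\mathfrak{g}^*$ be a coadjoint orbit of $G$ and $\omega\subset\mathfrak{h}^*$ a coadjoint orbit of $H$, with corresponding irreducible complex representations $T^\Omega$ of $G$ and $t^\omega$ of $H$. Then $t^\omega$ occurs in the decomposition of the restriction of $T^\Omega$ to $H$ if and only if $\omega\subset\pi(\Omega)$.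
   Context: $\mathfrak{ut}(N,K)$ is the Lie algebra of all $N\times N$ upper triangular matrices over $K$ with zeros on the diagonal. Since $p\ge N$, the exponential map $\exp$ is defined on $\mathfrak{ut}(N,K)$ and maps each Lie subalgebra $\mathfrak{g}$ bijectively onto a subgroup $G=\exp(\mathfrak{g})$ of the unitriangular group $\mathrm{UT}(N,K)$. $\mathfrak{g}^*$ is the dual $K$-vector space. The coadjoint action of $G$ on $\mathfrak{g}^*$ is $(\mathrm{Ad}^*_g\lambda)(x)=\lambda(g^{-1}xg)$; its orbits are the coadjoint orbits. Fix a nontrivial additive character $K\to\mathbb{C}^*$, written $x\mapsto e^{x}$ (the same character is used for all groups). For $\lambda\in\mathfrak{g}^*$, a polarization of $\lambda$ is a subalgebra $\mathfrak{p}$ of $\mathfrak{g}$ that is a maximal isotropic subspace for the skew-symmetric form $B_\lambda(x,y)=\lambda([x,y])$ on $\mathfrak{g}$; polarizations always exist. Put $P=\exp(\mathfrak{p})$, let $\xi_\lambda:P\to\mathbb{C}^*$ be the one-dimensional representation $\xi_\lambda(\exp(x))=e^{\lambda(x)}$, and let $T^\lambda=\mathrm{ind}(\xi_\lambda,P,G)$ be the induced complex representation. Up to equivalence, $T^\lambda$ is irreducible, does not depend on the choice of $\mathfrak{p}$, and depends only on the coadjoint orbit $\Omega$ of $\lambda$; its equivalence class is denoted $T^\Omega$. The representation $t^\omega$ of $H$ attached to a coadjoint orbit $\omega\subset\mathfrak{h}^*$ is defined in the same way, with $(\mathfrak{h},H)$ in place of $(\mathfrak{g},G)$. *)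

theory Defs
  imports
    "HOL-Analysis.Analysis"
    "HOL-Computational_Algebra.Computational_Algebra"
    "HOL-Library.Function_Algebras"
    "HOL-Algebra.Group_Action"
begin

section \<open>Linear maps on subspaces\<close>

text \<open>
  The library predicate \<open>linear\<close> speaks about maps on a whole type; here the domains are
  subspaces. Values outside \<open>V\<close> are not constrained.
\<close>

definition linear_map_on ::
  "('c \<Rightarrow> 'a \<Rightarrow> 'a) \<Rightarrow> ('c \<Rightarrow> 'b \<Rightarrow> 'b) \<Rightarrow> 'a::ab_group_add set \<Rightarrow> ('a \<Rightarrow> 'b::ab_group_add) \<Rightarrow> bool"
  where "linear_map_on s\<^sub>1 s\<^sub>2 V f \<longleftrightarrow>
    (\<forall>x\<in>V. \<forall>y\<in>V. f (x + y) = f x + f y) \<and> (\<forall>c. \<forall>x\<in>V. f (s\<^sub>1 c x) = s\<^sub>2 c (f x))"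


section \<open>Complex representations of a group\<close>

text \<open>
  Representation spaces are complex subspaces of function spaces \<^typ>\<open>'b \<Rightarrow> complex\<close>, with
  pointwise operations. Every complex vector space is isomorphic to one of these.
\<close>

definition fun_scale :: "complex \<Rightarrow> ('b \<Rightarrow> complex) \<Rightarrow> 'b \<Rightarrow> complex"
  where "fun_scale c f = (\<lambda>x. c * f x)"

interpretation fun_space: vector_space fun_scale
  by unfold_locales (auto simp: fun_scale_def fun_eq_iff algebra_simps)

record ('g, 'b) rep =
  rep_space :: "('b \<Rightarrow> complex) set"
  rep_act :: "'g \<Rightarrow> ('b \<Rightarrow> complex) \<Rightarrow> 'b \<Rightarrow> complex"

text \<open>
  By the convention of \<^const>\<open>BijGroup\<close>, the operators \<open>rep_act R g\<close> take the value
  \<^const>\<open>undefined\<close> outside the representation space.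
\<close>

definition complex_rep :: "('g, 'm) monoid_scheme \<Rightarrow> ('g, 'b) rep \<Rightarrow> bool"
  where "complex_rep G R \<longleftrightarrow>
    fun_space.subspace (rep_space R) \<and>
    group_action G (rep_space R) (rep_act R) \<and>
    (\<forall>g\<in>carrier G. linear_map_on fun_scale fun_scale (rep_space R) (rep_act R g))"

definition equivalent_rep :: "('g, 'm) monoid_scheme \<Rightarrow> ('g, 'b) rep \<Rightarrow> ('g, 'c) rep \<Rightarrow> bool"
  where "equivalent_rep G R S \<longleftrightarrow> complex_rep G R \<and> complex_rep G S \<and>
    (\<exists>\<phi>. linear_map_on fun_scale fun_scale (rep_space R) \<phi> \<and>
         bij_betw \<phi> (rep_space R) (rep_space S) \<and>
         (\<forall>g\<in>carrier G. \<forall>v\<in>rep_space R. \<phi> (rep_act R g v) = rep_act S g (\<phi> v)))"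

definition invariant_subspace ::
  "('g, 'm) monoid_scheme \<Rightarrow> ('g, 'b) rep \<Rightarrow> ('b \<Rightarrow> complex) set \<Rightarrow> bool"
  where "invariant_subspace G R U \<longleftrightarrow>
    fun_space.subspace U \<and> U \<subseteq> rep_space R \<and> (\<forall>g\<in>carrier G. \<forall>v\<in>U. rep_act R g v \<in> U)"

definition subrep :: "('g, 'b) rep \<Rightarrow> ('b \<Rightarrow> complex) set \<Rightarrow> ('g, 'b) rep"
  where "subrep R U = \<lparr>rep_space = U, rep_act = (\<lambda>g. restrict (rep_act R g) U)\<rparr>"

definition irreducible_rep :: "('g, 'm) monoid_scheme \<Rightarrow> ('g, 'b) rep \<Rightarrow> bool"
  where "irreducible_rep G R \<longleftrightarrow> complex_rep G R \<and> rep_space R \<noteq> {0} \<and>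
    (\<forall>U. invariant_subspace G R U \<longrightarrow> U = {0} \<or> U = rep_space R)"

text \<open>\<open>\<U>\<close> is the set of summands of a direct sum decomposition into irreducibles.\<close>

definition irreducible_decomposition ::
  "('g, 'm) monoid_scheme \<Rightarrow> ('g, 'b) rep \<Rightarrow> ('b \<Rightarrow> complex) set set \<Rightarrow> bool"
  where "irreducible_decomposition G R \<U> \<longleftrightarrow> finite \<U> \<and>
    (\<forall>U\<in>\<U>. invariant_subspace G R U \<and> irreducible_rep G (subrep R U)) \<and>
    (\<forall>v\<in>rep_space R. \<exists>!u. u \<in> (\<Pi>\<^sub>E U\<in>\<U>. U) \<and> v = (\<Sum>U\<in>\<U>. u U))"

definition occurs_in :: "('g, 'm) monoid_scheme \<Rightarrow> ('g, 'c) rep \<Rightarrow> ('g, 'b) rep \<Rightarrow> bool"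
  where "occurs_in G S R \<longleftrightarrow>
    (\<exists>\<U>. irreducible_decomposition G R \<U> \<and> (\<exists>U\<in>\<U>. equivalent_rep G S (subrep R U)))"

definition restrict_rep :: "('g, 'm) monoid_scheme \<Rightarrow> ('g, 'b) rep \<Rightarrow> ('g, 'b) rep"
  where "restrict_rep H R = \<lparr>rep_space = rep_space R, rep_act = restrict (rep_act R) (carrier H)\<rparr>"

text \<open>
  Representation of \<open>G\<close> induced from the one-dimensional representation \<open>\<xi>\<close> of the subgroup
  with carrier \<open>P\<close>: functions with \<open>f (p x) = \<xi> p f x\<close>, on which \<open>G\<close> acts by right
  translations. Functions on \<open>G\<close> are encoded as functions vanishing outside \<open>G\<close>.
\<close>

definition induced_space ::
  "('g, 'm) monoid_scheme \<Rightarrow> 'g set \<Rightarrow> ('g \<Rightarrow> complex) \<Rightarrow> ('g \<Rightarrow> complex) set"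
  where "induced_space G P \<xi> =
    {f. (\<forall>x. x \<notin> carrier G \<longrightarrow> f x = 0) \<and>
        (\<forall>p\<in>P. \<forall>x\<in>carrier G. f (p \<otimes>\<^bsub>G\<^esub> x) = \<xi> p * f x)}"

definition induced_rep ::
  "('g, 'm) monoid_scheme \<Rightarrow> 'g set \<Rightarrow> ('g \<Rightarrow> complex) \<Rightarrow> ('g, 'g) rep"
  where "induced_rep G P \<xi> =
    \<lparr>rep_space = induced_space G P \<xi>,
     rep_act = (\<lambda>g. \<lambda>f\<in>induced_space G P \<xi>. \<lambda>x. if x \<in> carrier G then f (x \<otimes>\<^bsub>G\<^esub> g) else 0)\<rparr>"


section \<open>Nilpotent matrix Lie algebras and their groups\<close>

text \<open>
  \<open>N \<times> N\<close> matrices over \<open>K\<close> have type \<open>'k^'n^'n\<close> with \<open>N = CARD('n)\<close>; the linear order on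
  the finite index type gives the meaning of \<open>upper triangular\<close>. The product is \<open>**\<close>: the
  class operation \<open>*\<close> on this type is componentwise, so powers are defined separately.
\<close>

type_synonym ('k, 'n) sqmat = "'k^'n^'n"

definition mat_scale :: "'k \<Rightarrow> ('k, 'n) sqmat \<Rightarrow> ('k::field, 'n::finite) sqmat"
  where "mat_scale c A = (\<chi> i j. c * A $ i $ j)"

interpretation mat_space: vector_space "mat_scale :: 'k::field \<Rightarrow> ('k, 'n::finite) sqmat \<Rightarrow> _"
  by unfold_locales (auto simp: mat_scale_def vec_eq_iff algebra_simps)

primrec mat_pow :: "('k::field, 'n::finite) sqmat \<Rightarrow> nat \<Rightarrow> ('k, 'n) sqmat"
  where
    "mat_pow A 0 = mat 1"
  | "mat_pow A (Suc m) = A ** mat_pow A m"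

definition strict_upper :: "('k::field, 'n::{finite,linorder}) sqmat set"
  where "strict_upper = {A. \<forall>i j. j \<le> i \<longrightarrow> A $ i $ j = 0}"

text \<open>
  The exponential series stops at \<open>N - 1\<close> since \<open>A\<^sup>N = 0\<close> for \<open>A \<in> strict_upper\<close>. The
  factorials that occur are invertible if the characteristic is at least \<open>N\<close>.
\<close>

definition mat_exp :: "('k::field, 'n::finite) sqmat \<Rightarrow> ('k, 'n) sqmat"
  where "mat_exp A = (\<Sum>m<CARD('n). mat_scale (1 / of_nat (fact m)) (mat_pow A m))"

definition lie_bracket :: "('k::field, 'n::finite) sqmat \<Rightarrow> ('k, 'n) sqmat \<Rightarrow> ('k, 'n) sqmat"
  where "lie_bracket A B = A ** B - B ** A"

definition lie_subalgebra :: "('k::field, 'n::finite) sqmat set \<Rightarrow> ('k, 'n) sqmat set \<Rightarrow> bool"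
  where "lie_subalgebra \<gg> \<aa> \<longleftrightarrow> \<gg> \<subseteq> \<aa> \<and> mat_space.subspace \<gg> \<and>
    (\<forall>A\<in>\<gg>. \<forall>B\<in>\<gg>. lie_bracket A B \<in> \<gg>)"

definition exp_group :: "('k::field, 'n::finite) sqmat set \<Rightarrow> ('k, 'n) sqmat monoid"
  where "exp_group \<gg> = \<lparr>carrier = mat_exp ` \<gg>, mult = (**), one = mat 1\<rparr>"


section \<open>Coadjoint orbits and the orbit method\<close>

text \<open>Linear forms on \<open>\<gg>\<close> are \<^const>\<open>undefined\<close> outside \<open>\<gg>\<close>, so that equality of forms is
  equality of functions.\<close>

definition dual :: "('k::field, 'n::finite) sqmat set \<Rightarrow> (('k, 'n) sqmat \<Rightarrow> 'k) set"
  where "dual \<gg> = {l \<in> extensional \<gg>. linear_map_on mat_scale (*) \<gg> l}"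

definition dual_projection ::
  "('k::field, 'n::finite) sqmat set \<Rightarrow> (('k, 'n) sqmat \<Rightarrow> 'k) \<Rightarrow> ('k, 'n) sqmat \<Rightarrow> 'k"
  where "dual_projection \<hh> l = restrict l \<hh>"

definition coadjoint ::
  "('k::field, 'n::finite) sqmat set \<Rightarrow> ('k, 'n) sqmat \<Rightarrow> (('k, 'n) sqmat \<Rightarrow> 'k) \<Rightarrow>
    ('k, 'n) sqmat \<Rightarrow> 'k"
  where "coadjoint \<gg> g = (\<lambda>l\<in>dual \<gg>. \<lambda>A\<in>\<gg>. l (matrix_inv g ** A ** g))"

definition coadjoint_orbits :: "('k::field, 'n::finite) sqmat set \<Rightarrow> (('k, 'n) sqmat \<Rightarrow> 'k) set set"
  where "coadjoint_orbits \<gg> = orbits (exp_group \<gg>) (dual \<gg>) (coadjoint \<gg>)"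

definition isotropic ::
  "('k::field, 'n::finite) sqmat set \<Rightarrow> (('k, 'n) sqmat \<Rightarrow> 'k) \<Rightarrow> ('k, 'n) sqmat set \<Rightarrow> bool"
  where "isotropic \<gg> l W \<longleftrightarrow> mat_space.subspace W \<and> W \<subseteq> \<gg> \<and>
    (\<forall>A\<in>W. \<forall>B\<in>W. l (lie_bracket A B) = 0)"

definition polarization ::
  "('k::field, 'n::finite) sqmat set \<Rightarrow> (('k, 'n) sqmat \<Rightarrow> 'k) \<Rightarrow> ('k, 'n) sqmat set \<Rightarrow> bool"
  where "polarization \<gg> l \<pp> \<longleftrightarrow> lie_subalgebra \<pp> \<gg> \<and> isotropic \<gg> l \<pp> \<and>
    (\<forall>W. isotropic \<gg> l W \<and> \<pp> \<subseteq> W \<longrightarrow> W = \<pp>)"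

definition nontrivial_additive_character :: "('k::field \<Rightarrow> complex) \<Rightarrow> bool"
  where "nontrivial_additive_character \<psi> \<longleftrightarrow>
    (\<forall>x. \<psi> x \<noteq> 0) \<and> (\<forall>x y. \<psi> (x + y) = \<psi> x * \<psi> y) \<and> (\<exists>x. \<psi> x \<noteq> 1)"

text \<open>\<open>mat_exp\<close> is injective on \<open>strict_upper\<close> if the characteristic is at least \<open>N\<close>.\<close>

definition exp_character ::
  "('k \<Rightarrow> complex) \<Rightarrow> ('k::field, 'n::finite) sqmat set \<Rightarrow> (('k, 'n) sqmat \<Rightarrow> 'k) \<Rightarrow>
    ('k, 'n) sqmat \<Rightarrow> complex"
  where "exp_character \<psi> \<pp> l g = \<psi> (l (the_inv_into \<pp> mat_exp g))"

text \<open>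
  The equivalence class of representations attached to a coadjoint orbit is given as a
  predicate: \<open>R\<close> is equivalent to a representation induced from a polarization of some
  linear form in \<open>\<Omega>\<close>.
\<close>

definition orbit_rep ::
  "('k \<Rightarrow> complex) \<Rightarrow> ('k::field, 'n::finite) sqmat set \<Rightarrow> (('k, 'n) sqmat \<Rightarrow> 'k) set \<Rightarrow>
    (('k, 'n) sqmat, 'b) rep \<Rightarrow> bool"
  where "orbit_rep \<psi> \<gg> \<Omega> R \<longleftrightarrow>
    (\<exists>l\<in>\<Omega>. \<exists>\<pp>. polarization \<gg> l \<pp> \<and>
      equivalent_rep (exp_group \<gg>) R
        (induced_rep (exp_group \<gg>) (mat_exp ` \<pp>) (exp_character \<psi> \<pp> l)))"

end

theory Submission
  imports Defs
begin

text \<open>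
  If \<open>T\<close> is induced from \<open>\<xi>\<close> on \<open>P\<close> and \<open>t\<close> from \<open>\<eta>\<close> on \<open>Q\<close>, then by Frobenius reciprocity and
  Mackey's argument \<open>t\<close> occurs in the restriction of \<open>T\<close> iff for some \<open>x \<in> G\<close> the characters \<open>\<eta>\<close>
  and \<open>q \<mapsto> \<xi> (x q x\<^sup>-\<^sup>1)\<close> agree on \<open>Q \<inter> x\<^sup>-\<^sup>1 P x\<close>. Since \<open>\<psi>\<close> is nontrivial, this says that two linear
  forms agree on a subspace. As a polarization is its own orthogonal space, the form on \<open>Q\<close> can
  be matched by changing \<open>\<lambda>\<close> outside \<open>\<pp>\<close>, and counting shows that \<open>P\<close> acts transitively on the
  forms that agree with \<open>\<lambda>\<close> on \<open>\<pp>\<close>. So the condition becomes \<open>\<pi> \<Omega> \<inter> \<omega> \<noteq> {}\<close>. The same argument with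
  \<open>G = H\<close> shows that \<open>t\<close> is irreducible. No character theory is involved.

  That exponentials of Lie algebras are groups is derived from logarithmic derivatives in place of the
  Baker-Campbell-Hausdorff formula: \<open>exp (- t (x + y)) exp (t x) exp (t y)\<close> has a logarithmic
  derivative with coefficients in the ideal of brackets, hence it is a product of exponentials of
  elements of this ideal.
\<close>

unbundle no vec_syntax

section \<open>Truncated exponentials in a filtered ring\<close>

text \<open>The obstacle is the characteristic: for p = N only the integers 1, ..., N - 1 may be
  inverted. The identities on products and conjugates are therefore proved for series in t whose
  n-th coefficient lies in the n-th step of a filtration. Coefficients from N on vanish, those with
  0 < n < N are recovered from t d/dt by dividing by n, and t = 1 gives the identity in the ring.
  Corrections are never computed, only located in a freely chosen subspace. In \<open>E_mult\<close>
  this is any D with [L, L] \<subseteq> D \<subseteq> L: D = L makes \<open>exp_group\<close> a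
  group, while D = kernel of the form on its polarization makes \<open>exp_character\<close>
  multiplicative. Conjugation is expanded only to first order, modulo a subspace J chosen in the
  same spirit. Characters are compared with linear forms through one lemma,
  \<open>agree_after_translation\<close>: characters that agree on a set closed under scalars come
  from equal forms. It serves both for irreducibility and for the restriction to H.\<close>

locale graded_exp =
  fixes s :: "'k::field \<Rightarrow> 'r::ring_1" and u :: "nat \<Rightarrow> 'r set" and N :: nat
  assumes s_add: "s (a + b) = s a + s b"
    and s_mult: "s (a * b) = s a * s b"
    and s_one: "s 1 = 1"
    and s_central: "s a * x = x * s a"
    and u_zero: "0 \<in> u k"
    and u_add: "x \<in> u k \<Longrightarrow> y \<in> u k \<Longrightarrow> x + y \<in> u k"
    and u_scale: "x \<in> u k \<Longrightarrow> s a * x \<in> u k"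
    and u_0: "1 \<in> u 0"
    and u_mult: "x \<in> u i \<Longrightarrow> y \<in> u j \<Longrightarrow> x * y \<in> u (i + j)"
    and u_Suc: "u (Suc k) \<subseteq> u k"
    and u_N: "u N = {0}"
    and N_pos: "0 < N"
    and N_char: "0 < m \<Longrightarrow> m < N \<Longrightarrow> (of_nat m :: 'k) \<noteq> 0"
begin

sublocale V: vector_space "\<lambda>a x. s a * x"
  by unfold_locales (auto simp: algebra_simps s_add s_mult s_one)

lemma s_of_nat: "s (of_nat m) = of_nat m"
proof -
  have "s 0 = 0" using s_add[of 0 0] by simp
  then show ?thesis by (induction m) (auto simp: s_add s_one)
qed

lemma u_subspace: "V.subspace (u k)"
  by (auto simp: V.subspace_def u_zero u_add u_scale)

lemma u_antimono: "i \<le> j \<Longrightarrow> u j \<subseteq> u i"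
  using lift_Suc_antimono_le[of u i j] u_Suc by blast

lemma u_large: "N \<le> n \<Longrightarrow> x \<in> u n \<Longrightarrow> x = 0"
  using u_antimono[of N n] u_N by auto

lemma u_uminus: "x \<in> u k \<Longrightarrow> - x \<in> u k"
  by (rule V.subspace_neg[OF u_subspace])

lemma u_power: "z \<in> u k \<Longrightarrow> z ^ m \<in> u (k * m)"
  by (induction m) (use u_mult u_0 in auto)

lemma nilpotent: "z \<in> u 1 \<Longrightarrow> N \<le> m \<Longrightarrow> z ^ m = 0"
  using u_power[of z 1 m] u_large by auto

text \<open>Division by n is multiplication by the scalar 1 / n, which exists for 0 < n < N.
  Together with \<open>ifact_Suc\<close> this is where the bound on the characteristic enters the
  locale.\<close>

lemma divide_nat:
  assumes "V.subspace J" "0 < n" "n < N" "of_nat n * x \<in> J"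
  shows "x \<in> J"
proof -
  have "s (1 / of_nat n) * (of_nat n * x) \<in> J"
    using assms by (simp add: V.subspace_scale)
  moreover have "s (1 / of_nat n) * (of_nat n * x) = x"
    using N_char[OF assms(2,3)] s_mult[of "1 / of_nat n" "of_nat n"]
    by (simp add: s_of_nat s_one flip: mult.assoc)
  ultimately show ?thesis by simp
qed

section \<open>Exponentials as power series in an auxiliary variable t\<close>

definition ifact :: "nat \<Rightarrow> 'r" where "ifact m = s (1 / of_nat (fact m))"

lemma ifact_0 [simp]: "ifact 0 = 1"
  by (simp add: ifact_def s_one)

text \<open>When the index reaches the characteristic, the factorial becomes 0 in the field and
  \<open>ifact\<close> is 0 by the convention for division by zero, so the recursion breaks down
  there.\<close>

lemma ifact_Suc: "Suc m < N \<Longrightarrow> of_nat (Suc m) * ifact (Suc m) = ifact m"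
proof -
  assume "Suc m < N"
  then have "of_nat (Suc m) * (1 / of_nat (fact (Suc m))) = (1 / of_nat (fact m) :: 'k)"
    using N_char[of "Suc m"]
    by (simp only: fact_Suc of_nat_mult of_nat_id) (simp del: of_nat_Suc)
  then show ?thesis by (simp only: ifact_def flip: s_of_nat s_mult)
qed

definition E :: "'r \<Rightarrow> 'r" where "E x = (\<Sum>m<N. ifact m * x ^ m)"

lemma E_0 [simp]: "E 0 = 1"
proof -
  have "E 0 = (\<Sum>m<N. if m = 0 then 1 else 0)"
    unfolding E_def by (rule sum.cong) (auto simp: power_0_left)
  also have "\<dots> = 1" using N_pos by simp
  finally show ?thesis .
qed

definition monomial :: "nat \<Rightarrow> 'r \<Rightarrow> 'r fps"
  where "monomial k z = Abs_fps (\<lambda>n. if n = k then z else 0)"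

text \<open>The derivation \<open>t d/dt\<close>: it determines the coefficients with index \<open>0 < n < N\<close>, as \<open>n\<close> is invertible.\<close>

definition euler :: "'r fps \<Rightarrow> 'r fps"
  where "euler f = Abs_fps (\<lambda>n. of_nat n * f $ n)"

text \<open>The series \<open>exp (t\<^sup>k z)\<close>, truncated where \<open>z ^ m = 0\<close>.\<close>

definition exp_fps :: "nat \<Rightarrow> 'r \<Rightarrow> 'r fps"
  where "exp_fps k z = Abs_fps (\<lambda>n. if k dvd n \<and> n div k < N then ifact (n div k) * z ^ (n div k) else 0)"

text \<open>Coefficients from index N on vanish by \<open>u_N\<close>, so a graded series is a
  polynomial in t of degree below N and can be evaluated at t = 1.\<close>

definition graded :: "'r fps \<Rightarrow> bool" where "graded f \<longleftrightarrow> (\<forall>n. f $ n \<in> u n)"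

text \<open>The value at t = 1. For graded series the cut at N loses nothing, and products are
  respected (\<open>ev_mult\<close>).\<close>

definition ev :: "'r fps \<Rightarrow> 'r" where "ev f = (\<Sum>n<N. f $ n)"

lemma monomial_nth: "monomial k z $ n = (if n = k then z else 0)"
  by (simp add: monomial_def)

lemma euler_nth: "euler f $ n = of_nat n * f $ n"
  by (simp add: euler_def)

lemma monomial_mult_nth: "(monomial k z * f) $ n = (if n < k then 0 else z * f $ (n - k))"
proof -
  have "(monomial k z * f) $ n = (\<Sum>i=0..n. if i = k then z * f $ (n - i) else 0)"
    unfolding fps_mult_nth by (rule sum.cong) (auto simp: monomial_nth)
  then show ?thesis by (simp add: sum.delta)
qed

lemma mult_monomial_nth: "(f * monomial k z) $ n = (if n < k then 0 else f $ (n - k) * z)"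
proof -
  have "(f * monomial k z) $ n = (\<Sum>i=0..n. if i = n - k then (if n < k then 0 else f $ (n - k) * z) else 0)"
    unfolding fps_mult_nth by (rule sum.cong) (auto simp: monomial_nth)
  then show ?thesis by (simp add: sum.delta)
qed

lemma monomial_monomial: "monomial i a * monomial j b = monomial (i + j) (a * b)"
  by (rule fps_ext) (auto simp: monomial_mult_nth monomial_nth)

lemma monomial_add: "monomial k (a + b) = monomial k a + monomial k b"
  by (rule fps_ext) (simp add: monomial_nth)

lemma monomial_uminus: "monomial k (- a) = - monomial k a"
  by (rule fps_ext) (simp add: monomial_nth)

lemma euler_mult: "euler (f * g) = euler f * g + f * euler g"
proof (rule fps_ext)
  fix n
  have *: "a * (of_nat m * b) = of_nat m * (a * b)" for a b :: 'r and m
    by (metis mult.assoc mult_of_nat_commute)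
  have "of_nat n * (f $ i * g $ (n - i)) =
      of_nat i * f $ i * g $ (n - i) + f $ i * (of_nat (n - i) * g $ (n - i))" if "i \<le> n" for i
    using that by (simp add: * of_nat_diff algebra_simps)
  then show "euler (f * g) $ n = (euler f * g + f * euler g) $ n"
    by (simp add: euler_nth fps_mult_nth sum_distrib_left flip: sum.distrib)
qed

lemma euler_monomial: "euler (monomial k z) = monomial k (of_nat k * z)"
  by (rule fps_ext) (simp add: euler_nth monomial_nth)

lemma exp_fps_nth_0: "exp_fps k z $ 0 = 1"
  using N_pos by (simp add: exp_fps_def)

lemma exp_fps_nth_less: "0 < n \<Longrightarrow> n < k \<Longrightarrow> exp_fps k z $ n = 0"
  by (auto simp: exp_fps_def dest: dvd_imp_le)

lemma exp_fps_nth_self: "0 < k \<Longrightarrow> 1 < N \<Longrightarrow> exp_fps k z $ k = z"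
  using ifact_Suc[of 0] by (simp add: exp_fps_def)

lemma ifact_central: "ifact m * x = x * ifact m"
  by (simp add: ifact_def s_central)

lemma exp_fps_commute:
  assumes "w * z = z * w"
  shows "monomial k w * exp_fps j z = exp_fps j z * monomial k w"
proof (rule fps_ext)
  fix n
  have "w * (ifact m * z ^ m) = ifact m * z ^ m * w" for m
    using power_commuting_commutes[OF assms[symmetric], of m]
    by (metis ifact_central mult.assoc)
  then show "(monomial k w * exp_fps j z) $ n = (exp_fps j z * monomial k w) $ n"
    by (auto simp: monomial_mult_nth mult_monomial_nth exp_fps_def)
qed

text \<open>Since z commutes with its own powers, the usual logarithmic derivative k t^k z of
  exp(t^k z) survives in a noncommutative ring.\<close>

lemma euler_exp_fps:
  assumes k: "0 < k" and z: "z \<in> u 1"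
  shows "euler (exp_fps k z) = monomial k (of_nat k * z) * exp_fps k z"
proof (rule fps_ext)
  fix n
  consider "n = 0" | "\<not> k dvd n" | m where "n = k * Suc m"
    by (metis dvd_def mult_0_right not0_implies_Suc)
  then show "euler (exp_fps k z) $ n = (monomial k (of_nat k * z) * exp_fps k z) $ n"
  proof cases
    case 1
    then show ?thesis using k by (simp add: euler_nth monomial_mult_nth del: fps_mult_nth_0)
  next
    case 2
    then have "k \<le> n \<Longrightarrow> \<not> k dvd n - k"
      by (simp add: dvd_minus_self)
    then show ?thesis using 2 by (auto simp: euler_nth monomial_mult_nth exp_fps_def)
  next
    case 3
    have n: "n div k = Suc m" "n - k = k * m" "k dvd n" "\<not> n < k" "(n - k) div k = m" "k dvd n - k"
      using 3 k by auto
    have R: "(monomial k (of_nat k * z) * exp_fps k z) $ n = (if m < N then of_nat k * (ifact m * z ^ Suc m) else 0)"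
    proof -
      have "z * (ifact m * z ^ m) = ifact m * z ^ Suc m"
        by (metis ifact_central mult.assoc power_Suc)
      then show ?thesis by (simp only: monomial_mult_nth exp_fps_def n fps_nth_Abs_fps) (simp add: mult.assoc)
    qed
    have L: "euler (exp_fps k z) $ n = (if Suc m < N then of_nat n * (ifact (Suc m) * z ^ Suc m) else 0)"
      by (simp only: euler_nth exp_fps_def n fps_nth_Abs_fps) simp
    have nn: "(of_nat n :: 'r) = of_nat k * of_nat (Suc m)"
      using 3 by (simp only: of_nat_mult)
    show ?thesis
    proof (cases "Suc m < N")
      case True
      then have "of_nat n * (ifact (Suc m) * z ^ Suc m) = of_nat k * (ifact m * z ^ Suc m)"
        using ifact_Suc[OF True] by (simp only: nn mult.assoc) (simp only: flip: mult.assoc)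
      then show ?thesis using True by (simp only: L R) simp
    next
      \<comment> \<open>The two sides are truncated at different places: at \<open>Suc m = N\<close>
        only the right side still has a term, and it contains \<open>z ^ N = 0\<close>.\<close>
      case False
      then have "z ^ Suc m = 0" using nilpotent[OF z, of "Suc m"] by simp
      then show ?thesis using False by (simp only: L R) simp
    qed
  qed
qed

lemma graded_mult: "graded f \<Longrightarrow> graded g \<Longrightarrow> graded (f * g)"
  unfolding graded_def fps_mult_nth
  by (metis (no_types, lifting) V.subspace_sum[OF u_subspace] atLeastAtMost_iff le_add_diff_inverse u_mult)

text \<open>The exponent of t matches the depth of z: \<open>z ^ m\<close> lies in
  \<open>u (k * m)\<close> and sits at index k m.\<close>

lemma graded_exp_fps: "0 < k \<Longrightarrow> z \<in> u k \<Longrightarrow> graded (exp_fps k z)"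
  unfolding graded_def exp_fps_def ifact_def
  using u_power[of z k] u_zero u_scale by (auto elim!: dvdE)

lemma graded_large: "graded f \<Longrightarrow> N \<le> n \<Longrightarrow> f $ n = 0"
  unfolding graded_def using u_large by blast

text \<open>Products of coefficients with i + j \<ge> N lie in \<open>u N\<close> or deeper and
  vanish, so the square of index pairs and the triangle i + j < N give the same sum.\<close>

lemma ev_mult:
  assumes "graded f" "graded g"
  shows "ev (f * g) = ev f * ev g"
proof -
  have 0: "f $ i * g $ j = 0" if "N \<le> i + j" for i j
    using assms u_mult[of "f $ i" i "g $ j" j] u_large[OF that] by (auto simp: graded_def)
  have "ev f * ev g = (\<Sum>(i,j)\<in>{..<N} \<times> {..<N}. f $ i * g $ j)"
    by (simp add: ev_def sum_product sum.cartesian_product)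
  also have "\<dots> = (\<Sum>(i,j)\<in>{(i,j). i + j < N}. f $ i * g $ j)"
    by (rule sum.mono_neutral_right) (auto intro: 0 leI)
  also have "\<dots> = (\<Sum>n<N. \<Sum>i\<le>n. f $ i * g $ (n - i))"
    by (rule sum.triangle_reindex)
  finally show ?thesis by (simp add: ev_def fps_mult_nth atLeast0AtMost)
qed

text \<open>Evaluation cuts at k m < N while \<open>E\<close> cuts at m < N; the powers in between
  vanish because \<open>z ^ m\<close> lies in \<open>u (k * m)\<close>.\<close>

lemma ev_exp_fps:
  assumes k: "0 < k" and z: "z \<in> u k"
  shows "ev (exp_fps k z) = E z"
proof -
  have less: "m < N" if "k * m < N" for m
  proof -
    have "m \<le> k * m" using k by simp
    then show ?thesis using that by (rule le_less_trans)
  qed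
  have "E z = (\<Sum>m\<in>{m. k * m < N}. ifact m * z ^ m)"
    unfolding E_def
  proof (rule sum.mono_neutral_right)
    show "{m. k * m < N} \<subseteq> {..<N}" using less by auto
    show "\<forall>m\<in>{..<N} - {m. k * m < N}. ifact m * z ^ m = 0"
    proof
      fix m assume "m \<in> {..<N} - {m. k * m < N}"
      then have "z ^ m = 0" using u_large[OF _ u_power[OF z]] by (simp add: not_less)
      then show "ifact m * z ^ m = 0" by simp
    qed
  qed auto
  also have "\<dots> = (\<Sum>n\<in>(\<lambda>m. k * m) ` {m. k * m < N}. exp_fps k z $ n)"
  proof (subst sum.reindex)
    show "inj_on ((*) k) {m. k * m < N}" using k by (auto simp: inj_on_def)
    show "(\<Sum>m | k * m < N. ifact m * z ^ m) = sum ((\<lambda>n. exp_fps k z $ n) \<circ> (*) k) {m. k * m < N}"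
      using k less by (intro sum.cong) (auto simp: exp_fps_def)
  qed
  also have "\<dots> = ev (exp_fps k z)"
    unfolding ev_def by (rule sum.mono_neutral_left) (auto simp: exp_fps_def)
  finally show ?thesis ..
qed

lemma of_nat_eq_0D: "0 < n \<Longrightarrow> n < N \<Longrightarrow> of_nat n * x = 0 \<Longrightarrow> x = (0::'r)"
  using divide_nat[of "{0}" n x] by (simp add: V.subspace_single_0)

text \<open>The product is killed by \<open>euler\<close> and has constant term 1. Coefficients with
  0 < n < N vanish since n is invertible, the later ones by the grading.\<close>

lemma exp_fps_inverse:
  assumes k: "0 < k" and z: "z \<in> u k"
  shows "exp_fps k (- z) * exp_fps k z = 1"
proof -
  have z1: "z \<in> u 1" "- z \<in> u 1" using u_antimono[of 1 k] k z u_uminus by auto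
  let ?F = "exp_fps k (- z) * exp_fps k z"
  have c: "monomial k (of_nat k * z) * exp_fps k (- z) = exp_fps k (- z) * monomial k (of_nat k * z)"
    by (rule exp_fps_commute) (metis mult.assoc mult_minus_left mult_minus_right mult_of_nat_commute)
  have "euler ?F = monomial k (of_nat k * (- z)) * exp_fps k (-z) * exp_fps k z
      + exp_fps k (-z) * (monomial k (of_nat k * z) * exp_fps k z)"
    by (simp only: euler_mult euler_exp_fps[OF k z1(1)] euler_exp_fps[OF k z1(2)])
  also have "\<dots> = 0"
    by (simp only: mult_minus_right monomial_uminus) (simp add: c flip: mult.assoc)
  finally have 0: "of_nat n * ?F $ n = 0" for n
    by (metis euler_nth fps_zero_nth)
  have g: "graded ?F"
    by (intro graded_mult graded_exp_fps k z u_uminus)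
  have "?F $ n = 1 $ n" for n
    using 0[of n] of_nat_eq_0D[of n "?F $ n"] graded_large[OF g, of n]
    by (cases "n = 0"; cases "n < N") (auto simp: exp_fps_nth_0)
  then show ?thesis by (rule fps_ext)
qed

lemma exp_fps_inverse':
  "0 < k \<Longrightarrow> z \<in> u k \<Longrightarrow> exp_fps k z * exp_fps k (- z) = 1"
  using exp_fps_inverse[of k "- z"] u_uminus by simp

lemma ev_one: "ev 1 = 1"
proof -
  have "ev 1 = (\<Sum>n<N. if n = 0 then 1 else 0)"
    unfolding ev_def by (rule sum.cong) auto
  then show ?thesis using N_pos by simp
qed

lemma E_inverse: "z \<in> u 1 \<Longrightarrow> E (- z) * E z = 1"
  using ev_mult[OF graded_exp_fps graded_exp_fps, of 1 "- z" 1 z]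
  by (simp add: exp_fps_inverse ev_exp_fps u_uminus ev_one)

section \<open>Conjugation by exponentials\<close>

lemma euler_conj:
  assumes k: "0 < k" and z: "z \<in> u 1"
  shows "euler (exp_fps k (- z) * monomial 0 b * exp_fps k z) =
    exp_fps k (- z) * monomial 0 b * exp_fps k z * monomial k (of_nat k * z)
    - monomial k (of_nat k * z) * (exp_fps k (- z) * monomial 0 b * exp_fps k z)"
proof -
  have c: "monomial k (of_nat k * z) * exp_fps k z = exp_fps k z * monomial k (of_nat k * z)"
    by (rule exp_fps_commute) (metis mult.assoc mult_of_nat_commute)
  have 0: "euler (monomial 0 b) = 0" by (rule fps_ext) (simp add: euler_monomial monomial_nth)
  show ?thesis
    unfolding euler_mult euler_exp_fps[OF k z] euler_exp_fps[OF k u_uminus[OF z]] 0 c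
    by (simp add: monomial_uminus algebra_simps)
qed

text \<open>Comparison of coefficients in \<open>euler_conj\<close>: up to scalars every coefficient
  is a bracket of an earlier one with z. This is the recursion behind the series of iterated
  brackets.\<close>

lemma conj_recursion:
  fixes b z k
  assumes k: "0 < k" and z: "z \<in> u 1"
  defines "q \<equiv> exp_fps k (- z) * monomial 0 b * exp_fps k z"
  shows "q $ 0 = b"
    and "of_nat n * q $ n =
      (if n < k then 0 else of_nat k * (q $ (n - k) * z - z * q $ (n - k)))"
proof -
  show "q $ 0 = b" by (simp add: q_def exp_fps_nth_0 monomial_nth)
  have "of_nat n * q $ n = (q * monomial k (of_nat k * z) - monomial k (of_nat k * z) * q) $ n"
    unfolding q_def euler_conj[OF k z, symmetric] by (simp add: euler_nth)
  also have "\<dots> = (if n < k then 0 else of_nat k * (q $ (n - k) * z - z * q $ (n - k)))"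
    by (simp add: monomial_mult_nth mult_monomial_nth right_diff_distrib)
      (metis mult.assoc mult_of_nat_commute)
  finally show "of_nat n * q $ n = \<dots>" .
qed

lemma of_nat_scale: "V.subspace J \<Longrightarrow> x \<in> J \<Longrightarrow> of_nat n * x \<in> J"
  using V.subspace_scale[of J x "of_nat n"] by (simp add: s_of_nat)

lemma conj_in_subspace:
  assumes k: "0 < k" and z: "z \<in> u 1" and J: "V.subspace J"
    and zJ: "\<And>v. v \<in> J \<Longrightarrow> v * z - z * v \<in> J"
    and b: "b \<in> J" and n: "n < N"
  shows "(exp_fps k (- z) * monomial 0 b * exp_fps k z) $ n \<in> J"
  using n
proof (induction n rule: less_induct)
  case (less n)
  show ?case
  proof (cases "n = 0")
    case True
    then show ?thesis using conj_recursion(1)[OF k z] b by simp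
  next
    case False
    show ?thesis
      by (rule divide_nat[OF J _ less.prems], use False in simp)
        (use less False k in \<open>auto simp: conj_recursion(2)[OF k z] V.subspace_0[OF J]
          intro!: of_nat_scale[OF J] zJ\<close>)
  qed
qed

text \<open>Expansion to first order: the coefficient at 1 is d, twice the one at 2 is [d, z], and J
  is stable under brackets with z, so everything from index 2 on falls into J.\<close>

lemma conj_mod_subspace:
  fixes b z d :: 'r
  assumes d: "d = b * z - z * b" and z: "z \<in> u 1" and J: "V.subspace J"
    and zJ: "\<And>v. v \<in> J \<Longrightarrow> v * z - z * v \<in> J"
    and b: "d * z - z * d \<in> J"
  shows "n < N \<Longrightarrow> (exp_fps 1 (- z) * monomial 0 b * exp_fps 1 z - monomial 0 b - monomial 1 d) $ n \<in> J"
proof (induction n)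
  case 0
  show ?case by (simp add: exp_fps_nth_0 monomial_nth V.subspace_0[OF J])
next
  case (Suc n)
  define q where "q = exp_fps 1 (- z) * monomial 0 b * exp_fps 1 z"
  have r: "of_nat (Suc m) * q $ Suc m = q $ m * z - z * q $ m" for m
    using conj_recursion(2)[of 1 z "Suc m" b] z by (simp add: q_def del: of_nat_Suc One_nat_def)
  have 0: "q $ 0 = b" using conj_recursion(1)[of 1 z b] z by (simp add: q_def)
  show ?case
  proof (cases "n = 0")
    case True
    then have "q $ Suc n = d" using r[of 0] 0 d by simp
    then show ?thesis unfolding q_def[symmetric] using True by (simp add: monomial_nth V.subspace_0[OF J])
  next
    case False
    have IH: "q $ n - monomial 1 d $ n \<in> J"
      using Suc.IH Suc.prems False unfolding q_def[symmetric] by (simp add: monomial_nth)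
    have "q $ Suc n \<in> J"
    proof (rule divide_nat[OF J _ Suc.prems], simp, unfold r)
      show "q $ n * z - z * q $ n \<in> J"
      proof (cases "n = 1")
        case True
        then show ?thesis using r[of 0] 0 b by (simp add: d)
      next
        case False
        then show ?thesis using IH zJ by (simp add: monomial_nth)
      qed
    qed
    then show ?thesis unfolding q_def[symmetric] using False by (simp add: monomial_nth)
  qed
qed

lemma ev_monomial: "b \<in> u 0 \<Longrightarrow> graded (monomial 0 b)" "ev (monomial 0 b) = b"
proof -
  show "graded (monomial 0 b)" if "b \<in> u 0" using that by (simp add: graded_def monomial_nth u_zero)
  have "ev (monomial 0 b) = (\<Sum>n<N. if n = 0 then b else 0)"
    unfolding ev_def by (rule sum.cong) (auto simp: monomial_nth)
  then show "ev (monomial 0 b) = b" using N_pos by simp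
qed

lemma E_conj:
  assumes z: "z \<in> u 1" and J: "V.subspace J"
    and zJ: "\<And>v. v \<in> J \<Longrightarrow> v * z - z * v \<in> J"
    and b: "(b * z - z * b) * z - z * (b * z - z * b) \<in> J"
    and u: "b \<in> u 1"
  shows "E (- z) * b * E z - b - (b * z - z * b) \<in> J"
proof (cases "1 < N")
  case True
  let ?q = "exp_fps 1 (- z) * monomial 0 b * exp_fps 1 z"
  have e: "graded (exp_fps 1 z)" "graded (exp_fps 1 (- z))" using z u_uminus by (auto intro: graded_exp_fps)
  have "E (- z) * b * E z = ev ?q"
    using e z u u_antimono[of 0 1] by (auto simp: ev_mult graded_mult ev_monomial ev_exp_fps u_uminus)
  moreover have "ev ?q - ev (monomial 0 b) - ev (monomial 1 (b * z - z * b)) \<in> J"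
    using conj_mod_subspace[OF refl z J zJ b]
    unfolding ev_def sum_subtractf[symmetric]
    by (intro V.subspace_sum[OF J]) auto
  moreover have "ev (monomial 1 c) = c" for c
  proof -
    have "ev (monomial 1 c) = (\<Sum>n<N. if n = 1 then c else 0)"
      unfolding ev_def by (rule sum.cong) (auto simp: monomial_nth)
    then show "ev (monomial 1 c) = c" using True by simp
  qed
  ultimately show ?thesis by (simp add: ev_monomial)
next
  case False
  then have "b = 0" "z = 0" using u_large[of 1] z u by auto
  then show ?thesis using V.subspace_0[OF J] by simp
qed

text \<open>Extends \<open>conj_in_subspace\<close> from constants to series: as t is central, the
  constant term is split off and the rest is t times a shifted series.\<close>

lemma conj_series_in_subspace:
  assumes k: "0 < k" and z: "z \<in> u 1" and J: "V.subspace J"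
    and zJ: "\<And>v. v \<in> J \<Longrightarrow> v * z - z * v \<in> J"
  shows "n < N \<Longrightarrow> (\<And>i. i < N \<Longrightarrow> f $ i \<in> J) \<Longrightarrow> (exp_fps k (- z) * f * exp_fps k z) $ n \<in> J"
proof (induction n arbitrary: f)
  case 0
  then show ?case by (simp add: exp_fps_nth_0)
next
  case (Suc n)
  \<comment> \<open>The shifted series is continued by zeros. The remainder \<open>h\<close>
    collects the coefficients from N on, about which nothing is assumed; it cannot influence indices
    below N.\<close>
  define g where "g = Abs_fps (\<lambda>n. if Suc n < N then f $ Suc n else 0)"
  define h where "h = Abs_fps (\<lambda>n. if N \<le> n then f $ n else 0)"
  have f: "f = monomial 0 (f $ 0) + monomial 1 1 * g + h"
    using N_pos by (intro fps_ext) (auto simp: g_def h_def monomial_mult_nth monomial_nth)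
  have hz: "(a * h * c) $ m = 0" if "m < N" for a c m
  proof -
    have "(a * h) $ i = 0" if "i \<le> m" for i
      unfolding fps_mult_nth using that \<open>m < N\<close> by (intro sum.neutral) (auto simp: h_def)
    then show ?thesis
      unfolding fps_mult_nth[of "a * h"] by (intro sum.neutral) auto
  qed
  have sw: "exp_fps k (- z) * monomial 1 1 = monomial 1 1 * exp_fps k (- z)"
    by (rule exp_fps_commute[symmetric]) simp
  have "exp_fps k (- z) * f * exp_fps k z = exp_fps k (- z) * monomial 0 (f $ 0) * exp_fps k z
      + monomial 1 1 * (exp_fps k (- z) * g * exp_fps k z) + exp_fps k (- z) * h * exp_fps k z"
    by (subst f) (simp add: distrib_left distrib_right sw del: One_nat_def flip: mult.assoc)
  then have "(exp_fps k (- z) * f * exp_fps k z) $ Suc n = (exp_fps k (- z) * monomial 0 (f $ 0) * exp_fps k z) $ Suc n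
      + (exp_fps k (- z) * g * exp_fps k z) $ n"
    using hz[OF Suc.prems(1)] by (simp add: monomial_mult_nth)
  moreover have "(exp_fps k (- z) * g * exp_fps k z) $ n \<in> J"
    using Suc.prems by (intro Suc.IH) (auto simp: g_def V.subspace_0[OF J])
  moreover have "(exp_fps k (- z) * monomial 0 (f $ 0) * exp_fps k z) $ Suc n \<in> J"
    using Suc.prems N_pos by (intro conj_in_subspace[OF k z J zJ]) auto
  ultimately show ?case using V.subspace_add[OF J] by simp
qed

section \<open>Products of exponentials\<close>

text \<open>
  A graded series whose logarithmic derivative has coefficients in \<open>J\<close> is a product of
  factors \<open>exp (t\<^sup>k z\<^sub>k)\<close> with \<open>z\<^sub>k \<in> J\<close>; they are split off one by one.
\<close>

lemma absorb_series:
  assumes J: "V.subspace J" and JJ: "\<And>v z. v \<in> J \<Longrightarrow> z \<in> J \<Longrightarrow> v * z - z * v \<in> J"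
    and LJ: "\<And>a w. a \<in> L \<Longrightarrow> w \<in> J \<Longrightarrow> a + w \<in> L"
    and absorb: "\<And>a z. a \<in> L \<Longrightarrow> z \<in> J \<Longrightarrow> \<exists>w\<in>J. E a * E z = E (a + w)"
  shows "graded f \<Longrightarrow> f $ 0 = 1 \<Longrightarrow> (\<And>j. 0 < j \<Longrightarrow> j < k \<Longrightarrow> f $ j = 0) \<Longrightarrow>
    (\<And>n. n < N \<Longrightarrow> c $ n \<in> J) \<Longrightarrow> euler f = c * f \<Longrightarrow> a \<in> L \<Longrightarrow> 0 < k \<Longrightarrow>
    \<exists>w\<in>J. E a * ev f = E (a + w)"
proof (induction "N - k" arbitrary: k f c a)
  case 0
  have "f $ n = 1 $ n" for n
    using 0 graded_large[OF 0(2), of n] by (cases "n = 0"; cases "n < k") auto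
  then have "f = 1" by (rule fps_ext)
  then show ?case using V.subspace_0[OF J] by (auto simp: ev_one intro: bexI[of _ 0])
next
  case (Suc m)
  note k = \<open>0 < k\<close> and f = Suc.prems(1-3) and c = Suc.prems(4,5)
  have kN: "k < N" using Suc.hyps by simp
  define z where "z = f $ k"
  \<comment> \<open>Since f = 1 + O(t^k), the series c and c f agree up to index k, so there c has
    the coefficients of \<open>euler f\<close>. At index k this exhibits k z as an element of
    J.\<close>
  have cf: "c $ n = of_nat n * f $ n" if "n \<le> k" for n
    using that
  proof (induction n rule: less_induct)
    case (less n)
    have "(c * f) $ n = (\<Sum>i=0..n. c $ i * f $ (n - i))"
      by (rule fps_mult_nth)
    also have "\<dots> = (\<Sum>i=0..n. if i = n then c $ n else 0)"
    proof (rule sum.cong)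
      fix i assume i: "i \<in> {0..n}"
      show "c $ i * f $ (n - i) = (if i = n then c $ n else 0)"
      proof (cases "i = n")
        case False
        then have "c $ i = of_nat i * f $ i" "i < k" using less i by auto
        then show ?thesis using f(3)[of i] False by (cases "i = 0") auto
      qed (simp add: f(2))
    qed simp
    finally show ?case using c(2) by (simp flip: euler_nth)
  qed
  have zJ: "z \<in> J"
    using divide_nat[OF J k kN] c(1)[OF kN] cf[of k] by (simp add: z_def)
  have zu: "z \<in> u k" using f(1) by (simp add: z_def graded_def)
  have z1: "z \<in> u 1" "- z \<in> u 1" using zu u_antimono[of 1 k] k u_uminus by auto
  define f' where "f' = exp_fps k (- z) * f"
  \<comment> \<open>The logarithmic derivative of \<open>f'\<close>: the old one conjugated by the
    factor that is split off, minus the derivative of that factor.\<close>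
  define c' where "c' = exp_fps k (- z) * c * exp_fps k z - monomial k (of_nat k * z)"
  have ff': "f = exp_fps k z * f'"
    using exp_fps_inverse'[OF k zu] by (simp add: f'_def flip: mult.assoc)
  obtain w where w: "w \<in> J" "E a * E z = E (a + w)"
    using absorb[OF Suc.prems(6) zJ] by blast
  have gf': "graded f'" unfolding f'_def by (intro graded_mult graded_exp_fps k u_uminus zu f(1))
  have "\<exists>w'\<in>J. E (a + w) * ev f' = E (a + w + w')"
  \<comment> \<open>The new series differs from 1 only from index k + 1 on, and the base point moves
    from a to a + w, still in L.\<close>
  proof (rule Suc.hyps(1)[of "Suc k" f' c' "a + w"])
    show "graded f'" by (rule gf')
    show "f' $ 0 = 1" by (simp add: f'_def exp_fps_nth_0 f(2))
    show "f' $ j = 0" if "0 < j" "j < Suc k" for j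
    proof -
      have "f' $ j = (\<Sum>i=0..j. exp_fps k (- z) $ i * f $ (j - i))"
        by (simp add: f'_def fps_mult_nth)
      also have "\<dots> = (\<Sum>i\<in>{0,j}. exp_fps k (- z) $ i * f $ (j - i))"
      proof (rule sum.mono_neutral_right)
        show "\<forall>i\<in>{0..j} - {0, j}. exp_fps k (- z) $ i * f $ (j - i) = 0"
          using that by (auto simp: exp_fps_nth_less)
      qed auto
      also have "\<dots> = f $ j + exp_fps k (- z) $ j"
        using that f(2) by (simp add: exp_fps_nth_0)
      also have "\<dots> = 0"
        using that f(3)[of j] exp_fps_nth_less[of j k "- z"] exp_fps_nth_self[of k "- z"] kN k
        by (cases "j = k") (auto simp: z_def)
      finally show ?thesis .
    qed
    show "c' $ n \<in> J" if n: "n < N" for n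
    proof -
      have "(exp_fps k (- z) * c * exp_fps k z) $ n \<in> J"
        by (rule conj_series_in_subspace[OF k z1(1) J _ n]) (use JJ zJ c(1) in auto)
      moreover have "monomial k (of_nat k * z) $ n \<in> J"
        using of_nat_scale[OF J zJ] V.subspace_0[OF J] by (simp add: monomial_nth)
      ultimately show ?thesis
        unfolding c'_def fps_sub_nth by (rule V.subspace_diff[OF J])
    qed
    show "euler f' = c' * f'"
    proof -
      have "euler f' = - monomial k (of_nat k * z) * f' + exp_fps k (- z) * c * f"
        unfolding f'_def euler_mult euler_exp_fps[OF k z1(2)] c(2)
        by (simp add: monomial_uminus mult.assoc)
      also have "exp_fps k (- z) * c * f = exp_fps k (- z) * c * exp_fps k z * f'"
        by (simp add: ff' mult.assoc)
      finally show ?thesis by (simp add: c'_def algebra_simps)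
    qed
    show "a + w \<in> L" by (rule LJ[OF Suc.prems(6) w(1)])
  qed (use Suc.hyps(2) in auto)
  then obtain w' where w': "w' \<in> J" "E (a + w) * ev f' = E (a + w + w')" by blast
  have "E a * ev f = E a * E z * ev f'"
    by (subst ff') (simp add: ev_mult[OF graded_exp_fps[OF k zu] gf'] ev_exp_fps[OF k zu] mult.assoc)
  then have "E a * ev f = E (a + (w + w'))"
    using w w' by (simp add: add.assoc)
  then show ?case using V.subspace_add[OF J w(1) w'(1)] by blast
qed

text \<open>The assumption \<open>absorb\<close> is the claim for right factors in the smaller space
  J; \<open>E_mult\<close> supplies it by induction. J contains [y, x] and is stable under brackets
  with L, which puts the logarithmic derivative of \<open>F\<close> into J.\<close>

lemma E_mult_step:
  assumes J: "V.subspace J" and L: "V.subspace L" and Lu: "L \<subseteq> u 1"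
    and JL: "J \<subseteq> L" and LJ: "\<And>v z. v \<in> J \<Longrightarrow> z \<in> L \<Longrightarrow> v * z - z * v \<in> J"
    and absorb: "\<And>a z. a \<in> L \<Longrightarrow> z \<in> J \<Longrightarrow> \<exists>w\<in>J. E a * E z = E (a + w)"
    and x: "x \<in> L" and y: "y \<in> L" and xy: "y * x - x * y \<in> J"
  shows "\<exists>w\<in>J. E x * E y = E (x + y + w)"
proof -
  have xyL: "x + y \<in> L" using V.subspace_add[OF L x y] .
  have m: "- x \<in> L" "- (x + y) \<in> L" using V.subspace_neg[OF L] x xyL by blast+
  have u: "x \<in> u 1" "y \<in> u 1" "x + y \<in> u 1" "- x \<in> u 1" "- (x + y) \<in> u 1"
    using x y xyL m Lu by auto
  have pos: "0 < (1::nat)" by simp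
  define T where "T = monomial 1"
  define F where "F = exp_fps 1 (- (x + y)) * exp_fps 1 x * exp_fps 1 y"
  define q where "q = exp_fps 1 x * monomial 0 y * exp_fps 1 (- x)"
  \<comment> \<open>This is t (exp(t x) y exp(- t x) - y), the excess of the logarithmic derivative
    of exp(t x) exp(t y) over t (x + y).\<close>
  define r where "r = T 1 * (q - monomial 0 y)"
  \<comment> \<open>the logarithmic derivative of \<open>F\<close>\<close>
  define c where "c = exp_fps 1 (- (x + y)) * r * exp_fps 1 (x + y)"
  have qJ: "(q - monomial 0 y) $ n \<in> J" if n: "n < N" for n
  proof -
    \<comment> \<open>The coefficient at 1 is minus the bracket of y with x and is added back
      afterwards; \<open>conj_mod_subspace\<close>, applied to - x, covers the rest.\<close>
    have "(q - monomial 0 y - monomial 1 (y * (- x) - (- x) * y)) $ n \<in> J"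
    proof -
      have "v * (- x) - (- x) * v \<in> J" if "v \<in> J" for v
        using LJ[OF that m(1)] .
      moreover have "y * (- x) - (- x) * y \<in> J" using V.subspace_neg[OF J xy] by simp
      ultimately show ?thesis
        unfolding q_def using conj_mod_subspace[OF refl u(4) J, of y n] n by simp
    qed
    moreover have "monomial 1 (y * (- x) - (- x) * y) $ n \<in> J"
      using V.subspace_neg[OF J xy] V.subspace_0[OF J] by (simp add: monomial_nth)
    ultimately show ?thesis using V.subspace_add[OF J] by fastforce
  qed
  have rJ: "r $ n \<in> J" if "n < N" for n
    using that qJ[of "n - 1"] V.subspace_0[OF J] by (simp add: r_def T_def monomial_mult_nth)
  have cJ: "c $ n \<in> J" if "n < N" for n
    unfolding c_def by (rule conj_series_in_subspace[OF pos u(3) J _ that rJ]) (use LJ xyL in auto)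
  have T: "T z * exp_fps 1 z = exp_fps 1 z * T z" "T z * exp_fps 1 (- z) = exp_fps 1 (- z) * T z" for z
    by (simp_all add: T_def exp_fps_commute)
  have e: "euler (exp_fps 1 z) = T z * exp_fps 1 z" if "z \<in> u 1" for z
    using euler_exp_fps[OF pos that] by (simp add: T_def)
  have r: "r = exp_fps 1 x * T y * exp_fps 1 (- x) - T y"
  proof -
    have "T 1 * q = exp_fps 1 x * (T 1 * monomial 0 y) * exp_fps 1 (- x)"
      using exp_fps_commute[of 1 x 1 1] by (simp add: q_def T_def mult.assoc[symmetric])
    then show ?thesis by (simp add: r_def right_diff_distrib T_def monomial_monomial)
  qed
  have "c * F = exp_fps 1 (- (x + y)) * (exp_fps 1 x * T y * exp_fps 1 (- x) - T y) * exp_fps 1 x * exp_fps 1 y"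
  proof -
    have "exp_fps 1 (x + y) * (exp_fps 1 (- (x + y)) * g) = g" for g
      using exp_fps_inverse'[OF pos u(3)] by (simp del: One_nat_def flip: mult.assoc)
    then show ?thesis unfolding c_def F_def r by (simp only: mult.assoc)
  qed
  also have "\<dots> = exp_fps 1 (- (x + y)) * exp_fps 1 x * T y * exp_fps 1 y - exp_fps 1 (- (x + y)) * T y * exp_fps 1 x * exp_fps 1 y"
  proof -
    have "exp_fps 1 (- x) * (exp_fps 1 x * g) = g" for g
      using exp_fps_inverse[OF pos u(1)] by (simp del: One_nat_def flip: mult.assoc)
    then show ?thesis by (simp add: left_diff_distrib right_diff_distrib mult.assoc del: One_nat_def)
  qed
  also have "\<dots> = euler F"
  proof -
    have "euler F = T (- (x + y)) * exp_fps 1 (- (x + y)) * exp_fps 1 x * exp_fps 1 y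
        + exp_fps 1 (- (x + y)) * (T x * exp_fps 1 x) * exp_fps 1 y + exp_fps 1 (- (x + y)) * exp_fps 1 x * (T y * exp_fps 1 y)"
      by (simp only: F_def euler_mult e[OF u(1)] e[OF u(2)] e[OF u(5)] distrib_right)
    also have "T (- (x + y)) * exp_fps 1 (- (x + y)) = - exp_fps 1 (- (x + y)) * (T x + T y)"
    proof -
      have "T (- (x + y)) * exp_fps 1 (- (x + y)) = - (T (x + y) * exp_fps 1 (- (x + y)))"
        by (simp only: T_def monomial_uminus mult_minus_left)
      also have "\<dots> = - exp_fps 1 (- (x + y)) * (T x + T y)"
        using T(2)[of "x + y"] by (simp only: T_def monomial_add mult_minus_left)
      finally show ?thesis .
    qed
    finally show ?thesis by (simp add: algebra_simps)
  qed
  finally have eF: "euler F = c * F" ..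
  have gF: "graded F" unfolding F_def by (intro graded_mult graded_exp_fps u pos)
  have "\<exists>w\<in>J. E (x + y) * ev F = E (x + y + w)"
  proof (rule absorb_series[OF J _ _ _ gF])
    show "v * z - z * v \<in> J" if "v \<in> J" "z \<in> J" for v z using LJ that JL by blast
    show "a + w \<in> L" if "a \<in> L" "w \<in> J" for a w using V.subspace_add[OF L] that JL by blast
    show "F $ 0 = 1" by (simp add: F_def exp_fps_nth_0)
    show "F $ j = 0" if "0 < j" "j < 1" for j using that by simp
  qed (use absorb cJ eF xyL in auto)
  moreover have "E (x + y) * ev F = E x * E y"
  proof -
    have "ev F = E (- (x + y)) * E x * E y"
      unfolding F_def
      by (simp only: ev_mult graded_mult graded_exp_fps u pos ev_exp_fps)
    moreover have "E (x + y) * E (- (x + y)) = 1"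
      using E_inverse[OF u(5)] by (simp only: minus_minus)
    ultimately show ?thesis by (simp flip: mult.assoc)
  qed
  ultimately show ?thesis by simp
qed

text \<open>This stands in for the Baker-Campbell-Hausdorff formula. For \<open>y \<in> L \<inter> u i\<close>
  the correction term is deeper in the filtration, which allows downward induction on \<open>i\<close>.\<close>

theorem E_mult:
  assumes L: "V.subspace L" and Lu: "L \<subseteq> u 1" and D: "V.subspace D" and DL: "D \<subseteq> L"
    and LD: "\<And>v z. v \<in> L \<Longrightarrow> z \<in> L \<Longrightarrow> v * z - z * v \<in> D"
    and x: "x \<in> L" and y: "y \<in> L"
  shows "\<exists>w\<in>D. E x * E y = E (x + y + w)"
proof -
  have "\<exists>w\<in>D \<inter> u (Suc i). E x * E y = E (x + y + w)" if "x \<in> L" "y \<in> L \<inter> u i" "0 < i" for x y i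
    using that
  proof (induction "N - i" arbitrary: i x y)
    case 0
    then have "y = 0" using u_large by auto
    then show ?case using V.subspace_0[OF D] u_zero by (auto intro: bexI[of _ 0])
  next
    case (Suc m)
    let ?J = "D \<inter> u (Suc i)"
    have J: "V.subspace ?J" using D u_subspace by (rule V.subspace_inter)
    have br: "v * z - z * v \<in> ?J" if "v \<in> L \<inter> u i" "z \<in> L" for v z
    proof -
      have "z \<in> u 1" using that Lu by auto
      then have "v * z \<in> u (Suc i)" "z * v \<in> u (Suc i)"
        using u_mult[of v i z 1] u_mult[of z 1 v i] that by auto
      then show ?thesis using LD that V.subspace_diff[OF u_subspace] by auto
    qed
    show ?case
    proof (rule E_mult_step[OF J L Lu])
      show "\<exists>w\<in>?J. E a * E z = E (a + w)" if "a \<in> L" "z \<in> ?J" for a z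
      proof -
        \<comment> \<open>As z lies one step deeper than y, the induction hypothesis applies; z then
          joins its correction term, and z + w stays in J.\<close>
        have "\<exists>w\<in>D \<inter> u (Suc (Suc i)). E a * E z = E (a + z + w)"
          by (rule Suc.hyps(1)) (use Suc.hyps(2) that DL in auto)
        then obtain w where w: "w \<in> D" "w \<in> u (Suc (Suc i))" "E a * E z = E (a + z + w)"
          by blast
        then have "w \<in> ?J" using u_Suc by blast
        then have "z + w \<in> ?J"
          using that V.subspace_add[OF J] by blast
        then show ?thesis using w(3) by (auto simp: add.assoc intro: bexI[of _ "z + w"])
      qed
      show "v * z - z * v \<in> ?J" if "v \<in> ?J" "z \<in> L" for v z
        using br[of v z] that DL u_Suc by blast
      show "y * x - x * y \<in> ?J" using br Suc.prems by blast
    qed (use Suc.prems DL in auto)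
  qed
  from this[of x y 1] show ?thesis using x y Lu by auto
qed

section \<open>Injectivity of the exponential\<close>

lemma power_diff_in:
  assumes "x \<in> u 1" "y \<in> u 1" "x - y \<in> u i" "0 < i"
  shows "x ^ Suc m - y ^ Suc m \<in> u (i + m)"
proof (induction m)
  case (Suc m)
  have "x ^ Suc (Suc m) - y ^ Suc (Suc m) = x * (x ^ Suc m - y ^ Suc m) + (x - y) * y ^ Suc m"
    by (simp add: algebra_simps)
  moreover have "x * (x ^ Suc m - y ^ Suc m) \<in> u (1 + (i + m))"
    using assms(1) Suc by (rule u_mult)
  moreover have "(x - y) * y ^ Suc m \<in> u (i + Suc m)"
    using u_mult[OF assms(3) u_power[OF assms(2), of "Suc m"]] by simp
  ultimately show ?case using u_add by simp
qed (use assms in simp)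

text \<open>If x - y lies in \<open>u i\<close> with i > 0, the terms of degree at least 2 in
  \<open>E x - E y\<close> lie in \<open>u (i + 1)\<close>, hence so does x - y. Iteration reaches
  \<open>u N\<close>, which is zero.\<close>

lemma E_inj: "inj_on E (u 1)"
proof (rule inj_onI)
  fix x y assume x: "x \<in> u 1" and y: "y \<in> u 1" and xy: "E x = E y"
  have "x - y \<in> u (Suc i)" for i
  proof (induction i)
    case 0
    then show ?case using V.subspace_diff[OF u_subspace] x y by simp
  next
    case (Suc i)
    show ?case
    proof (cases "1 < N")
      case False
      then have "x = 0" "y = 0" using x y u_large[of 1] by auto
      then show ?thesis using u_zero by simp
    next
      case True
      have "0 = (\<Sum>m<N. ifact m * (x ^ m - y ^ m))"
        using xy by (simp add: E_def right_diff_distrib sum_subtractf)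
      also have "{..<N} = insert 0 (insert 1 {2..<N})" using True by auto
      finally have "- (x - y) = (\<Sum>m\<in>{2..<N}. ifact m * (x ^ m - y ^ m))"
        using ifact_Suc[of 0] True
        by (simp add: eq_neg_iff_add_eq_0 algebra_simps)
      moreover have "(\<Sum>m\<in>{2..<N}. ifact m * (x ^ m - y ^ m)) \<in> u (Suc (Suc i))"
      proof (rule V.subspace_sum[OF u_subspace])
        fix m assume "m \<in> {2..<N}"
        then obtain l where "m = Suc (Suc l)"
          by (metis One_nat_def Suc_1 Suc_le_D Suc_le_mono atLeastLessThan_iff)
        then have "x ^ m - y ^ m \<in> u (Suc i + Suc l)"
          using power_diff_in[OF x y Suc, of "Suc l"] by (simp only:)
        then have "x ^ m - y ^ m \<in> u (Suc (Suc i))"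
          using u_antimono[of "Suc (Suc i)" "Suc i + Suc l"] by auto
        then show "ifact m * (x ^ m - y ^ m) \<in> u (Suc (Suc i))"
          unfolding ifact_def by (rule u_scale)
      qed
      ultimately have "- (x - y) \<in> u (Suc (Suc i))" by simp
      then show ?thesis using u_uminus[of "- (x - y)"] by simp
    qed
  qed
  from this[of N] show "x = y" using u_large[of "Suc N" "x - y"] by simp
qed

end

unbundle vec_syntax
unbundle no fps_syntax

section \<open>Matrices as a filtered ring\<close>

text \<open>The class operation \<open>*\<close> on \<open>'k^'n^'n\<close> is componentwise. A copy of the type carries the ring
  structure given by \<open>**\<close>, so that the library on power series applies.\<close>

typedef ('k, 'n) mring = "UNIV :: ('k^'n^'n) set" morphisms mat_of ring_of ..

setup_lifting type_definition_mring

lemma matrix_add_rdistrib: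
  "(A + B) ** C = A ** C + B ** (C :: ('k::field, 'n::finite) sqmat)"
  by (simp add: matrix_matrix_mult_def vec_eq_iff sum.distrib distrib_right)

instantiation mring :: (field, finite) ring_1
begin

lift_definition zero_mring :: "('a, 'b) mring" is 0 .
lift_definition one_mring :: "('a, 'b) mring" is "mat 1" .
lift_definition plus_mring :: "('a, 'b) mring \<Rightarrow> ('a, 'b) mring \<Rightarrow> ('a, 'b) mring" is "(+)" .
lift_definition minus_mring :: "('a, 'b) mring \<Rightarrow> ('a, 'b) mring \<Rightarrow> ('a, 'b) mring" is "(-)" .
lift_definition uminus_mring :: "('a, 'b) mring \<Rightarrow> ('a, 'b) mring" is uminus .
lift_definition times_mring :: "('a, 'b) mring \<Rightarrow> ('a, 'b) mring \<Rightarrow> ('a, 'b) mring" is "(**)" .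

instance
proof
  show "(0 :: ('a, 'b) mring) \<noteq> 1"
    by transfer (auto simp: mat_def vec_eq_iff)
qed (transfer; simp add: matrix_mul_assoc matrix_add_ldistrib matrix_add_rdistrib)+

end

lemma mat_of_sum: "mat_of (\<Sum>i\<in>I. f i) = (\<Sum>i\<in>I. mat_of (f i))"
  by (induction I rule: infinite_finite_induct) (auto simp: zero_mring.rep_eq plus_mring.rep_eq)

lemma mat_of_power: "mat_of (x ^ m) = mat_pow (mat_of x) m"
  by (induction m) (auto simp: one_mring.rep_eq times_mring.rep_eq)

lemma mat_of_ring_of [simp]: "mat_of (ring_of A) = A"
  by (simp add: ring_of_inverse)

definition scalar :: "'k \<Rightarrow> ('k::field, 'n::finite) mring"
  where "scalar c = ring_of (mat c)"

lemma mat_mult: "mat c ** A = mat_scale c (A :: ('k::field, 'n::finite) sqmat)"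
  by (simp add: mat_def matrix_matrix_mult_def mat_scale_def vec_eq_iff if_distrib if_distribR sum.delta cong: if_cong)

lemma mult_mat: "A ** mat c = mat_scale c (A :: ('k::field, 'n::finite) sqmat)"
  by (simp add: mat_def matrix_matrix_mult_def mat_scale_def vec_eq_iff if_distrib if_distribR sum.delta mult.commute cong: if_cong)

lemma mat_of_scalar_mult: "mat_of (scalar c * x) = mat_scale c (mat_of x)"
  by (simp add: scalar_def times_mring.rep_eq mat_mult)

text \<open>Position in the abstract linear order of the indices, counted from 0, so that the
  distance from the diagonal becomes a number.\<close>

definition rank :: "'n::{finite,linorder} \<Rightarrow> nat" where "rank i = card {..<i}"

lemma rank_less: "i < j \<Longrightarrow> rank i < rank j"
  unfolding rank_def by (rule psubset_card_mono) auto

lemma rank_less_iff: "rank i < rank j \<longleftrightarrow> i < j"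
  using rank_less by (metis less_asym neqE)

lemma rank_bound: "rank (i::'n::{finite,linorder}) < CARD('n)"
  unfolding rank_def by (rule psubset_card_mono) auto

text \<open>Matrices supported on the k-th superdiagonal and above. Ranks stay below N, so nothing
  but 0 is left at k = N.\<close>

definition upper :: "nat \<Rightarrow> ('k::field, 'n::{finite,linorder}) mring set"
  where "upper k = {x. \<forall>i j. mat_of x $ i $ j \<noteq> 0 \<longrightarrow> rank i + k \<le> rank j}"

lemma mat_of_upper_1: "x \<in> upper 1 \<longleftrightarrow> mat_of x \<in> strict_upper"
proof -
  have "rank i + 1 \<le> rank j \<longleftrightarrow> \<not> j \<le> i" for i j :: 'b
    using rank_less_iff[of i j] by (simp add: Suc_le_eq not_le)
  then show ?thesis by (auto simp: upper_def strict_upper_def)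
qed

lemma graded_exp_mring:
  assumes "CARD('n::{finite,linorder}) \<le> CHAR('k::field)"
  shows "graded_exp (scalar :: 'k \<Rightarrow> ('k, 'n) mring) upper CARD('n)"
proof
  fix a b :: 'k and x y :: "('k, 'n) mring" and i j k m :: nat
  show "scalar (a + b) = (scalar a + scalar b :: ('k, 'n) mring)"
    by (simp add: scalar_def plus_mring.abs_eq eq_onp_same_args mat_def vec_eq_iff ring_of_inject)
  show "scalar (a * b) = (scalar a * scalar b :: ('k, 'n) mring)"
    by (simp add: scalar_def times_mring.abs_eq eq_onp_same_args mat_mult)
      (simp add: mat_def mat_scale_def ring_of_inject vec_eq_iff)
  show "scalar 1 = (1 :: ('k, 'n) mring)"
    by (simp add: scalar_def one_mring.abs_eq)
  show "scalar a * x = x * scalar a"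
    by (simp add: mat_of_inject[symmetric] times_mring.rep_eq scalar_def mat_mult mult_mat)
  show "0 \<in> (upper k :: ('k, 'n) mring set)"
    by (simp add: upper_def zero_mring.rep_eq)
  show "x + y \<in> upper k" if "x \<in> upper k" "y \<in> upper k"
    unfolding upper_def
  proof (intro CollectI allI impI)
    fix l l' assume "mat_of (x + y) $ l $ l' \<noteq> 0"
    then have "mat_of x $ l $ l' \<noteq> 0 \<or> mat_of y $ l $ l' \<noteq> 0"
      by (auto simp: plus_mring.rep_eq)
    then show "rank l + k \<le> rank l'" using that by (auto simp: upper_def)
  qed
  show "scalar a * x \<in> upper k" if "x \<in> upper k"
    using that by (auto simp: upper_def mat_of_scalar_mult mat_scale_def)
  show "(1 :: ('k, 'n) mring) \<in> upper 0"
    by (simp add: upper_def one_mring.rep_eq mat_def)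
  show "x * y \<in> upper (i + j)" if "x \<in> upper i" "y \<in> upper j"
    unfolding upper_def
  proof (intro CollectI allI impI)
    fix l l' assume "mat_of (x * y) $ l $ l' \<noteq> 0"
    then have "(\<Sum>k\<in>UNIV. mat_of x $ l $ k * mat_of y $ k $ l') \<noteq> 0"
      by (simp add: times_mring.rep_eq matrix_matrix_mult_def)
    then obtain k where "mat_of x $ l $ k * mat_of y $ k $ l' \<noteq> 0"
      by (rule sum.not_neutral_contains_not_neutral)
    then have "mat_of x $ l $ k \<noteq> 0" "mat_of y $ k $ l' \<noteq> 0" by auto
    then have "rank l + i \<le> rank k" "rank k + j \<le> rank l'"
      using that by (auto simp: upper_def)
    then show "rank l + (i + j) \<le> rank l'" by simp
  qed
  show "upper (Suc k) \<subseteq> (upper k :: ('k, 'n) mring set)"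
    by (auto simp: upper_def dest: Suc_leD)
  show "upper CARD('n) = {0 :: ('k, 'n) mring}"
  proof -
    have "\<not> rank i + CARD('n) \<le> rank j" for i j :: 'n
      using rank_bound[of j] by simp
    then show ?thesis
      by (auto simp: upper_def mat_of_inject[symmetric] zero_mring.rep_eq vec_eq_iff)
  qed
  show "0 < CARD('n)" by simp
  show "(of_nat m :: 'k) \<noteq> 0" if "0 < m" "m < CARD('n)"
    using that assms by (auto simp: of_nat_eq_0_iff_char_dvd dest: dvd_imp_le)
qed


lemma mat_of_E:
  assumes "CARD('n::{finite,linorder}) \<le> CHAR('k::field)"
  shows "mat_of (graded_exp.E (scalar :: 'k \<Rightarrow> ('k, 'n) mring) CARD('n) x) = mat_exp (mat_of x)"
proof -
  interpret graded_exp "scalar :: 'k \<Rightarrow> ('k, 'n) mring" upper "CARD('n)"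
    by (rule graded_exp_mring[OF assms])
  show ?thesis
    by (simp add: E_def ifact_def mat_exp_def mat_of_sum mat_of_scalar_mult mat_of_power)
qed

lemma subspace_vimage:
  assumes "mat_space.subspace J" "CARD('n::{finite,linorder}) \<le> CHAR('k::field)"
  shows "module.subspace (\<lambda>a x. scalar a * x) (mat_of -` J :: ('k, 'n) mring set)"
proof -
  interpret graded_exp "scalar :: 'k \<Rightarrow> ('k, 'n) mring" upper "CARD('n)"
    by (rule graded_exp_mring[OF assms(2)])
  show ?thesis
    using assms(1)
    by (auto simp: V.subspace_def mat_space.subspace_def zero_mring.rep_eq plus_mring.rep_eq
        mat_of_scalar_mult)
qed

context
  assumes char_ge: "CARD('n::{finite,linorder}) \<le> CHAR('k::field)"
begin

interpretation graded_exp "scalar :: 'k \<Rightarrow> ('k, 'n) mring" upper "CARD('n)"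
  by (rule graded_exp_mring[OF char_ge])

private lemma E_ring_of: "E (ring_of A) = ring_of (mat_exp A)"
  using mat_of_E[OF char_ge, of "ring_of A"] by (simp add: mat_of_inject[symmetric])

private lemma ring_of_upper: "ring_of A \<in> upper 1 \<longleftrightarrow> A \<in> strict_upper"
  by (simp add: mat_of_upper_1 del: One_nat_def)

lemma mat_exp_0: "mat_exp (0 :: ('k, 'n) sqmat) = mat 1"
  using E_0 mat_of_E[OF char_ge, of 0] by (simp add: zero_mring.rep_eq one_mring.rep_eq)

lemma mat_exp_uminus:
  fixes A :: "('k, 'n) sqmat"
  assumes "A \<in> strict_upper"
  shows "mat_exp (- A) ** mat_exp A = mat 1"
proof -
  have "E (- ring_of A) * E (ring_of A) = 1"
    by (rule E_inverse) (use assms in \<open>simp only: ring_of_upper\<close>)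
  then show ?thesis
    by (simp add: mat_of_inject[symmetric] times_mring.rep_eq one_mring.rep_eq uminus_mring.rep_eq
        mat_of_E[OF char_ge])
qed

lemma mat_exp_inj: "inj_on mat_exp (strict_upper :: ('k, 'n) sqmat set)"
proof (rule inj_onI)
  fix A B :: "('k, 'n) sqmat"
  assume "A \<in> strict_upper" "B \<in> strict_upper" "mat_exp A = mat_exp B"
  then have "ring_of A = ring_of B"
    using inj_onD[OF E_inj, of "ring_of A" "ring_of B"] by (simp add: E_ring_of ring_of_upper del: One_nat_def)
  then show "A = B" by (simp add: ring_of_inject)
qed

text \<open>The adjoint series cut after the first bracket. The choice of J decides what is seen:
  below, J is the algebra itself, the kernel of a form, or the image of an iterated bracket.\<close>

lemma mat_exp_conj:
  fixes A B :: "('k, 'n) sqmat"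
  assumes A: "A \<in> strict_upper" and B: "B \<in> strict_upper" and J: "mat_space.subspace J"
    and br: "\<And>C. C \<in> J \<Longrightarrow> lie_bracket C A \<in> J"
    and br2: "lie_bracket (lie_bracket B A) A \<in> J"
  shows "mat_exp (- A) ** B ** mat_exp A - B - lie_bracket B A \<in> J"
proof -
  let ?a = "ring_of A" and ?b = "ring_of B"
  have "E (- ?a) * ?b * E ?a - ?b - (?b * ?a - ?a * ?b) \<in> mat_of -` J"
  proof (rule E_conj[OF _ subspace_vimage[OF J char_ge]])
    show "?a \<in> upper 1" "?b \<in> upper 1" using A B by (simp_all only: ring_of_upper)
  qed (use br br2 in \<open>auto simp: times_mring.rep_eq minus_mring.rep_eq lie_bracket_def\<close>)
  then show ?thesis
    by (simp add: times_mring.rep_eq minus_mring.rep_eq uminus_mring.rep_eq mat_of_E[OF char_ge]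
        lie_bracket_def)
qed

text \<open>B starts at depth 1 and every bracket with A adds a step, so m brackets reach depth m +
  1 > N.\<close>

lemma lie_bracket_nilpotent:
  fixes A B :: "('k, 'n) sqmat"
  assumes A: "A \<in> strict_upper" and B: "B \<in> strict_upper" and m: "CARD('n) \<le> m"
  shows "((\<lambda>B. lie_bracket B A) ^^ m) B = 0"
proof -
  have a: "ring_of A \<in> upper 1" using A by (simp only: ring_of_upper)
  have "ring_of (((\<lambda>B. lie_bracket B A) ^^ i) B) \<in> upper (Suc i)" for i
  proof (induction i)
    case 0
    have "ring_of B \<in> upper 1" using B by (simp only: ring_of_upper)
    then show ?case by simp
  next
    case (Suc i)
    let ?b = "ring_of (((\<lambda>B. lie_bracket B A) ^^ i) B)"
    have "?b * ring_of A - ring_of A * ?b \<in> upper (Suc (Suc i))"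
      using u_mult[OF Suc a] u_mult[OF a Suc] by (intro V.subspace_diff[OF u_subspace]) simp_all
    moreover have "?b * ring_of A - ring_of A * ?b = ring_of (((\<lambda>B. lie_bracket B A) ^^ Suc i) B)"
      by (simp add: mat_of_inject[symmetric] minus_mring.rep_eq times_mring.rep_eq lie_bracket_def)
    ultimately show ?case by simp
  qed
  then have "ring_of (((\<lambda>B. lie_bracket B A) ^^ m) B) = 0"
    using u_large[of "Suc m"] m by simp
  then show ?thesis by (simp add: mat_of_inject[symmetric] zero_mring.rep_eq)
qed

lemma mat_exp_mult:
  fixes A B :: "('k, 'n) sqmat"
  assumes L: "lie_subalgebra L strict_upper" and D: "mat_space.subspace D" and DL: "D \<subseteq> L"
    and LD: "\<And>A B. A \<in> L \<Longrightarrow> B \<in> L \<Longrightarrow> lie_bracket A B \<in> D"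
    and A: "A \<in> L" and B: "B \<in> L"
  shows "\<exists>C\<in>D. mat_exp A ** mat_exp B = mat_exp (A + B + C)"
proof -
  have L': "mat_space.subspace L" "L \<subseteq> strict_upper" using L by (auto simp: lie_subalgebra_def)
  have "\<exists>w\<in>mat_of -` D. E (ring_of A) * E (ring_of B) = E (ring_of A + ring_of B + w)"
  proof (rule E_mult[OF subspace_vimage[OF L'(1) char_ge] _ subspace_vimage[OF D char_ge]])
    show "mat_of -` L \<subseteq> upper 1" using L'(2) by (auto simp: mat_of_upper_1 simp del: One_nat_def)
  qed (use LD A B DL in \<open>auto simp: times_mring.rep_eq minus_mring.rep_eq lie_bracket_def\<close>)
  then show ?thesis
    by (auto simp: mat_of_inject[symmetric] times_mring.rep_eq plus_mring.rep_eq mat_of_E[OF char_ge])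
qed

end

section \<open>Representations of finite groups\<close>

lemma linear_map_on_add:
  "linear_map_on s1 s2 V f \<Longrightarrow> x \<in> V \<Longrightarrow> y \<in> V \<Longrightarrow> f (x + y) = f x + f y"
  by (simp add: linear_map_on_def)

lemma linear_map_on_scale:
  "linear_map_on s1 s2 V f \<Longrightarrow> x \<in> V \<Longrightarrow> f (s1 c x) = s2 c (f x)"
  by (simp add: linear_map_on_def)

lemma linear_map_on_zero: "linear_map_on s1 s2 V f \<Longrightarrow> 0 \<in> V \<Longrightarrow> f 0 = 0"
  using linear_map_on_add[of s1 s2 V f 0 0] by simp

lemma linear_map_on_diff:
  assumes "linear_map_on fun_scale s2 V f" "fun_space.subspace V" "x \<in> V" "y \<in> V"
  shows "f (x - y) = f x - f y"
  using linear_map_on_add[OF assms(1) fun_space.subspace_diff[OF assms(2-4)] assms(4)] by simp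

lemma linear_map_on_sum:
  assumes "linear_map_on fun_scale s2 V f" "fun_space.subspace V" "\<And>i. i \<in> I \<Longrightarrow> g i \<in> V"
  shows "f (\<Sum>i\<in>I. g i) = (\<Sum>i\<in>I. f (g i))"
  using assms(3)
proof (induction I rule: infinite_finite_induct)
  case (insert i I)
  then show ?case
    using linear_map_on_add[OF assms(1), of "g i" "sum g I"] fun_space.subspace_sum[OF assms(2), of I g]
    by (simp only: sum.insert[OF insert(1,2)] insertI1 insertI2)
qed (use linear_map_on_zero[OF assms(1)] fun_space.subspace_0[OF assms(2)] in simp_all)

lemma complex_repD:
  assumes "complex_rep G R"
  shows "group G" and "fun_space.subspace (rep_space R)"
    and "g \<in> carrier G \<Longrightarrow> v \<in> rep_space R \<Longrightarrow> rep_act R g v \<in> rep_space R"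
    and "g \<in> carrier G \<Longrightarrow> h \<in> carrier G \<Longrightarrow> v \<in> rep_space R \<Longrightarrow>
      rep_act R (g \<otimes>\<^bsub>G\<^esub> h) v = rep_act R g (rep_act R h v)"
    and "v \<in> rep_space R \<Longrightarrow> rep_act R \<one>\<^bsub>G\<^esub> v = v"
    and "g \<in> carrier G \<Longrightarrow> linear_map_on fun_scale fun_scale (rep_space R) (rep_act R g)"
proof -
  interpret group_action G "rep_space R" "rep_act R"
    using assms by (simp add: complex_rep_def)
  show "group G" using group_hom by (simp add: group_hom_def)
  show "fun_space.subspace (rep_space R)"
    and "g \<in> carrier G \<Longrightarrow> linear_map_on fun_scale fun_scale (rep_space R) (rep_act R g)"
    using assms by (auto simp: complex_rep_def)
  show "g \<in> carrier G \<Longrightarrow> v \<in> rep_space R \<Longrightarrow> rep_act R g v \<in> rep_space R"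
    using element_image by blast
  show "g \<in> carrier G \<Longrightarrow> h \<in> carrier G \<Longrightarrow> v \<in> rep_space R \<Longrightarrow>
      rep_act R (g \<otimes>\<^bsub>G\<^esub> h) v = rep_act R g (rep_act R h v)"
    by (rule composition_rule)
  show "v \<in> rep_space R \<Longrightarrow> rep_act R \<one>\<^bsub>G\<^esub> v = v"
    using id_eq_one by (metis restrict_apply')
qed

lemma complex_repI:
  fixes G (structure)
  assumes "group G" and V: "fun_space.subspace (rep_space R)"
    and ext: "\<And>g. g \<in> carrier G \<Longrightarrow> rep_act R g \<in> extensional (rep_space R)"
    and closed: "\<And>g v. g \<in> carrier G \<Longrightarrow> v \<in> rep_space R \<Longrightarrow> rep_act R g v \<in> rep_space R"
    and mult: "\<And>g h v. g \<in> carrier G \<Longrightarrow> h \<in> carrier G \<Longrightarrow> v \<in> rep_space R \<Longrightarrow>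
      rep_act R (g \<otimes>\<^bsub>G\<^esub> h) v = rep_act R g (rep_act R h v)"
    and one: "\<And>v. v \<in> rep_space R \<Longrightarrow> rep_act R \<one>\<^bsub>G\<^esub> v = v"
    and lin: "\<And>g. g \<in> carrier G \<Longrightarrow> linear_map_on fun_scale fun_scale (rep_space R) (rep_act R g)"
  shows "complex_rep G R"
proof -
  interpret group G by fact
  let ?V = "rep_space R"
  have Bij: "rep_act R g \<in> Bij ?V" if g: "g \<in> carrier G" for g
  proof -
    have "bij_betw (rep_act R g) ?V ?V"
    proof (rule bij_betw_byWitness[where f' = "rep_act R (inv g)"])
      show "\<forall>v\<in>?V. rep_act R (inv g) (rep_act R g v) = v"
        using g mult[of "inv g" g] one by simp
      show "\<forall>v\<in>?V. rep_act R g (rep_act R (inv g) v) = v"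
        using g mult[of g "inv g"] one by simp
    qed (use g closed in auto)
    then show ?thesis using ext[OF g] by (simp add: Bij_def)
  qed
  have "rep_act R \<in> hom G (BijGroup ?V)"
  proof (rule homI)
    show "rep_act R g \<in> carrier (BijGroup ?V)" if "g \<in> carrier G" for g
      using Bij[OF that] by (simp add: BijGroup_def)
    show "rep_act R (g \<otimes> h) = rep_act R g \<otimes>\<^bsub>BijGroup ?V\<^esub> rep_act R h"
      if "g \<in> carrier G" "h \<in> carrier G" for g h
    proof -
      have "rep_act R (g \<otimes> h) = compose ?V (rep_act R g) (rep_act R h)"
        using that mult by (intro extensionalityI[OF ext compose_extensional]) (auto simp: compose_eq)
      then show ?thesis using that Bij by (simp add: BijGroup_def)
    qed
  qed
  then have "group_action G ?V (rep_act R)"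
    by (simp add: group_action_def group_hom_def group_hom_axioms_def group_BijGroup is_group)
  then show ?thesis using V lin by (simp add: complex_rep_def)
qed

lemma complex_rep_extensional:
  assumes "complex_rep G R" "g \<in> carrier G"
  shows "rep_act R g \<in> extensional (rep_space R)"
  using group_action.bij_prop0[of G "rep_space R" "rep_act R" g] assms
  by (simp add: complex_rep_def Bij_def)

lemma subrep_simps [simp]:
  "rep_space (subrep R U) = U" "rep_act (subrep R U) g = restrict (rep_act R g) U"
  by (simp_all add: subrep_def)

lemma linear_map_on_subset: "linear_map_on s1 s2 V f \<Longrightarrow> U \<subseteq> V \<Longrightarrow> linear_map_on s1 s2 U f"
  unfolding linear_map_on_def by blast

lemma linear_map_on_restrict:
  assumes "linear_map_on fun_scale s2 V f" "fun_space.subspace V"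
  shows "linear_map_on fun_scale s2 V (restrict f V)"
  using assms fun_space.subspace_add[OF assms(2)] fun_space.subspace_scale[OF assms(2)]
  by (simp add: linear_map_on_def)

lemma complex_rep_subrep:
  assumes R: "complex_rep G R" and U: "invariant_subspace G R U"
  shows "complex_rep G (subrep R U)"
proof (rule complex_repI)
  have sub: "U \<subseteq> rep_space R" "fun_space.subspace U"
    using U by (auto simp: invariant_subspace_def)
  interpret group G by (rule complex_repD(1)[OF R])
  show "group G" by (rule is_group)
  show "fun_space.subspace (rep_space (subrep R U))" using sub by simp
  show "linear_map_on fun_scale fun_scale (rep_space (subrep R U)) (rep_act (subrep R U) g)"
    if "g \<in> carrier G" for g
    using linear_map_on_restrict[OF linear_map_on_subset[OF complex_repD(6)[OF R that] sub(1)] sub(2)]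
    by simp
qed (use U complex_repD[OF R] in \<open>auto simp: invariant_subspace_def subset_iff\<close>)

lemma complex_rep_restrict:
  assumes R: "complex_rep G R" and "group H" and "carrier H \<subseteq> carrier G"
    and "mult H = mult G" and "one H = one G"
  shows "complex_rep H (restrict_rep H R)"
proof (rule complex_repI)
  interpret H: group H by fact
  show "group H" by fact
  show "rep_act (restrict_rep H R) (g \<otimes>\<^bsub>H\<^esub> h) v = rep_act (restrict_rep H R) g (rep_act (restrict_rep H R) h v)"
    if "g \<in> carrier H" "h \<in> carrier H" "v \<in> rep_space (restrict_rep H R)" for g h v
  proof -
    have "g \<otimes>\<^bsub>G\<^esub> h \<in> carrier H" using H.m_closed[OF that(1,2)] assms(4) by simp
    then show ?thesis
      using that complex_repD(4)[OF R, of g h v] assms(3,4) by (auto simp: restrict_rep_def)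
  qed
  show "rep_act (restrict_rep H R) \<one>\<^bsub>H\<^esub> v = v" if "v \<in> rep_space (restrict_rep H R)" for v
    using H.one_closed complex_repD(5)[OF R, of v] assms(5) that by (simp add: restrict_rep_def)
qed (use complex_repD[OF R] complex_rep_extensional[OF R] assms(3) in \<open>auto simp: restrict_rep_def\<close>)


subsection \<open>Intertwining maps\<close>

definition rep_hom ::
  "('g, 'm) monoid_scheme \<Rightarrow> ('g, 'b) rep \<Rightarrow> ('g, 'c) rep \<Rightarrow> (('b \<Rightarrow> complex) \<Rightarrow> 'c \<Rightarrow> complex) \<Rightarrow> bool"
  where "rep_hom G R S \<phi> \<longleftrightarrow> linear_map_on fun_scale fun_scale (rep_space R) \<phi> \<and>
    \<phi> ` rep_space R \<subseteq> rep_space S \<and>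
    (\<forall>g\<in>carrier G. \<forall>v\<in>rep_space R. \<phi> (rep_act R g v) = rep_act S g (\<phi> v))"

lemma rep_hom_compose:
  assumes "rep_hom G R S \<phi>" "rep_hom G S T \<theta>"
  shows "rep_hom G R T (\<theta> \<circ> \<phi>)"
  using assms by (auto simp: rep_hom_def linear_map_on_def image_subset_iff)

lemma equivalent_repE:
  assumes "equivalent_rep G R S"
  obtains \<phi> where "rep_hom G R S \<phi>" "bij_betw \<phi> (rep_space R) (rep_space S)"
  using assms by (force simp: equivalent_rep_def rep_hom_def bij_betw_def)

lemma rep_hom_inv:
  assumes R: "complex_rep G R" and \<phi>: "rep_hom G R S \<phi>" and bij: "bij_betw \<phi> (rep_space R) (rep_space S)"
  shows "rep_hom G S R (the_inv_into (rep_space R) \<phi>)"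
proof -
  let ?i = "the_inv_into (rep_space R) \<phi>"
  have inj: "inj_on \<phi> (rep_space R)" using bij by (simp add: bij_betw_def)
  have eq: "?i v = w" if "\<phi> w = v" "w \<in> rep_space R" for v w
    using that the_inv_into_f_f[OF inj] by blast
  have surj: "\<exists>w\<in>rep_space R. v = \<phi> w" if "v \<in> rep_space S" for v
    using bij that by (auto simp: bij_betw_def)
  note V = complex_repD(2)[OF R]
  have lin: "linear_map_on fun_scale fun_scale (rep_space R) \<phi>" using \<phi> by (simp add: rep_hom_def)
  have "?i (v + w) = ?i v + ?i w" if vw: "v \<in> rep_space S" "w \<in> rep_space S" for v w
  proof -
    obtain v' w' where *: "v' \<in> rep_space R" "v = \<phi> v'" "w' \<in> rep_space R" "w = \<phi> w'"
      using surj vw by blast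
    then show ?thesis
      using fun_space.subspace_add[OF V, of v' w'] linear_map_on_add[OF lin]
      by (simp add: eq)
  qed
  moreover have "?i (fun_scale c v) = fun_scale c (?i v)" if v: "v \<in> rep_space S" for v c
  proof -
    obtain v' where *: "v' \<in> rep_space R" "v = \<phi> v'"
      using surj[OF v] by blast
    then show ?thesis
      using fun_space.subspace_scale[OF V, of v' c] linear_map_on_scale[OF lin, of v' c]
      by (simp add: eq)
  qed
  moreover have "?i (rep_act S g v) = rep_act R g (?i v)" if g: "g \<in> carrier G" and v: "v \<in> rep_space S" for g v
  proof -
    obtain v' where *: "v' \<in> rep_space R" "v = \<phi> v'"
      using surj[OF v] by blast
    then show ?thesis
      using complex_repD(3)[OF R g *(1)] \<phi> g by (simp add: eq rep_hom_def)
  qed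
  moreover have "?i v \<in> rep_space R" if "v \<in> rep_space S" for v
    using surj[OF that] eq by auto
  ultimately show ?thesis by (auto simp: rep_hom_def linear_map_on_def)
qed

lemma equivalent_rep_sym:
  assumes "equivalent_rep G R S"
  shows "equivalent_rep G S R"
proof -
  obtain \<phi> where \<phi>: "rep_hom G R S \<phi>" "bij_betw \<phi> (rep_space R) (rep_space S)"
    using equivalent_repE[OF assms] by blast
  have R: "complex_rep G R" "complex_rep G S" using assms by (auto simp: equivalent_rep_def)
  show ?thesis
    using rep_hom_inv[OF R(1) \<phi>] bij_betw_the_inv_into[OF \<phi>(2)] R
    by (auto simp: equivalent_rep_def rep_hom_def)
qed

lemma image_subspace:
  assumes "linear_map_on fun_scale fun_scale V \<phi>" "fun_space.subspace V"
  shows "fun_space.subspace (\<phi> ` V)"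
  unfolding fun_space.subspace_def
proof (intro conjI ballI allI)
  show "0 \<in> \<phi> ` V"
    using linear_map_on_zero[OF assms(1)] fun_space.subspace_0[OF assms(2)] by force
  show "v + w \<in> \<phi> ` V" if "v \<in> \<phi> ` V" "w \<in> \<phi> ` V" for v w
    using that linear_map_on_add[OF assms(1)] fun_space.subspace_add[OF assms(2)]
    by (auto simp flip: linear_map_on_add[OF assms(1)])
  show "fun_scale c v \<in> \<phi> ` V" if "v \<in> \<phi> ` V" for c v
    using that fun_space.subspace_scale[OF assms(2)]
    by (auto simp flip: linear_map_on_scale[OF assms(1)])
qed

lemma rep_hom_image:
  assumes R: "complex_rep G R" and \<phi>: "rep_hom G R S \<phi>" and U: "invariant_subspace G R U"
  shows "invariant_subspace G S (\<phi> ` U)"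
proof -
  have "fun_space.subspace (\<phi> ` U)"
    using U \<phi> by (intro image_subspace)
      (auto simp: invariant_subspace_def rep_hom_def intro: linear_map_on_subset)
  moreover have "rep_act S g (\<phi> v) \<in> \<phi> ` U" if "g \<in> carrier G" "v \<in> U" for g v
  proof -
    have "rep_act S g (\<phi> v) = \<phi> (rep_act R g v)"
      using \<phi> U that by (auto simp: rep_hom_def invariant_subspace_def subset_iff)
    then show ?thesis using U that by (auto simp: invariant_subspace_def)
  qed
  ultimately show ?thesis
    using \<phi> U by (force simp: invariant_subspace_def rep_hom_def)
qed

lemma invariant_subspace_whole:
  "complex_rep G R \<Longrightarrow> invariant_subspace G R (rep_space R)"
  using complex_repD[of G R] by (auto simp: invariant_subspace_def)

lemma equivalent_rep_image:
  assumes R: "complex_rep G R" and S: "complex_rep G S"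
    and \<phi>: "rep_hom G R S \<phi>" and inj: "inj_on \<phi> (rep_space R)"
  shows "invariant_subspace G S (\<phi> ` rep_space R)"
    and "equivalent_rep G R (subrep S (\<phi> ` rep_space R))"
proof -
  show *: "invariant_subspace G S (\<phi> ` rep_space R)"
    by (rule rep_hom_image[OF R \<phi> invariant_subspace_whole[OF R]])
  show "equivalent_rep G R (subrep S (\<phi> ` rep_space R))"
    using R complex_rep_subrep[OF S *] \<phi> inj
    by (auto simp: equivalent_rep_def rep_hom_def bij_betw_def intro!: exI[of _ \<phi>])
qed

lemma irreducible_equivalent:
  assumes "irreducible_rep G R" "equivalent_rep G R S"
  shows "irreducible_rep G S"
proof -
  obtain \<theta> where \<theta>: "rep_hom G S R \<theta>" "bij_betw \<theta> (rep_space S) (rep_space R)"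
    using equivalent_repE[OF equivalent_rep_sym[OF assms(2)]] by blast
  have R: "complex_rep G R" "complex_rep G S" using assms by (auto simp: equivalent_rep_def)
  have lin: "linear_map_on fun_scale fun_scale (rep_space S) \<theta>" using \<theta> by (simp add: rep_hom_def)
  note z = fun_space.subspace_0[OF complex_repD(2)[OF R(1)]] fun_space.subspace_0[OF complex_repD(2)[OF R(2)]]
  have \<theta>0: "\<theta> 0 = 0" using linear_map_on_zero[OF lin] z by simp
  have inj: "inj_on \<theta> (rep_space S)" using \<theta> by (simp add: bij_betw_def)
  have im: "\<theta> ` rep_space S = rep_space R" using \<theta> by (simp add: bij_betw_def)
  have "U = {0} \<or> U = rep_space S" if U: "invariant_subspace G S U" for U
  proof -
    have sub: "U \<subseteq> rep_space S" "{0} \<subseteq> rep_space S" using U z by (auto simp: invariant_subspace_def)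
    have "\<theta> ` U = {0} \<or> \<theta> ` U = rep_space R"
      using rep_hom_image[OF R(2) \<theta>(1) U] assms(1) by (simp add: irreducible_rep_def)
    then have "\<theta> ` U = \<theta> ` {0} \<or> \<theta> ` U = \<theta> ` rep_space S"
      using \<theta>0 im by simp
    then show ?thesis
      using inj_on_image_eq_iff[OF inj sub(1)] sub(2) by blast
  qed
  moreover have "rep_space S \<noteq> {0}"
    using im \<theta>0 assms(1) by (auto simp: irreducible_rep_def)
  ultimately show ?thesis using R by (simp add: irreducible_rep_def)
qed

text \<open>One half of Schur's lemma: the kernel is invariant and misses v.\<close>

lemma irreducible_rep_hom_inj:
  assumes "irreducible_rep G R" "complex_rep G S" "rep_hom G R S \<phi>" "v \<in> rep_space R" "\<phi> v \<noteq> 0"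
  shows "inj_on \<phi> (rep_space R)"
proof -
  have R: "complex_rep G R" using assms(1) by (simp add: irreducible_rep_def)
  note V = complex_repD(2)[OF R]
  have lin: "linear_map_on fun_scale fun_scale (rep_space R) \<phi>" using assms(3) by (simp add: rep_hom_def)
  let ?K = "{v \<in> rep_space R. \<phi> v = 0}"
  have "invariant_subspace G R ?K"
    unfolding invariant_subspace_def fun_space.subspace_def
  proof (intro conjI ballI allI)
    show "0 \<in> ?K" using fun_space.subspace_0[OF V] linear_map_on_zero[OF lin] by simp
    show "x + y \<in> ?K" if "x \<in> ?K" "y \<in> ?K" for x y
      using that fun_space.subspace_add[OF V] linear_map_on_add[OF lin] by simp
    show "fun_scale c x \<in> ?K" if "x \<in> ?K" for c x
      using that fun_space.subspace_scale[OF V] linear_map_on_scale[OF lin] by simp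
    show "rep_act R g v \<in> ?K" if "g \<in> carrier G" "v \<in> ?K" for g v
    proof -
      have "rep_act S g 0 = 0"
        using complex_repD(6)[OF assms(2) that(1)] fun_space.subspace_0[OF complex_repD(2)[OF assms(2)]]
        by (rule linear_map_on_zero)
      then show ?thesis
        using that assms(3) complex_repD(3)[OF R] by (auto simp: rep_hom_def)
    qed
  qed auto
  then have K: "?K = {0}"
    using assms(1,4,5) by (auto simp: irreducible_rep_def)
  show ?thesis
  proof (rule inj_onI)
    fix x y assume xy: "x \<in> rep_space R" "y \<in> rep_space R" "\<phi> x = \<phi> y"
    then have "x - y \<in> ?K"
      using linear_map_on_diff[OF lin V] fun_space.subspace_diff[OF V] by simp
    then show "x = y" using K by auto
  qed
qed


subsection \<open>Complete reducibility\<close>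

text \<open>A projection onto U averaged over the group commutes with the action and is still the
  identity on U; W is its kernel in the representation space.\<close>

lemma maschke:
  fixes G (structure)
  assumes R: "complex_rep G R" and fin: "finite (carrier G)" and U: "invariant_subspace G R U"
  obtains W where "invariant_subspace G R W" "U \<inter> W = {0}"
    "\<And>v. v \<in> rep_space R \<Longrightarrow> \<exists>u\<in>U. \<exists>w\<in>W. v = u + w"
proof -
  interpret group G by (rule complex_repD(1)[OF R])
  interpret pair: vector_space_pair fun_scale fun_scale ..
  let ?V = "rep_space R"
  note V = complex_repD(2)[OF R]
  have U': "fun_space.subspace U" "U \<subseteq> ?V" "\<And>g v. g \<in> carrier G \<Longrightarrow> v \<in> U \<Longrightarrow> rep_act R g v \<in> U"
    using U by (auto simp: invariant_subspace_def)
  \<comment> \<open>The projection is taken on the whole function space; its average is linear and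
    equivariant on the representation space.\<close>
  have "\<exists>pr. pr ` UNIV \<subseteq> U \<and> Vector_Spaces.linear fun_scale fun_scale pr \<and> (\<forall>v\<in>U. pr (id v) = v)"
    by (rule pair.linear_exists_left_inverse_on[OF fun_space.linear_id U'(1)]) auto
  then obtain pr where pr: "\<And>v. pr v \<in> U" "Vector_Spaces.linear fun_scale fun_scale pr"
      "\<And>v. v \<in> U \<Longrightarrow> pr v = v"
    by auto
  have pr_add: "pr (v + w) = pr v + pr w" and pr_scale: "pr (fun_scale c v) = fun_scale c (pr v)" for v w c
    using pr(2) by (auto simp: Vector_Spaces.linear_iff)
  define av where "av v = fun_scale (1 / card (carrier G))
    (\<Sum>g\<in>carrier G. rep_act R g (pr (rep_act R (inv g) v)))" for v
  have prV: "pr v \<in> ?V" for v using pr(1) U'(2) by blast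
  have av_U: "av v \<in> U" for v
    unfolding av_def by (intro fun_space.subspace_scale[OF U'(1)] fun_space.subspace_sum[OF U'(1)] U'(3) pr(1))
  have card: "complex_of_nat (card (carrier G)) \<noteq> 0"
    using fin one_closed by (auto simp: card_eq_0_iff)
  have av_id: "av v = v" if v: "v \<in> U" for v
  proof -
    have "rep_act R g (pr (rep_act R (inv g) v)) = v" if g: "g \<in> carrier G" for g
      using pr(3)[OF U'(3)[OF inv_closed[OF g] v]] complex_repD(4)[OF R g inv_closed[OF g], of v]
        complex_repD(5)[OF R, of v] g v U'(2) by auto
    then have "av v = fun_scale (1 / card (carrier G)) (\<Sum>g\<in>carrier G. v)"
      unfolding av_def by simp
    also have "(\<Sum>g\<in>carrier G. v) = fun_scale (card (carrier G)) v"
      using fun_space.scale_sum_left[of "\<lambda>_. 1" "carrier G" v] by simp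
    also have "fun_scale (1 / card (carrier G)) \<dots> = v" using card by simp
    finally show ?thesis .
  qed
  have av_lin: "linear_map_on fun_scale fun_scale ?V av"
    unfolding linear_map_on_def
  proof (intro conjI ballI allI)
    fix v w assume vw: "v \<in> ?V" "w \<in> ?V"
    have "rep_act R g (pr (rep_act R (inv g) (v + w))) =
        rep_act R g (pr (rep_act R (inv g) v)) + rep_act R g (pr (rep_act R (inv g) w))"
      if g: "g \<in> carrier G" for g
      using linear_map_on_add[OF complex_repD(6)[OF R g] prV prV]
        linear_map_on_add[OF complex_repD(6)[OF R inv_closed[OF g]] vw] by (simp add: pr_add)
    then show "av (v + w) = av v + av w"
      by (simp add: av_def sum.distrib fun_space.scale_right_distrib)
  next
    fix c v assume v: "v \<in> ?V"
    have "rep_act R g (pr (rep_act R (inv g) (fun_scale c v))) =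
        fun_scale c (rep_act R g (pr (rep_act R (inv g) v)))"
      if g: "g \<in> carrier G" for g
      using linear_map_on_scale[OF complex_repD(6)[OF R g] prV]
        linear_map_on_scale[OF complex_repD(6)[OF R inv_closed[OF g]] v] by (simp add: pr_scale)
    then show "av (fun_scale c v) = fun_scale c (av v)"
      by (simp add: av_def fun_space.scale_left_commute flip: fun_space.scale_sum_right)
  qed
  have av_act: "av (rep_act R h v) = rep_act R h (av v)" if h: "h \<in> carrier G" and v: "v \<in> ?V" for h v
  proof -
    let ?f = "\<lambda>g. rep_act R g (pr (rep_act R (inv g) v))"
    have fV: "?f g \<in> ?V" if "g \<in> carrier G" for g
      using complex_repD(3)[OF R that prV] .
    have "rep_act R h (\<Sum>g\<in>carrier G. ?f g) = (\<Sum>g\<in>carrier G. rep_act R h (?f g))"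
      by (rule linear_map_on_sum[OF complex_repD(6)[OF R h] V fV])
    also have "\<dots> = (\<Sum>g\<in>carrier G. rep_act R g (pr (rep_act R (inv g) (rep_act R h v))))"
    proof (rule sum.reindex_bij_witness[of _ "\<lambda>g. inv h \<otimes> g" "\<lambda>g. h \<otimes> g"])
      fix g assume g: "g \<in> carrier G"
      show "rep_act R (h \<otimes> g) (pr (rep_act R (inv (h \<otimes> g)) (rep_act R h v))) = rep_act R h (?f g)"
      proof -
        have "rep_act R (inv (h \<otimes> g)) (rep_act R h v) = rep_act R (inv g) v"
          using complex_repD(4)[OF R inv_closed[OF m_closed[OF h g]] h v, symmetric] g h
          by (simp add: inv_mult_group m_assoc)
        then show ?thesis using complex_repD(4)[OF R h g prV] by simp
      qed
    qed (use h in \<open>auto simp flip: m_assoc\<close>)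
    finally show ?thesis
      unfolding av_def
      by (subst linear_map_on_scale[OF complex_repD(6)[OF R h] fun_space.subspace_sum[OF V fV]]) simp_all
  qed
  let ?W = "{v \<in> ?V. av v = 0}"
  have W: "invariant_subspace G R ?W"
    unfolding invariant_subspace_def fun_space.subspace_def
  proof (intro conjI ballI allI)
    show "0 \<in> ?W" using fun_space.subspace_0[OF V] linear_map_on_zero[OF av_lin] by simp
    show "x + y \<in> ?W" if "x \<in> ?W" "y \<in> ?W" for x y
      using that fun_space.subspace_add[OF V] linear_map_on_add[OF av_lin] by simp
    show "fun_scale c x \<in> ?W" if "x \<in> ?W" for c x
      using that fun_space.subspace_scale[OF V] linear_map_on_scale[OF av_lin] by simp
    show "rep_act R g v \<in> ?W" if "g \<in> carrier G" "v \<in> ?W" for g v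
      using that av_act complex_repD(3)[OF R] linear_map_on_zero[OF complex_repD(6)[OF R that(1)]]
        fun_space.subspace_0[OF V] by simp
  qed auto
  have "v - av v \<in> ?W" if v: "v \<in> ?V" for v
    using v av_U[of v] U'(2) fun_space.subspace_diff[OF V] linear_map_on_diff[OF av_lin V, of v "av v"]
      av_id[OF av_U[of v]] by auto
  then have "\<exists>u\<in>U. \<exists>w\<in>?W. v = u + w" if "v \<in> ?V" for v
    using that av_U[of v] by (intro bexI[of _ "av v"] bexI[of _ "v - av v"]) auto
  moreover have "U \<inter> ?W = {0}"
    using av_id fun_space.subspace_0[OF V] fun_space.subspace_0[OF U'(1)] linear_map_on_zero[OF av_lin] by force
  ultimately show ?thesis using that W by blast
qed

lemma subrep_subrep: "X \<subseteq> W \<Longrightarrow> subrep (subrep R W) X = subrep R X"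
  by (auto simp: subrep_def fun_eq_iff restrict_def subset_iff)

lemma invariant_subspace_subrep:
  "invariant_subspace G R W \<Longrightarrow>
    invariant_subspace G (subrep R W) X \<longleftrightarrow> invariant_subspace G R X \<and> X \<subseteq> W"
  by (auto simp: invariant_subspace_def subset_iff)

lemma irreducible_decomposition_insert:
  assumes R: "complex_rep G R" and U: "invariant_subspace G R U" "irreducible_rep G (subrep R U)"
    and W: "invariant_subspace G R W" and UW: "U \<inter> W = {0}"
    and sum: "\<And>v. v \<in> rep_space R \<Longrightarrow> \<exists>u\<in>U. \<exists>w\<in>W. v = u + w"
    and dec: "irreducible_decomposition G (subrep R W) \<W>"
  shows "irreducible_decomposition G R (insert U \<W>)"
proof -
  have fin: "finite \<W>"
    and inv: "\<And>X. X \<in> \<W> \<Longrightarrow> invariant_subspace G R X \<and> X \<subseteq> W"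
    and irr: "\<And>X. X \<in> \<W> \<Longrightarrow> irreducible_rep G (subrep (subrep R W) X)"
    and ex: "\<And>v. v \<in> W \<Longrightarrow> \<exists>!u. u \<in> (\<Pi>\<^sub>E X\<in>\<W>. X) \<and> v = (\<Sum>X\<in>\<W>. u X)"
    using dec invariant_subspace_subrep[OF W] by (auto simp: irreducible_decomposition_def)
  have Us: "fun_space.subspace U" and Ws: "fun_space.subspace W"
    using U W by (auto simp: invariant_subspace_def)
  \<comment> \<open>A decomposition is a set of summands, so the new one must differ from the old
    ones; otherwise U would lie in W and be zero.\<close>
  have "U \<noteq> {0}" using U(2) by (simp add: irreducible_rep_def)
  then have UnW: "U \<notin> \<W>" using inv UW fun_space.subspace_0[OF Us] by blast
  have sum_W: "(\<Sum>X\<in>\<W>. f X) \<in> W" if "f \<in> (\<Pi>\<^sub>E X\<in>\<W>. X)" for f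
    using that inv by (intro fun_space.subspace_sum[OF Ws]) (auto simp: PiE_def Pi_def)
  have "\<exists>!f. f \<in> (\<Pi>\<^sub>E X\<in>insert U \<W>. X) \<and> v = (\<Sum>X\<in>insert U \<W>. f X)" if v: "v \<in> rep_space R" for v
  proof -
    obtain u w where uw: "u \<in> U" "w \<in> W" "v = u + w" using sum[OF v] by blast
    obtain f where f: "f \<in> (\<Pi>\<^sub>E X\<in>\<W>. X)" "w = (\<Sum>X\<in>\<W>. f X)"
      and f_unique: "\<And>f'. f' \<in> (\<Pi>\<^sub>E X\<in>\<W>. X) \<Longrightarrow> w = (\<Sum>X\<in>\<W>. f' X) \<Longrightarrow> f' = f"
      using ex[OF uw(2)] by blast
    have sum_upd: "(\<Sum>X\<in>\<W>. (f'(U := z)) X) = (\<Sum>X\<in>\<W>. f' X)" for f' z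
      using UnW by (intro sum.cong) auto
    show ?thesis
    proof (rule ex1I[of _ "f(U := u)"])
      show "f(U := u) \<in> (\<Pi>\<^sub>E X\<in>insert U \<W>. X) \<and> v = (\<Sum>X\<in>insert U \<W>. (f(U := u)) X)"
      proof
        show "f(U := u) \<in> (\<Pi>\<^sub>E X\<in>insert U \<W>. X)"
          using f(1) uw(1) by (auto simp: PiE_def extensional_def)
        show "v = (\<Sum>X\<in>insert U \<W>. (f(U := u)) X)"
          unfolding sum.insert[OF fin UnW] sum_upd using f(2) uw(3) by simp
      qed
    next
      fix h assume h: "h \<in> (\<Pi>\<^sub>E X\<in>insert U \<W>. X) \<and> v = (\<Sum>X\<in>insert U \<W>. h X)"
      \<comment> \<open>Resetting the value at U makes the family extensional on
        \<open>\<W>\<close>, so that uniqueness of the decomposition of w applies.\<close>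
      define f' where "f' = h(U := undefined)"
      have f': "f' \<in> (\<Pi>\<^sub>E X\<in>\<W>. X)"
        using h UnW by (auto simp: f'_def PiE_def Pi_def extensional_def)
      have s: "v = h U + (\<Sum>X\<in>\<W>. f' X)"
        using h fin UnW sum_upd[of h undefined] by (simp add: f'_def)
      have hU: "h U \<in> U" using h by auto
      have "u - h U = (\<Sum>X\<in>\<W>. f' X) - w"
        using s uw(3) by (simp add: algebra_simps)
      then have "u - h U \<in> U \<inter> W"
        using fun_space.subspace_diff[OF Us uw(1) hU] fun_space.subspace_diff[OF Ws sum_W[OF f'] uw(2)]
        by simp
      then have "h U = u" using UW by simp
      then have "w = (\<Sum>X\<in>\<W>. f' X)" using s uw(3) by simp
      then have "f' = f" using f_unique f' by blast
      then show "h = f(U := u)" using \<open>h U = u\<close> by (auto simp: f'_def)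
    qed
  qed
  then show ?thesis
    using fin inv irr U subrep_subrep[of _ W R] by (simp add: irreducible_decomposition_def)
qed

text \<open>\<open>dim\<close> is a cardinality and measures subspaces properly only in finite
  dimension. The ambient function space may be infinite dimensional, hence the finite spanning set
  B.\<close>

lemma fun_space_dim_less:
  assumes W: "fun_space.subspace W" and WV: "W \<subset> V" and B: "finite B" "V \<subseteq> fun_space.span B"
  shows "fun_space.dim W < fun_space.dim V"
proof -
  obtain C where C: "C \<subseteq> W" "fun_space.independent C" "W \<subseteq> fun_space.span C" "card C = fun_space.dim W"
    using fun_space.basis_exists by blast
  obtain v where v: "v \<in> V" "v \<notin> W" using WV by blast
  have "fun_space.span C \<subseteq> W" using C W by (intro fun_space.span_minimal)
  then have vC: "v \<notin> fun_space.span C" using v by blast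
  then have ind: "fun_space.independent (insert v C)"
    using C(2) by (simp add: fun_space.independent_insert)
  obtain D where D: "insert v C \<subseteq> D" "D \<subseteq> V" "fun_space.independent D" "V \<subseteq> fun_space.span D"
    using fun_space.maximal_independent_subset_extend[OF _ ind, of V] v C(1) WV by blast
  have "finite D" using fun_space.independent_span_bound[OF B(1) D(3)] D(2) B(2) by blast
  then have "card (insert v C) \<le> card D" and "finite C"
    using D(1) by (auto intro: card_mono finite_subset)
  moreover have "v \<notin> C" using vC fun_space.span_base by blast
  moreover have "card D = fun_space.dim V"
    using fun_space.basis_card_eq_dim[OF D(2) D(4) D(3)] .
  ultimately show ?thesis using C(4) by simp
qed

text \<open>A nonzero invariant subspace of least dimension is irreducible, and
  \<open>maschke\<close> gives a complement of smaller dimension than the whole space.\<close>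

lemma irreducible_decomposition_exists:
  assumes "complex_rep G R" "finite (carrier G)" "finite B" "rep_space R \<subseteq> fun_space.span B"
  shows "\<exists>\<U>. irreducible_decomposition G R \<U>"
  using assms(1,4)
proof (induction "fun_space.dim (rep_space R)" arbitrary: R rule: less_induct)
  case less
  note R = less.prems(1)
  show ?case
  proof (cases "rep_space R = {0}")
    case True
    then have "irreducible_decomposition G R {}"
      by (auto simp: irreducible_decomposition_def)
    then show ?thesis by blast
  next
    case False
    let ?P = "\<lambda>U. invariant_subspace G R U \<and> U \<noteq> {0}"
    obtain U where U: "?P U" and min: "\<And>X. ?P X \<Longrightarrow> fun_space.dim U \<le> fun_space.dim X"
      using ex_has_least_nat[of ?P "rep_space R" fun_space.dim] False invariant_subspace_whole[OF R] by blast
    have sub: "U \<subseteq> rep_space R" using U by (simp add: invariant_subspace_def)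
    have "irreducible_rep G (subrep R U)"
      unfolding irreducible_rep_def
    proof (intro conjI allI impI)
      show "complex_rep G (subrep R U)" using complex_rep_subrep[OF R] U by blast
      show "rep_space (subrep R U) \<noteq> {0}" using U by simp
      fix X assume "invariant_subspace G (subrep R U) X"
      then have X: "invariant_subspace G R X" "X \<subseteq> U"
        using invariant_subspace_subrep U by blast+
      show "X = {0} \<or> X = rep_space (subrep R U)"
      proof (rule ccontr)
        assume "\<not> ?thesis"
        then have "X \<subset> U" "X \<noteq> {0}" using X by auto
        moreover from this have "fun_space.dim X < fun_space.dim U"
          using X sub less.prems(2) assms(3)
          by (intro fun_space_dim_less[of X U B]) (auto simp: invariant_subspace_def)
        ultimately show False using min[of X] X by auto
      qed
    qed
    moreover obtain W where W: "invariant_subspace G R W" "U \<inter> W = {0}"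
        "\<And>v. v \<in> rep_space R \<Longrightarrow> \<exists>u\<in>U. \<exists>w\<in>W. v = u + w"
      using maschke[OF R assms(2)] U by blast
    moreover have "\<exists>\<W>. irreducible_decomposition G (subrep R W) \<W>"
    proof (rule less.hyps)
      have "W \<noteq> rep_space R" using W(2) U sub by blast
      then show "fun_space.dim (rep_space (subrep R W)) < fun_space.dim (rep_space R)"
        using W(1) less.prems(2) assms(3)
        by (intro fun_space_dim_less[of _ _ B]) (auto simp: invariant_subspace_def)
      show "complex_rep G (subrep R W)" using complex_rep_subrep[OF R W(1)] .
      show "rep_space (subrep R W) \<subseteq> fun_space.span B"
        using W(1) less.prems(2) by (auto simp: invariant_subspace_def)
    qed
    ultimately show ?thesis using irreducible_decomposition_insert[OF R] U by blast
  qed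
qed

text \<open>\<open>occurs_in\<close> asks for some decomposition, so one is built around the image
  of \<open>\<phi>\<close>: by Schur it is a copy of S, and a complement of it is decomposed
  separately.\<close>

lemma occurs_inI:
  assumes R: "complex_rep G R" and fin: "finite (carrier G)" "finite B" "rep_space R \<subseteq> fun_space.span B"
    and S: "irreducible_rep G S" and \<phi>: "rep_hom G S R \<phi>" and v: "v \<in> rep_space S" "\<phi> v \<noteq> 0"
  shows "occurs_in G S R"
proof -
  have S': "complex_rep G S" using S by (simp add: irreducible_rep_def)
  let ?U = "\<phi> ` rep_space S"
  have U: "invariant_subspace G R ?U" and eq: "equivalent_rep G S (subrep R ?U)"
    using equivalent_rep_image[OF S' R \<phi> irreducible_rep_hom_inj[OF S R \<phi> v]] by auto
  obtain W where W: "invariant_subspace G R W" "?U \<inter> W = {0}"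
      "\<And>v. v \<in> rep_space R \<Longrightarrow> \<exists>u\<in>?U. \<exists>w\<in>W. v = u + w"
    using maschke[OF R fin(1) U] by blast
  have "rep_space (subrep R W) \<subseteq> fun_space.span B"
    using W(1) fin(3) by (auto simp: invariant_subspace_def)
  then obtain \<W> where "irreducible_decomposition G (subrep R W) \<W>"
    using irreducible_decomposition_exists[OF complex_rep_subrep[OF R W(1)] fin(1,2)] by blast
  then have "irreducible_decomposition G R (insert ?U \<W>)"
    using irreducible_decomposition_insert[OF R U irreducible_equivalent[OF S eq] W(1,2)] W(3) by blast
  then show ?thesis using eq by (auto simp: occurs_in_def)
qed

text \<open>Carries finite dimension from an induced representation to any representation equivalent
  to it.\<close>

lemma finite_span_image:
  assumes lin: "linear_map_on fun_scale fun_scale V \<phi>" and V: "fun_space.subspace V"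
    and B: "finite B" "V \<subseteq> fun_space.span B"
  shows "\<exists>C. finite C \<and> \<phi> ` V \<subseteq> fun_space.span C"
proof -
  obtain C where C: "C \<subseteq> V" "fun_space.independent C" "V \<subseteq> fun_space.span C"
    using fun_space.maximal_independent_subset by blast
  have fin: "finite C" using fun_space.independent_span_bound[OF B(1) C(2)] C(1) B(2) by blast
  have "\<phi> v \<in> fun_space.span (\<phi> ` C)" if v: "v \<in> V" for v
  proof -
    obtain c where c: "v = (\<Sum>b\<in>C. fun_scale (c b) b)"
      using v C(3) unfolding fun_space.span_finite[OF fin] by blast
    have "\<phi> v = (\<Sum>b\<in>C. \<phi> (fun_scale (c b) b))"
      unfolding c using C(1) by (intro linear_map_on_sum[OF lin V] fun_space.subspace_scale[OF V]) auto
    also have "\<dots> = (\<Sum>b\<in>C. fun_scale (c b) (\<phi> b))"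
      using C(1) by (intro sum.cong refl linear_map_on_scale[OF lin]) auto
    also have "\<dots> \<in> fun_space.span (\<phi> ` C)"
      by (intro fun_space.span_sum fun_space.span_scale fun_space.span_base) auto
    finally show ?thesis .
  qed
  then show ?thesis using fin by blast
qed

subsection \<open>Representations induced from linear characters\<close>

lemma sum_fun_apply: "(\<Sum>i\<in>I. F i) x = (\<Sum>i\<in>I. F i x)"
  by (induction I rule: infinite_finite_induct) auto

lemma fun_scale_apply [simp]: "fun_scale c f x = c * f x"
  by (simp add: fun_scale_def)

lemma induced_rep_simps:
  "rep_space (induced_rep G P \<xi>) = induced_space G P \<xi>"
  "f \<in> induced_space G P \<xi> \<Longrightarrow>
    rep_act (induced_rep G P \<xi>) g f = (\<lambda>x. if x \<in> carrier G then f (x \<otimes>\<^bsub>G\<^esub> g) else 0)"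
  by (simp_all add: induced_rep_def)

lemma restrict_rep_simps [simp]:
  "rep_space (restrict_rep H R) = rep_space R"
  "g \<in> carrier H \<Longrightarrow> rep_act (restrict_rep H R) g = rep_act R g"
  by (simp_all add: restrict_rep_def)

locale linear_character = group G for G (structure) +
  fixes P :: "'a set" and \<xi> :: "'a \<Rightarrow> complex"
  assumes fin: "finite (carrier G)" and P: "subgroup P G"
    and \<xi>_mult: "p \<in> P \<Longrightarrow> q \<in> P \<Longrightarrow> \<xi> (p \<otimes> q) = \<xi> p * \<xi> q"
    and \<xi>_nonzero: "p \<in> P \<Longrightarrow> \<xi> p \<noteq> 0"
begin

sublocale P: subgroup P G by (rule P)

lemma \<xi>_one: "\<xi> \<one> = 1"
  using \<xi>_mult[of \<one> \<one>] \<xi>_nonzero[of \<one>] by simp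

lemma \<xi>_inv: "p \<in> P \<Longrightarrow> \<xi> (inv p) * \<xi> p = 1" "p \<in> P \<Longrightarrow> \<xi> p * \<xi> (inv p) = 1"
  using \<xi>_mult[of "inv p" p] \<xi>_mult[of p "inv p"] \<xi>_one by auto

abbreviation "V \<equiv> induced_space G P \<xi>"

abbreviation "R \<equiv> induced_rep G P \<xi>"

lemma V_mult: "f \<in> V \<Longrightarrow> p \<in> P \<Longrightarrow> x \<in> carrier G \<Longrightarrow> f (p \<otimes> x) = \<xi> p * f x"
  by (simp add: induced_space_def)

lemma V_outside: "f \<in> V \<Longrightarrow> x \<notin> carrier G \<Longrightarrow> f x = 0"
  by (simp add: induced_space_def)

text \<open>The character extended by zero. P acts on it through \<open>\<xi>\<close>, and its
  translates span the induced space.\<close>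

definition base :: "'a \<Rightarrow> complex" where "base x = (if x \<in> P then \<xi> x else 0)"

lemma mult_in_P_iff:
  assumes "p \<in> P" "x \<in> carrier G"
  shows "p \<otimes> x \<in> P \<longleftrightarrow> x \<in> P" "x \<otimes> p \<in> P \<longleftrightarrow> x \<in> P"
proof -
  have "x = inv p \<otimes> (p \<otimes> x)" "x = (x \<otimes> p) \<otimes> inv p"
    using assms by (auto simp: m_assoc m_assoc[symmetric])
  then show "p \<otimes> x \<in> P \<longleftrightarrow> x \<in> P" "x \<otimes> p \<in> P \<longleftrightarrow> x \<in> P"
    using assms by (metis P.m_closed P.m_inv_closed)+
qed

lemma base_in_V: "base \<in> V"
  by (auto simp: induced_space_def base_def mult_in_P_iff \<xi>_mult)

lemma base_nonzero: "base \<noteq> 0"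
proof
  assume "base = 0"
  then have "base \<one> = 0" by simp
  then show False by (simp add: base_def \<xi>_one)
qed

lemma act_base: "q \<in> P \<Longrightarrow> rep_act R q base = fun_scale (\<xi> q) base"
  by (auto simp: induced_rep_simps(2)[OF base_in_V] base_def mult_in_P_iff \<xi>_mult fun_eq_iff)

text \<open>Up to a factor this is the projection to the vectors on which P acts through
  \<open>\<xi>\<close>. The value at the identity shows that g is nonzero whenever f is nonzero
  there.\<close>

lemma averaging:
  fixes f :: "'a \<Rightarrow> complex"
  assumes f: "f \<in> V"
  defines "g \<equiv> (\<Sum>q\<in>P. fun_scale (\<xi> (inv q)) (rep_act R q f))"
  shows "g \<one> = of_nat (card P) * f \<one>"
    and "y \<in> carrier G \<Longrightarrow> q \<in> P \<Longrightarrow> g (y \<otimes> q) = g y * \<xi> q"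
proof -
  have g: "g y = (\<Sum>q\<in>P. \<xi> (inv q) * f (y \<otimes> q))" if "y \<in> carrier G" for y
    using that f by (simp add: g_def sum_fun_apply induced_rep_simps)
  have "\<xi> (inv q) * f q = f \<one>" if "q \<in> P" for q
    using V_mult[OF f that, of \<one>] that \<xi>_inv(1)[OF that] by (simp flip: mult.assoc)
  then show "g \<one> = card P * f \<one>"
    by (simp add: g)
  show "g (y \<otimes> q) = g y * \<xi> q" if yq: "y \<in> carrier G" "q \<in> P"
  proof -
    have "g (y \<otimes> q) = (\<Sum>r\<in>P. \<xi> (inv r) * f (y \<otimes> q \<otimes> r))"
      using yq by (simp add: g)
    also have "\<dots> = (\<Sum>r\<in>P. \<xi> (inv r) * \<xi> q * f (y \<otimes> r))"
    proof (rule sum.reindex_bij_witness[of _ "\<lambda>r. inv q \<otimes> r" "\<lambda>r. q \<otimes> r"])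
      fix r assume r: "r \<in> P"
      have "\<xi> (inv (q \<otimes> r)) * \<xi> q = \<xi> (inv r)"
        using \<xi>_mult[of "inv r" "inv q"] yq r \<xi>_inv(1)[OF yq(2)] by (simp add: inv_mult_group mult.assoc)
      then show "\<xi> (inv (q \<otimes> r)) * \<xi> q * f (y \<otimes> (q \<otimes> r)) = \<xi> (inv r) * f (y \<otimes> q \<otimes> r)"
        using yq r by (simp add: m_assoc)
    qed (use yq in \<open>auto simp: m_assoc[symmetric]\<close>)
    also have "\<dots> = g y * \<xi> q"
      using yq by (simp add: g sum_distrib_left sum_distrib_right mult_ac)
    finally show ?thesis .
  qed
qed

lemma card_P: "card P \<noteq> 0"
  using finite_subset[OF P.subset fin] P.one_closed by (metis card_0_eq empty_iff)

text \<open>At x only the y with x y^-1 in P contribute, and by covariance each of these |P| terms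
  equals v x.\<close>

lemma V_spanned_by_translates:
  assumes v: "v \<in> V"
  shows "v = fun_scale (1 / card P) (\<Sum>y\<in>carrier G. fun_scale (v y) (rep_act R (inv y) base))"
proof
  fix x
  show "v x = fun_scale (1 / card P) (\<Sum>y\<in>carrier G. fun_scale (v y) (rep_act R (inv y) base)) x"
  proof (cases "x \<in> carrier G")
    case x: True
    have "(\<Sum>y\<in>carrier G. fun_scale (v y) (rep_act R (inv y) base)) x
        = (\<Sum>y\<in>carrier G. v y * base (x \<otimes> inv y))"
      using x by (simp add: sum_fun_apply induced_rep_simps base_in_V)
    also have "\<dots> = (\<Sum>z\<in>carrier G. if z \<in> P then v x else 0)"
    proof (rule sum.reindex_bij_witness[of _ "\<lambda>z. inv z \<otimes> x" "\<lambda>y. x \<otimes> inv y"])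
      fix y assume y: "y \<in> carrier G"
      show "inv (x \<otimes> inv y) \<otimes> x = y" using x y by (simp add: inv_mult_group m_assoc)
      show "(if x \<otimes> inv y \<in> P then v x else 0) = v y * base (x \<otimes> inv y)"
        using V_mult[OF v, of "x \<otimes> inv y" y] x y by (auto simp: base_def m_assoc)
    next
      fix z assume z: "z \<in> carrier G"
      show "x \<otimes> inv (inv z \<otimes> x) = z"
        using x z by (simp add: inv_mult_group) (simp add: m_assoc[symmetric])
    qed (use x in auto)
    also have "\<dots> = card P * v x"
      using fin P.subset by (simp add: sum.If_cases Int_absorb1)
    finally show ?thesis using card_P by simp
  qed (use V_outside[OF v] in \<open>simp add: sum_fun_apply induced_rep_simps base_in_V\<close>)
qed

text \<open>By \<open>crit\<close>, functions covariant under P on both sides are supported on P,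
  hence multiples of \<open>base\<close>. Averaging produces a nonzero one in every nonzero
  invariant subspace, and \<open>base\<close> generates the whole space.\<close>

lemma irreducible:
  assumes R: "complex_rep G R"
    and crit: "\<And>f x. f \<in> V \<Longrightarrow> (\<And>y q. y \<in> carrier G \<Longrightarrow> q \<in> P \<Longrightarrow> f (y \<otimes> q) = f y * \<xi> q) \<Longrightarrow>
      x \<in> carrier G \<Longrightarrow> f x \<noteq> 0 \<Longrightarrow> x \<in> P"
  shows "irreducible_rep G R"
  unfolding irreducible_rep_def
proof (intro conjI allI impI)
  show "complex_rep G R" by fact
  show "rep_space R \<noteq> {0}" using base_in_V base_nonzero by (auto simp: induced_rep_simps)
  fix U assume U: "invariant_subspace G R U"
  then have Us: "fun_space.subspace U" "U \<subseteq> V"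
    and Ug: "\<And>g v. g \<in> carrier G \<Longrightarrow> v \<in> U \<Longrightarrow> rep_act R g v \<in> U"
    by (auto simp: invariant_subspace_def induced_rep_simps)
  show "U = {0} \<or> U = rep_space R"
  proof (cases "U = {0}")
    case False
    then obtain f where f: "f \<in> U" "f \<noteq> 0" using fun_space.subspace_0[OF Us(1)] by blast
    then obtain x where x: "f x \<noteq> 0" by (auto simp: fun_eq_iff)
    then have xG: "x \<in> carrier G" using V_outside f Us(2) by blast
    \<comment> \<open>Translation moves a point where f is nonzero to the identity, where
      \<open>averaging\<close> controls the value.\<close>
    define f1 where "f1 = rep_act R x f"
    have f1: "f1 \<in> U" "f1 \<one> \<noteq> 0"
      using Ug[OF xG f(1)] f Us(2) x xG by (auto simp: f1_def induced_rep_simps subset_iff)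
    define g where "g = (\<Sum>q\<in>P. fun_scale (\<xi> (inv q)) (rep_act R q f1))"
    have f1V: "f1 \<in> V" using f1 Us(2) by blast
    have gU: "g \<in> U" unfolding g_def
      by (intro fun_space.subspace_sum[OF Us(1)] fun_space.subspace_scale[OF Us(1)] Ug f1) auto
    have gV: "g \<in> V" using gU Us(2) by blast
    have g1: "g \<one> \<noteq> 0" using averaging(1)[OF f1V] f1(2) card_P by (simp add: g_def)
    have g_base: "g y = g \<one> * base y" for y
    proof (cases "y \<in> P")
      case True
      then show ?thesis using V_mult[OF gV True, of \<one>] by (simp add: base_def)
    next
      case False
      then have "g y = 0"
        using crit[OF gV, of y] averaging(2)[OF f1V] V_outside[OF gV, of y] by (auto simp: g_def)
      then show ?thesis using False by (simp add: base_def)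
    qed
    have "base y = fun_scale (1 / g \<one>) g y" for y
      using g1 by (simp add: g_base[of y])
    then have "base = fun_scale (1 / g \<one>) g" by (rule ext)
    then have bU: "base \<in> U" using fun_space.subspace_scale[OF Us(1) gU, of "1 / g \<one>"] by simp
    have "v \<in> U" if "v \<in> V" for v
      by (subst V_spanned_by_translates[OF that])
        (intro fun_space.subspace_sum[OF Us(1)] fun_space.subspace_scale[OF Us(1)] Ug bU, auto)
    then show ?thesis using Us(2) by (auto simp: induced_rep_simps)
  qed simp
qed

end

section \<open>Maps from an induced representation of H to the restriction of an induced
  representation of G\<close>

locale subgroup_characters = G: linear_character G P \<xi> + H: linear_character H Q \<eta>
  for G :: "('a, 'm) monoid_scheme" (structure) and P \<xi> and H :: "('a, 'm) monoid_scheme" and Q \<eta> +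
  assumes HG: "carrier H \<subseteq> carrier G" "mult H = mult G" "one H = one G"
begin

text \<open>The function \<open>intertwiner x \<phi>\<close> is supported on \<open>P x H\<close> and takes the value \<open>\<xi> p\<^sup>-\<^sup>1 \<phi> h\<close>
  at \<open>z = p\<^sup>-\<^sup>1 x h\<close>, summed over all such representations of \<open>z\<close>.\<close>

definition intertwiner :: "'a \<Rightarrow> ('a \<Rightarrow> complex) \<Rightarrow> 'a \<Rightarrow> complex"
  where "intertwiner x \<phi> z = (if z \<in> carrier G
    then \<Sum>p\<in>P. \<Sum>h\<in>carrier H. if p \<otimes> z = x \<otimes> h then \<xi> (inv p) * \<phi> h else 0 else 0)"

lemma H_in_G: "h \<in> carrier H \<Longrightarrow> h \<in> carrier G"
  using HG by blast

lemma H_mult: "h \<in> carrier H \<Longrightarrow> k \<in> carrier H \<Longrightarrow> h \<otimes> k \<in> carrier H"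
  using H.m_closed HG by metis

lemma H_inv: "h \<in> carrier H \<Longrightarrow> inv\<^bsub>H\<^esub> h = inv h"
  using H.l_inv[of h] H.inv_closed[of h] HG by (metis G.inv_equality H_in_G)

text \<open>Left covariance under k in P comes from the substitution p \<mapsto> p k, compatibility
  with right translation by k in H from h \<mapsto> h k.\<close>

lemma intertwiner_hom:
  assumes x: "x \<in> carrier G"
  shows "rep_hom H H.R (restrict_rep H G.R) (intertwiner x)"
  unfolding rep_hom_def
proof (intro conjI ballI image_subsetI)
  have "intertwiner x (\<phi> + \<theta>) z = intertwiner x \<phi> z + intertwiner x \<theta> z" for \<phi> \<theta> z
    by (simp add: intertwiner_def distrib_left if_distrib sum.distrib[symmetric] cong: if_cong)
  moreover have "intertwiner x (fun_scale c \<phi>) z = c * intertwiner x \<phi> z" for c \<phi> z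
    by (simp add: intertwiner_def sum_distrib_left if_distrib mult_ac cong: if_cong)
  ultimately show "linear_map_on fun_scale fun_scale (rep_space H.R) (intertwiner x)"
    by (auto simp: linear_map_on_def fun_eq_iff)
  have inV: "intertwiner x \<phi> \<in> G.V" for \<phi>
  proof -
    have "intertwiner x \<phi> (k \<otimes> z) = \<xi> k * intertwiner x \<phi> z" if k: "k \<in> P" and z: "z \<in> carrier G" for k z
    proof -
      let ?t = "\<lambda>p h. if p \<otimes> z = x \<otimes> h then \<xi> k * (\<xi> (inv p) * \<phi> h) else 0"
      have "intertwiner x \<phi> (k \<otimes> z)
          = (\<Sum>p\<in>P. \<Sum>h\<in>carrier H. if p \<otimes> (k \<otimes> z) = x \<otimes> h then \<xi> (inv p) * \<phi> h else 0)"
        using k z by (simp add: intertwiner_def)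
      also have "\<dots> = (\<Sum>p\<in>P. \<Sum>h\<in>carrier H. ?t p h)"
      proof (rule sum.reindex_bij_witness[of _ "\<lambda>p. p \<otimes> inv k" "\<lambda>p. p \<otimes> k"])
        fix p assume p: "p \<in> P"
        have "\<xi> k * \<xi> (inv (p \<otimes> k)) = \<xi> (inv p)"
          using G.\<xi>_mult[of "inv k" "inv p"] k p G.\<xi>_inv(2)[OF k]
          by (simp add: G.inv_mult_group flip: mult.assoc)
        then have *: "\<xi> k * (\<xi> (inv (p \<otimes> k)) * w) = \<xi> (inv p) * w" for w
          by (simp flip: mult.assoc)
        show "(\<Sum>h\<in>carrier H. ?t (p \<otimes> k) h) =
            (\<Sum>h\<in>carrier H. if p \<otimes> (k \<otimes> z) = x \<otimes> h then \<xi> (inv p) * \<phi> h else 0)"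
          using k p z by (simp add: G.m_assoc * cong: if_cong)
      qed (use k in \<open>auto simp: G.m_assoc\<close>)
      also have "\<dots> = \<xi> k * intertwiner x \<phi> z"
        using z by (simp add: intertwiner_def sum_distrib_left if_distrib cong: if_cong)
      finally show ?thesis .
    qed
    then show ?thesis by (simp add: induced_space_def intertwiner_def)
  qed
  then show "intertwiner x \<phi> \<in> rep_space (restrict_rep H G.R)" for \<phi>
    by (simp add: induced_rep_simps)
  fix k \<phi> assume k: "k \<in> carrier H" and "\<phi> \<in> rep_space H.R"
  then have \<phi>: "\<phi> \<in> H.V" by (simp add: induced_rep_simps)
  have inv_k: "inv k \<in> carrier H" using H.inv_closed[OF k] H_inv[OF k] by simp
  show "intertwiner x (rep_act H.R k \<phi>) = rep_act (restrict_rep H G.R) k (intertwiner x \<phi>)"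
  proof
    fix z
    show "intertwiner x (rep_act H.R k \<phi>) z = rep_act (restrict_rep H G.R) k (intertwiner x \<phi>) z"
    proof (cases "z \<in> carrier G")
      case z: True
      have "(\<Sum>h\<in>carrier H. if p \<otimes> z = x \<otimes> h then \<xi> (inv p) * rep_act H.R k \<phi> h else 0)
          = (\<Sum>h\<in>carrier H. if p \<otimes> (z \<otimes> k) = x \<otimes> h then \<xi> (inv p) * \<phi> h else 0)" if p: "p \<in> P" for p
      proof (rule sum.reindex_bij_witness[of _ "\<lambda>h. h \<otimes> inv k" "\<lambda>h. h \<otimes> k"])
        fix h assume h: "h \<in> carrier H"
        have "p \<otimes> z \<otimes> k = x \<otimes> h \<otimes> k \<longleftrightarrow> p \<otimes> z = x \<otimes> h"
          using p z x h k H_in_G by (intro G.right_cancel) auto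
        then have "p \<otimes> (z \<otimes> k) = x \<otimes> (h \<otimes> k) \<longleftrightarrow> p \<otimes> z = x \<otimes> h"
          using p z x h k H_in_G by (simp add: G.m_assoc)
        then show "(if p \<otimes> (z \<otimes> k) = x \<otimes> (h \<otimes> k) then \<xi> (inv p) * \<phi> (h \<otimes> k) else 0) =
            (if p \<otimes> z = x \<otimes> h then \<xi> (inv p) * rep_act H.R k \<phi> h else 0)"
          using h \<phi> HG(2) by (simp add: induced_rep_simps)
      qed (simp_all add: G.m_assoc H_mult H_in_G k inv_k)
      then have "intertwiner x (rep_act H.R k \<phi>) z = intertwiner x \<phi> (z \<otimes> k)"
        using z H_in_G[OF k] by (simp add: intertwiner_def)
      also have "\<dots> = rep_act (restrict_rep H G.R) k (intertwiner x \<phi>) z"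
        using z by (simp add: induced_rep_simps(2)[OF inV] k)
      finally show ?thesis .
    next
      case False
      then show ?thesis by (simp add: induced_rep_simps(2)[OF inV] k) (simp add: intertwiner_def)
    qed
  qed
qed

text \<open>In the value at x, a pair with p x = x h and h in Q has p = x h x^-1, so the two
  characters cancel and the summand is 1. The value counts such pairs, and p = h = 1 is one of
  them.\<close>

lemma intertwiner_nonzero:
  assumes x: "x \<in> carrier G"
    and compat: "\<And>q. q \<in> Q \<Longrightarrow> x \<otimes> q \<otimes> inv x \<in> P \<Longrightarrow> \<xi> (x \<otimes> q \<otimes> inv x) = \<eta> q"
  shows "intertwiner x H.base \<noteq> 0"
proof -
  have *: "(if p \<otimes> x = x \<otimes> h then \<xi> (inv p) * H.base h else 0) = (if p \<otimes> x = x \<otimes> h \<and> h \<in> Q then 1 else 0)"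
    if p: "p \<in> P" and h: "h \<in> carrier H" for p h
  proof (cases "p \<otimes> x = x \<otimes> h \<and> h \<in> Q")
    case True
    then have "p = x \<otimes> h \<otimes> inv x"
      using p x by (metis G.P.mem_carrier G.inv_solve_right' G.m_closed H_in_G h)
    then have "\<eta> h = \<xi> p" using compat[of h] True p by simp
    then show ?thesis using True G.\<xi>_inv(1)[OF p] by (simp add: H.base_def)
  qed (auto simp: H.base_def)
  define n :: nat where
    "n = (\<Sum>p\<in>P. \<Sum>h\<in>carrier H. if p \<otimes> x = x \<otimes> h \<and> h \<in> Q then 1 else 0)"
  have "intertwiner x H.base x =
      (\<Sum>p\<in>P. \<Sum>h\<in>carrier H. if p \<otimes> x = x \<otimes> h \<and> h \<in> Q then 1 else 0)"
    using x * by (auto simp: intertwiner_def intro!: sum.cong)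
  also have "\<dots> = of_nat n"
    by (simp add: n_def if_distrib cong: if_cong)
  also have "\<dots> \<noteq> 0"
  proof
    assume "of_nat n = (0 :: complex)"
    then have "n = 0" by simp
    moreover have "finite P" using finite_subset[OF G.P.subset G.fin] .
    moreover have "\<one> \<in> carrier H" "\<one> \<in> Q" using H.one_closed H.P.one_closed HG(3) by auto
    ultimately have "(if \<one> \<otimes> x = x \<otimes> \<one> \<and> \<one> \<in> Q then 1 else 0) = (0 :: nat)"
      using H.fin G.P.one_closed unfolding n_def sum_eq_0_iff[OF \<open>finite P\<close>] sum_eq_0_iff[OF H.fin]
      by blast
    then show False using x \<open>\<one> \<in> Q\<close> by simp
  qed
  finally show ?thesis by auto
qed

text \<open>An occurrence sends \<open>H.base\<close> to a nonzero f that is covariant under P on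
  the left and Q on the right. At a point x with f x nonzero, computing f (x q) in both ways
  compares the characters. Conversely, \<open>intertwiner x\<close> provides a nonzero map.\<close>

theorem occurs_in_induced_iff:
  assumes T: "equivalent_rep G T G.R" and t: "equivalent_rep H t H.R" and irr: "irreducible_rep H H.R"
  shows "occurs_in H t (restrict_rep H T) \<longleftrightarrow>
    (\<exists>x\<in>carrier G. \<forall>q\<in>Q. x \<otimes> q \<otimes> inv x \<in> P \<longrightarrow> \<xi> (x \<otimes> q \<otimes> inv x) = \<eta> q)" (is "?L \<longleftrightarrow> ?R")
proof
  obtain \<alpha> where \<alpha>: "rep_hom G T G.R \<alpha>" "bij_betw \<alpha> (rep_space T) (rep_space G.R)"
    using equivalent_repE[OF T] by blast
  obtain \<alpha>' where \<alpha>': "rep_hom G G.R T \<alpha>'" "bij_betw \<alpha>' (rep_space G.R) (rep_space T)"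
    using equivalent_repE[OF equivalent_rep_sym[OF T]] by blast
  obtain \<beta> where \<beta>: "rep_hom H t H.R \<beta>" "bij_betw \<beta> (rep_space t) (rep_space H.R)"
    using equivalent_repE[OF t] by blast
  obtain \<beta>' where \<beta>': "rep_hom H H.R t \<beta>'" "bij_betw \<beta>' (rep_space H.R) (rep_space t)"
    using equivalent_repE[OF equivalent_rep_sym[OF t]] by blast
  have cT: "complex_rep G T" "complex_rep G G.R" "complex_rep H t" "complex_rep H H.R"
    using T t by (auto simp: equivalent_rep_def)
  have cT': "complex_rep H (restrict_rep H T)"
    by (rule complex_rep_restrict[OF cT(1) H.is_group HG])
  have base: "H.base \<in> rep_space H.R" using H.base_in_V by (simp add: induced_rep_simps)
  {
    assume ?L
    then obtain U where inv: "invariant_subspace H (restrict_rep H T) U"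
      and eq: "equivalent_rep H t (subrep (restrict_rep H T) U)"
      by (auto simp: occurs_in_def irreducible_decomposition_def)
    obtain \<gamma> where \<gamma>: "rep_hom H t (subrep (restrict_rep H T) U) \<gamma>" "bij_betw \<gamma> (rep_space t) U"
      using equivalent_repE[OF eq] by auto
    have UT: "U \<subseteq> rep_space T" using inv by (simp add: invariant_subspace_def)
    define \<phi> where "\<phi> = \<alpha> \<circ> (\<gamma> \<circ> \<beta>')"
    have \<gamma>\<beta>: "\<gamma> (\<beta>' v) \<in> U" if "v \<in> H.V" for v
      using that \<beta>'(1) \<gamma>(1) by (auto simp: rep_hom_def induced_rep_simps image_subset_iff)
    have act: "\<gamma> (\<beta>' (rep_act H.R g v)) = rep_act T g (\<gamma> (\<beta>' v))" if "g \<in> carrier H" "v \<in> H.V" for g v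
      using that \<beta>'(1) \<gamma>(1) \<gamma>\<beta>[OF that(2)] by (auto simp: rep_hom_def induced_rep_simps image_subset_iff)
    have lin: "linear_map_on fun_scale fun_scale H.V \<phi>"
      using rep_hom_compose[OF \<beta>'(1) \<gamma>(1)] UT \<alpha>(1)
      unfolding \<phi>_def rep_hom_def linear_map_on_def by (auto simp: induced_rep_simps image_subset_iff subset_iff)
    have inj: "inj_on \<phi> H.V"
    proof -
      have "bij_betw (\<gamma> \<circ> \<beta>') H.V U"
        using bij_betw_trans[OF \<beta>'(2) \<gamma>(2)] by (simp add: induced_rep_simps)
      moreover have "inj_on \<alpha> U" using \<alpha>(2) UT by (auto simp: bij_betw_def intro: inj_on_subset)
      ultimately show ?thesis by (auto simp: \<phi>_def bij_betw_def intro: comp_inj_on)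
    qed
    define f where "f = \<phi> H.base"
    have fV: "f \<in> G.V"
      using \<alpha>(1) \<gamma>\<beta>[OF H.base_in_V] UT by (auto simp: f_def \<phi>_def rep_hom_def induced_rep_simps image_subset_iff)
    have "0 \<in> H.V" using fun_space.subspace_0[OF complex_repD(2)[OF cT(4)]] by (simp add: induced_rep_simps)
    then have "f \<noteq> 0"
      using inj_onD[OF inj, of H.base 0] H.base_in_V H.base_nonzero linear_map_on_zero[OF lin]
      by (auto simp: f_def)
    then obtain x where x: "f x \<noteq> 0" by (auto simp: fun_eq_iff)
    then have xG: "x \<in> carrier G" using G.V_outside[OF fV] by blast
    have fq: "f (x \<otimes> q) = f x * \<eta> q" if q: "q \<in> Q" for q
    proof -
      have qH: "q \<in> carrier H" "q \<in> carrier G" using q HG(1) by auto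
      have "rep_act G.R q f = \<phi> (rep_act H.R q H.base)"
        using \<alpha>(1) act[OF qH(1) H.base_in_V] \<gamma>\<beta>[OF H.base_in_V] UT qH
        by (auto simp: f_def \<phi>_def rep_hom_def)
      also have "\<dots> = fun_scale (\<eta> q) f"
        using linear_map_on_scale[OF lin H.base_in_V] by (simp add: H.act_base[OF q] f_def)
      finally have "rep_act G.R q f x = \<eta> q * f x" by simp
      then show ?thesis using fV xG by (simp add: induced_rep_simps mult.commute)
    qed
    have "\<xi> (x \<otimes> q \<otimes> inv x) = \<eta> q" if q: "q \<in> Q" "x \<otimes> q \<otimes> inv x \<in> P" for q
    proof -
      have "q \<in> carrier G" using q HG(1) by auto
      then have "f (x \<otimes> q) = \<xi> (x \<otimes> q \<otimes> inv x) * f x"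
        using G.V_mult[OF fV q(2) xG] xG by (simp add: G.m_assoc)
      then show ?thesis using fq[OF q(1)] x by simp
    qed
    then show ?R using xG by blast
  }
  {
    assume ?R
    then obtain x where x: "x \<in> carrier G"
      "\<And>q. q \<in> Q \<Longrightarrow> x \<otimes> q \<otimes> inv x \<in> P \<Longrightarrow> \<xi> (x \<otimes> q \<otimes> inv x) = \<eta> q" by blast
    have restr: "rep_hom H (restrict_rep H G.R) (restrict_rep H T) \<alpha>'"
      using \<alpha>'(1) HG(1) by (auto simp: rep_hom_def)
    define \<phi> where "\<phi> = \<alpha>' \<circ> intertwiner x \<circ> \<beta>"
    have hom: "rep_hom H t (restrict_rep H T) \<phi>"
      unfolding \<phi>_def by (intro rep_hom_compose[OF \<beta>(1)] rep_hom_compose[OF intertwiner_hom[OF x(1)] restr])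
    obtain v where v: "v \<in> rep_space t" "\<beta> v = H.base"
      using \<beta>(2) base by (metis bij_betw_imp_surj_on imageE)
    have "intertwiner x H.base \<noteq> 0" by (rule intertwiner_nonzero[OF x])
    moreover have "intertwiner x H.base \<in> rep_space G.R"
      using intertwiner_hom[OF x(1)] base by (auto simp: rep_hom_def)
    moreover have "0 \<in> rep_space G.R" using fun_space.subspace_0[OF complex_repD(2)[OF cT(2)]] .
    moreover have "\<alpha>' 0 = 0"
      using \<alpha>'(1) linear_map_on_zero \<open>0 \<in> rep_space G.R\<close> by (auto simp: rep_hom_def)
    ultimately have "\<phi> v \<noteq> 0"
      using inj_onD[of \<alpha>' "rep_space G.R" "intertwiner x H.base" 0] \<alpha>'(2) v(2)
      by (auto simp: \<phi>_def bij_betw_def)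
    \<comment> \<open>The point masses on G span a finite-dimensional space that contains the
      induced space; the bound is then carried over to T.\<close>
    let ?B = "(\<lambda>x y. if y = x then 1 else 0) ` carrier G"
    have "f \<in> fun_space.span ?B" if f: "f \<in> G.V" for f
    proof -
      have "f = (\<Sum>x\<in>carrier G. fun_scale (f x) (\<lambda>y. if y = x then 1 else 0))"
        using G.V_outside[OF f] G.fin
        by (auto simp: fun_eq_iff sum_fun_apply if_distrib[of "(*) _"] cong: if_cong)
      also have "\<dots> \<in> fun_space.span ?B"
        by (intro fun_space.span_sum fun_space.span_scale fun_space.span_base) auto
      finally show ?thesis .
    qed
    then have "\<exists>C. finite C \<and> \<alpha>' ` rep_space G.R \<subseteq> fun_space.span C"
      using \<alpha>'(1) complex_repD(2)[OF cT(2)] G.fin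
      by (intro finite_span_image[of _ _ ?B]) (auto simp: rep_hom_def induced_rep_simps)
    then obtain C where C: "finite C" "rep_space (restrict_rep H T) \<subseteq> fun_space.span C"
      using \<alpha>'(2) by (auto simp: bij_betw_def)
    show ?L
      by (rule occurs_inI[OF cT' H.fin C irreducible_equivalent[OF irr equivalent_rep_sym[OF t]] hom v(1)])
        fact
  }
qed

end

section \<open>The orbit method\<close>

lemma lie_bracket_bilinear:
  "lie_bracket (A + A') B = lie_bracket A B + lie_bracket A' B"
  "lie_bracket A (B + B') = lie_bracket A B + lie_bracket A B'"
  "lie_bracket (mat_scale c A) B = mat_scale c (lie_bracket A B)"
  "lie_bracket A (mat_scale c B) = mat_scale c (lie_bracket A B)"
  for A B :: "('k::field, 'n::finite) sqmat"
proof -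
  have s: "mat_scale c A ** B = mat_scale c (A ** B)" "A ** mat_scale c B = mat_scale c (A ** B)"
    for c and A B :: "('k, 'n) sqmat"
    by (simp_all add: mat_scale_def matrix_matrix_mult_def vec_eq_iff sum_distrib_left mult_ac)
  show "lie_bracket (A + A') B = lie_bracket A B + lie_bracket A' B"
    "lie_bracket A (B + B') = lie_bracket A B + lie_bracket A B'"
    by (simp_all add: lie_bracket_def matrix_add_ldistrib matrix_add_rdistrib)
  show "lie_bracket (mat_scale c A) B = mat_scale c (lie_bracket A B)"
    "lie_bracket A (mat_scale c B) = mat_scale c (lie_bracket A B)"
    by (simp_all add: lie_bracket_def s mat_space.scale_right_diff_distrib)
qed

lemma lie_bracket_swap: "lie_bracket A B = - lie_bracket B A"
  by (simp add: lie_bracket_def)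

lemma lie_bracket_self: "lie_bracket A A = 0"
  by (simp add: lie_bracket_def)

lemma conj_linear:
  "g ** (A + B) ** h = g ** A ** h + g ** B ** h"
  "g ** mat_scale c A ** h = mat_scale c (g ** A ** h)"
  for A B g h :: "('k::field, 'n::finite) sqmat"
  by (simp_all add: matrix_add_ldistrib matrix_add_rdistrib)
    (simp add: mat_scale_def matrix_matrix_mult_def vec_eq_iff sum_distrib_left sum_distrib_right mult_ac)

lemma mat_pow_conj:
  fixes A g h :: "('k::field, 'n::finite) sqmat"
  assumes "h ** g = mat 1" "g ** h = mat 1"
  shows "mat_pow (g ** A ** h) m = g ** mat_pow A m ** h"
proof (induction m)
  case (Suc m)
  have "g ** A ** h ** (g ** mat_pow A m ** h) = g ** A ** (h ** g) ** mat_pow A m ** h"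
    by (simp only: matrix_mul_assoc)
  then show ?case using Suc assms by (simp add: matrix_mul_assoc)
qed (use assms in simp)

lemma mat_exp_conj_eq:
  fixes A g h :: "('k::field, 'n::finite) sqmat"
  assumes "h ** g = mat 1" "g ** h = mat 1"
  shows "mat_exp (g ** A ** h) = g ** mat_exp A ** h"
proof -
  have "g ** (\<Sum>m\<in>I. F m) ** h = (\<Sum>m\<in>I. g ** F m ** h)" for I and F :: "nat \<Rightarrow> ('k, 'n) sqmat"
    by (induction I rule: infinite_finite_induct) (auto simp: conj_linear)
  then show ?thesis by (simp add: mat_exp_def mat_pow_conj[OF assms] conj_linear)
qed

lemma matrix_inv_eqI:
  fixes g h :: "('k::field, 'n::finite) sqmat"
  assumes "h ** g = mat 1" "g ** h = mat 1"
  shows "matrix_inv g = h"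
proof -
  have "g ** matrix_inv g = mat 1 \<and> matrix_inv g ** g = mat 1"
    unfolding matrix_inv_def by (rule someI[of _ h]) (use assms in simp)
  then have "matrix_inv g = (h ** g) ** matrix_inv g" "h ** (g ** matrix_inv g) = h"
    using assms by simp_all
  then show ?thesis by (simp add: matrix_mul_assoc)
qed

lemma card_uniform_fibres:
  assumes "finite A" "\<And>a. a \<in> A \<Longrightarrow> card {b \<in> A. f b = f a} = k"
  shows "card A = card (f ` A) * k"
proof -
  have "card A = (\<Sum>a\<in>A. 1)" by simp
  also have "\<dots> = (\<Sum>y\<in>f ` A. \<Sum>a\<in>{a \<in> A. f a = y}. 1)"
    by (rule sum.image_gen[OF assms(1)])
  also have "\<dots> = (\<Sum>y\<in>f ` A. k)"
    using assms(2) by (intro sum.cong) auto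
  finally show ?thesis by simp
qed

text \<open>Induction on the set of forms: on the kernel of \<open>b x\<close> the remaining forms
  represent f, so f minus their combination vanishes on that kernel and is a multiple of
  \<open>b x\<close>. The factor \<open>d\<close> is read off at a vector w outside the
  kernel.\<close>

lemma in_span_of_forms:
  fixes b :: "'x \<Rightarrow> ('k::field, 'n::finite) sqmat \<Rightarrow> 'k"
  assumes "finite X" "mat_space.subspace V" "linear_map_on mat_scale (*) V f"
    and "\<And>x. x \<in> X \<Longrightarrow> linear_map_on mat_scale (*) V (b x)"
    and "\<And>v. v \<in> V \<Longrightarrow> (\<And>x. x \<in> X \<Longrightarrow> b x v = 0) \<Longrightarrow> f v = 0"
  shows "\<exists>c. \<forall>v\<in>V. f v = (\<Sum>x\<in>X. c x * b x v)"
  using assms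
proof (induction X arbitrary: V rule: finite_induct)
  case empty
  then show ?case by simp
next
  case (insert x X)
  note V = insert.prems(1) and f = insert.prems(2)
  have bx: "linear_map_on mat_scale (*) V (b x)" using insert.prems(3) by simp
  let ?V' = "{v \<in> V. b x v = 0}"
  have V': "mat_space.subspace ?V'"
    using V bx linear_map_on_zero[OF bx]
    by (auto simp: mat_space.subspace_def linear_map_on_def)
  have "\<exists>c. \<forall>v\<in>?V'. f v = (\<Sum>x\<in>X. c x * b x v)"
  proof (rule insert.IH[OF V'])
    show "linear_map_on mat_scale (*) ?V' f" using f by (rule linear_map_on_subset) auto
    show "linear_map_on mat_scale (*) ?V' (b y)" if "y \<in> X" for y
      using insert.prems(3)[of y] that by (auto intro: linear_map_on_subset)
    show "f v = 0" if "v \<in> ?V'" "\<And>y. y \<in> X \<Longrightarrow> b y v = 0" for v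
      using insert.prems(4)[of v] that by auto
  qed
  then obtain c where c: "\<And>v. v \<in> ?V' \<Longrightarrow> f v = (\<Sum>x\<in>X. c x * b x v)" by blast
  have upd: "(\<Sum>y\<in>insert x X. (c(x := d)) y * b y v) = d * b x v + (\<Sum>y\<in>X. c y * b y v)" for d v
    unfolding sum.insert[OF insert.hyps(1,2)] using insert.hyps(2)
    by (auto intro!: sum.cong)
  show ?case
  proof (cases "?V' = V")
    case True
    then have "f v = (\<Sum>y\<in>insert x X. (c(x := 0)) y * b y v)" if "v \<in> V" for v
      using c[of v] that by (simp only: upd) simp
    then show ?thesis by blast
  next
    case False
    then obtain w where w: "w \<in> V" "b x w \<noteq> 0" by blast
    define g where "g v = f v - (\<Sum>y\<in>X. c y * b y v)" for v
    have g: "linear_map_on mat_scale (*) V g"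
      unfolding linear_map_on_def
    proof (intro conjI ballI allI)
      show "g (v + v') = g v + g v'" if "v \<in> V" "v' \<in> V" for v v'
      proof -
        have "(\<Sum>y\<in>X. c y * b y (v + v')) = (\<Sum>y\<in>X. c y * b y v) + (\<Sum>y\<in>X. c y * b y v')"
          unfolding sum.distrib[symmetric]
          using insert.prems(3) that by (intro sum.cong) (auto simp: linear_map_on_def distrib_left)
        then show ?thesis using f that by (simp add: g_def linear_map_on_def)
      qed
      show "g (mat_scale a v) = a * g v" if "v \<in> V" for a v
      proof -
        have "(\<Sum>y\<in>X. c y * b y (mat_scale a v)) = a * (\<Sum>y\<in>X. c y * b y v)"
          unfolding sum_distrib_left
          using insert.prems(3) that by (intro sum.cong) (auto simp: linear_map_on_def)
        then show ?thesis using f that by (simp add: g_def linear_map_on_def right_diff_distrib)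
      qed
    qed
    define d where "d = g w / b x w"
    have "f v = (\<Sum>y\<in>insert x X. (c(x := d)) y * b y v)" if v: "v \<in> V" for v
    proof -
      let ?a = "- (b x v / b x w)"
      have aw: "mat_scale ?a w \<in> V" using V w(1) by (rule mat_space.subspace_scale)
      have z: "v + mat_scale ?a w \<in> ?V'"
        using mat_space.subspace_add[OF V v aw] linear_map_on_add[OF bx v aw]
          linear_map_on_scale[OF bx w(1), of ?a] w(2) by simp
      then have "g (v + mat_scale ?a w) = 0" using c by (simp add: g_def)
      then have "g v = d * b x v"
        using linear_map_on_add[OF g v aw] linear_map_on_scale[OF g w(1), of ?a]
        by (simp add: d_def mult.commute)
      then have "f v = d * b x v + (\<Sum>y\<in>X. c y * b y v)"
        by (simp add: g_def diff_eq_eq)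
      then show ?thesis by (simp only: upd)
    qed
    then show ?thesis by blast
  qed
qed


subsection \<open>Exponential groups\<close>

locale nilpotent_lie =
  fixes L :: "('k::{field,finite}, 'n::{finite,linorder}) sqmat set"
  assumes char_ge: "CARD('n) \<le> CHAR('k)" and L: "lie_subalgebra L strict_upper"
begin

lemma L_subspace: "mat_space.subspace L"
  using L by (simp add: lie_subalgebra_def)

lemma L_strict: "A \<in> L \<Longrightarrow> A \<in> strict_upper"
  using L by (auto simp: lie_subalgebra_def)

lemma L_bracket: "A \<in> L \<Longrightarrow> B \<in> L \<Longrightarrow> lie_bracket A B \<in> L"
  using L by (simp add: lie_subalgebra_def)

lemma L_uminus: "A \<in> L \<Longrightarrow> - A \<in> L"
  using mat_space.subspace_neg[OF L_subspace] .

lemma exp_inverse: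
  assumes "A \<in> L"
  shows "mat_exp (- A) ** mat_exp A = mat 1" "mat_exp A ** mat_exp (- A) = mat 1"
  using mat_exp_uminus[OF char_ge, of A] mat_exp_uminus[OF char_ge, of "- A"] L_strict L_uminus assms
  by auto

lemma matrix_inv_exp: "A \<in> L \<Longrightarrow> matrix_inv (mat_exp A) = mat_exp (- A)"
  using exp_inverse by (intro matrix_inv_eqI) auto

lemma exp_inj: "inj_on mat_exp L"
  using inj_on_subset[OF mat_exp_inj[OF char_ge]] L_strict by blast

abbreviation "G \<equiv> mat_exp ` L"

lemma G_mult: "g \<in> G \<Longrightarrow> h \<in> G \<Longrightarrow> g ** h \<in> G"
proof -
  assume "g \<in> G" "h \<in> G"
  then obtain A B where AB: "A \<in> L" "B \<in> L" "g = mat_exp A" "h = mat_exp B" by blast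
  obtain C where "C \<in> L" "mat_exp A ** mat_exp B = mat_exp (A + B + C)"
    using mat_exp_mult[OF char_ge L L_subspace _ _ AB(1,2)] L_bracket by blast
  then show ?thesis
    using AB mat_space.subspace_add[OF L_subspace] by auto
qed

lemma G_one: "mat 1 \<in> G"
  using mat_exp_0[OF char_ge] mat_space.subspace_0[OF L_subspace] by (metis imageI)

lemma G_inv: "g \<in> G \<Longrightarrow> matrix_inv g \<in> G"
  using matrix_inv_exp L_uminus by auto

lemma G_inverse:
  assumes "g \<in> G"
  shows "matrix_inv g ** g = mat 1" "g ** matrix_inv g = mat 1"
  using assms exp_inverse matrix_inv_exp by auto

lemma G_inv_inv: "g \<in> G \<Longrightarrow> matrix_inv (matrix_inv g) = g"
  using G_inverse by (intro matrix_inv_eqI) auto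

lemma G_inv_mult:
  assumes "g \<in> G" "h \<in> G"
  shows "matrix_inv (g ** h) = matrix_inv h ** matrix_inv g"
proof (rule matrix_inv_eqI)
  have "matrix_inv h ** matrix_inv g ** (g ** h) = matrix_inv h ** (matrix_inv g ** g) ** h"
    by (simp only: matrix_mul_assoc)
  then show "matrix_inv h ** matrix_inv g ** (g ** h) = mat 1" using assms G_inverse by simp
  have "g ** h ** (matrix_inv h ** matrix_inv g) = g ** (h ** matrix_inv h) ** matrix_inv g"
    by (simp only: matrix_mul_assoc)
  then show "g ** h ** (matrix_inv h ** matrix_inv g) = mat 1" using assms G_inverse by simp
qed

lemma group_G: "group (exp_group L)"
proof (rule groupI)
  fix g assume "g \<in> carrier (exp_group L)"
  then show "\<exists>h\<in>carrier (exp_group L). h \<otimes>\<^bsub>exp_group L\<^esub> g = \<one>\<^bsub>exp_group L\<^esub>"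
    using G_inv[of g] G_inverse[of g] by (intro bexI[of _ "matrix_inv g"]) (auto simp: exp_group_def)
qed (use G_mult G_one in \<open>auto simp: exp_group_def matrix_mul_assoc\<close>)

lemma inv_G: "g \<in> G \<Longrightarrow> inv\<^bsub>exp_group L\<^esub> g = matrix_inv g"
  using group.inv_equality[OF group_G, of "matrix_inv g" g] G_inv G_inverse
  by (auto simp: exp_group_def)

lemma Ad_exp:
  assumes "A \<in> L" "B \<in> L" "mat_space.subspace J" "\<And>C. C \<in> J \<Longrightarrow> lie_bracket C A \<in> J"
    and "lie_bracket (lie_bracket B A) A \<in> J"
  shows "mat_exp (- A) ** B ** mat_exp A - B - lie_bracket B A \<in> J"
  using mat_exp_conj[OF char_ge] assms L_strict by blast

lemma Ad_exp_congruent: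
  assumes "A \<in> L" "B \<in> L" "mat_space.subspace J" "\<And>C. C \<in> J \<Longrightarrow> lie_bracket C A \<in> J"
    and "lie_bracket B A \<in> J"
  shows "mat_exp (- A) ** B ** mat_exp A - B \<in> J"
  using mat_space.subspace_add[OF assms(3) Ad_exp[OF assms(1-4)] assms(5)] assms(4,5) by simp

text \<open>This is \<open>Ad_exp_congruent\<close> with J = L; the second inclusion is the first
  one for the inverse element.\<close>

lemma Ad_in_L:
  assumes "g \<in> G" "B \<in> L"
  shows "matrix_inv g ** B ** g \<in> L" "g ** B ** matrix_inv g \<in> L"
proof -
  have *: "matrix_inv g ** B ** g \<in> L" if g: "g \<in> G" for g
  proof -
    obtain A where A: "A \<in> L" "g = mat_exp A" using g by blast
    have "mat_exp (- A) ** B ** mat_exp A - B \<in> L"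
      using A assms(2) by (intro Ad_exp_congruent L_subspace) (auto intro: L_bracket)
    then show ?thesis
      using mat_space.subspace_add[OF L_subspace _ assms(2)] A by (fastforce simp: matrix_inv_exp)
  qed
  show "matrix_inv g ** B ** g \<in> L" by (rule *[OF assms(1)])
  show "g ** B ** matrix_inv g \<in> L" using *[OF G_inv[OF assms(1)]] G_inv_inv[OF assms(1)] by simp
qed

lemma exp_Ad:
  assumes "g \<in> G"
  shows "mat_exp (g ** B ** matrix_inv g) = g ** mat_exp B ** matrix_inv g"
  using assms G_inverse by (intro mat_exp_conj_eq) auto

lemma dual_linear: "l \<in> dual L \<Longrightarrow> linear_map_on mat_scale (*) L l"
  by (simp add: dual_def)

lemma dual_zero: "l \<in> dual L \<Longrightarrow> l 0 = 0"
  using linear_map_on_zero[OF dual_linear] mat_space.subspace_0[OF L_subspace] by blast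

lemma dual_diff:
  assumes "l \<in> dual L" "A \<in> L" "B \<in> L"
  shows "l (A - B) = l A - l B"
  using linear_map_on_add[OF dual_linear[OF assms(1)] mat_space.subspace_diff[OF L_subspace assms(2,3)] assms(3)]
  by simp

lemma dual_uminus: "l \<in> dual L \<Longrightarrow> A \<in> L \<Longrightarrow> l (- A) = - l A"
  using dual_diff[of l 0 A] dual_zero mat_space.subspace_0[OF L_subspace] by simp

lemma coadjoint_apply:
  "l \<in> dual L \<Longrightarrow> A \<in> L \<Longrightarrow> coadjoint L g l A = l (matrix_inv g ** A ** g)"
  by (simp add: coadjoint_def)

lemma coadjoint_in_dual:
  assumes "g \<in> G" "l \<in> dual L"
  shows "coadjoint L g l \<in> dual L"
  unfolding dual_def
proof (intro CollectI conjI)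
  show "coadjoint L g l \<in> extensional L" using assms(2) by (simp add: coadjoint_def)
  show "linear_map_on mat_scale (*) L (coadjoint L g l)"
    using assms dual_linear[OF assms(2)] Ad_in_L[OF assms(1)]
      mat_space.subspace_add[OF L_subspace] mat_space.subspace_scale[OF L_subspace]
    by (simp add: linear_map_on_def coadjoint_apply conj_linear)
qed

lemma coadjoint_mult:
  assumes "g \<in> G" "h \<in> G" "l \<in> dual L"
  shows "coadjoint L (g ** h) l = coadjoint L g (coadjoint L h l)"
proof (rule extensionalityI[of _ L])
  show "coadjoint L (g ** h) l \<in> extensional L" "coadjoint L g (coadjoint L h l) \<in> extensional L"
    using coadjoint_in_dual assms G_mult by (auto simp: dual_def)
  show "coadjoint L (g ** h) l A = coadjoint L g (coadjoint L h l) A" if "A \<in> L" for A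
    using that assms Ad_in_L coadjoint_in_dual
    by (simp add: coadjoint_apply G_inv_mult matrix_mul_assoc)
qed

lemma coadjoint_one:
  assumes "l \<in> dual L"
  shows "coadjoint L (mat 1) l = l"
proof (rule extensionalityI[of _ L])
  have "matrix_inv (mat 1 :: ('k, 'n) sqmat) = mat 1" by (rule matrix_inv_eqI) auto
  then show "coadjoint L (mat 1) l A = l A" if "A \<in> L" for A
    using that assms by (simp add: coadjoint_apply)
  show "coadjoint L (mat 1) l \<in> extensional L" using assms by (simp add: coadjoint_def)
  show "l \<in> extensional L" using assms by (simp add: dual_def)
qed

lemma coadjoint_inv:
  assumes "g \<in> G" "l \<in> dual L"
  shows "coadjoint L (matrix_inv g) (coadjoint L g l) = l"
  using coadjoint_mult[OF G_inv[OF assms(1)] assms]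
  unfolding G_inverse(1)[OF assms(1)] coadjoint_one[OF assms(2)] by (rule sym)

text \<open>Orbits are defined from some representative, but \<open>orbit_rep\<close> supplies
  another member; any member may serve as base point.\<close>

lemma orbit_eq:
  assumes "\<Omega> \<in> coadjoint_orbits L" "l \<in> \<Omega>"
  shows "l \<in> dual L" and "\<Omega> = {coadjoint L g l | g. g \<in> G}"
proof -
  obtain l0 where l0: "l0 \<in> dual L" "\<Omega> = {coadjoint L g l0 | g. g \<in> G}"
    using assms(1) by (auto simp: coadjoint_orbits_def orbits_def orbit_def exp_group_def)
  obtain h where h: "h \<in> G" "l = coadjoint L h l0" using l0 assms(2) by blast
  show "l \<in> dual L" using h l0(1) coadjoint_in_dual by simp
  have to: "coadjoint L g l0 = coadjoint L (g ** matrix_inv h) l" if "g \<in> G" for g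
    using that h l0(1) coadjoint_in_dual[OF h(1) l0(1)]
    by (simp add: coadjoint_mult G_inv coadjoint_inv)
  have from': "coadjoint L g l = coadjoint L (g ** h) l0" if "g \<in> G" for g
    using that h l0(1) by (simp add: coadjoint_mult)
  show "\<Omega> = {coadjoint L g l | g. g \<in> G}"
  proof
    show "\<Omega> \<subseteq> {coadjoint L g l | g. g \<in> G}"
      using l0(2) to G_mult[OF _ G_inv[OF h(1)]] by blast
    show "{coadjoint L g l | g. g \<in> G} \<subseteq> \<Omega>"
      using l0(2) from' G_mult[OF _ h(1)] by blast
  qed
qed

text \<open>The stabilizer of l is the exponential of the radical of its skew form. If l kills all
  brackets with A, conjugation changes B only within the kernel of l. The converse runs down the
  powers of the bracket with A.\<close>

lemma coadjoint_exp_fixed_iff: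
  assumes l: "l \<in> dual L" and A: "A \<in> L"
  shows "coadjoint L (mat_exp A) l = l \<longleftrightarrow> (\<forall>B\<in>L. l (lie_bracket B A) = 0)"
proof
  let ?J = "{B \<in> L. l B = 0}"
  have J: "mat_space.subspace ?J"
    using L_subspace dual_linear[OF l] dual_zero[OF l]
    by (auto simp: mat_space.subspace_def linear_map_on_def)
  assume *: "\<forall>B\<in>L. l (lie_bracket B A) = 0"
  have "coadjoint L (mat_exp A) l B = l B" if B: "B \<in> L" for B
  proof -
    have "mat_exp (- A) ** B ** mat_exp A - B \<in> ?J"
      using * A B L_bracket by (intro Ad_exp_congruent J) auto
    moreover have "mat_exp (- A) ** B ** mat_exp A \<in> L"
      using Ad_in_L(1)[of "mat_exp A" B] A B by (simp add: matrix_inv_exp)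
    ultimately have "l (mat_exp (- A) ** B ** mat_exp A) - l B = 0"
      using dual_diff[OF l _ B] by simp
    then show ?thesis using A B l by (simp add: coadjoint_apply matrix_inv_exp)
  qed
  then show "coadjoint L (mat_exp A) l = l"
    using coadjoint_in_dual[of "mat_exp A" l] A l
    by (intro extensionalityI[of _ L]) (auto simp: dual_def)
next
  let ?a = "\<lambda>B. lie_bracket B A"
  assume fixed: "coadjoint L (mat_exp A) l = l"
  have aL: "(?a ^^ m) B \<in> L" if "B \<in> L" for m B
    by (induction m) (use that A L_bracket in auto)
  have V: "mat_space.subspace ((?a ^^ m) ` L)" for m
  proof (induction m)
    case (Suc m)
    have "mat_space.subspace (?a ` S)" if S: "mat_space.subspace S" for S
      unfolding mat_space.subspace_def
    proof (intro conjI ballI allI)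
      have "?a 0 = 0" by (simp add: lie_bracket_def)
      then show "0 \<in> ?a ` S" using mat_space.subspace_0[OF S] by (metis imageI)
      show "x + y \<in> ?a ` S" if "x \<in> ?a ` S" "y \<in> ?a ` S" for x y
        using that mat_space.subspace_add[OF S] by (auto simp flip: lie_bracket_bilinear(1))
      show "mat_scale c x \<in> ?a ` S" if "x \<in> ?a ` S" for c x
        using that mat_space.subspace_scale[OF S] by (auto simp flip: lie_bracket_bilinear(3))
    qed
    from this[OF Suc] show ?case by (simp add: image_comp)
  qed (use L_subspace in simp)
  \<comment> \<open>For m \<ge> N the iterated bracket is 0. For smaller m, let C be an (m - 1)-fold
    bracket: conjugation by exp A sends C to C + [C, A] up to (m + 1)-fold brackets, on which l
    already vanishes, so invariance of l gives l([C, A]) = 0.\<close>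
  have "0 < m \<Longrightarrow> \<forall>B\<in>L. l ((?a ^^ m) B) = 0" for m
  proof (induction "CARD('n) - m" arbitrary: m)
    case 0
    then have "(?a ^^ m) B = 0" if "B \<in> L" for B
      using lie_bracket_nilpotent[OF char_ge, of A B m] A that L_strict by simp
    then show ?case using dual_zero[OF l] by simp
  next
    case (Suc d)
    have IH: "\<forall>B\<in>L. l ((?a ^^ Suc m) B) = 0"
      by (rule Suc.hyps(1)) (use Suc.hyps(2) in simp_all)
    obtain i where m: "m = Suc i" using Suc.prems by (cases m) auto
    show ?case
    proof
      fix B assume B: "B \<in> L"
      define C where "C = (?a ^^ i) B"
      have C: "C \<in> L" using aL B by (simp add: C_def)
      have aC: "?a C = (?a ^^ m) B" "?a (?a C) = (?a ^^ Suc m) B" by (simp_all add: C_def m)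
      have D: "mat_exp (- A) ** C ** mat_exp A \<in> L"
        using Ad_in_L(1)[of "mat_exp A" C] A C by (simp add: matrix_inv_exp)
      have "mat_exp (- A) ** C ** mat_exp A - C - ?a C \<in> (?a ^^ Suc m) ` L"
      proof (rule Ad_exp[OF A C V])
        show "?a (?a C) \<in> (?a ^^ Suc m) ` L" using B aC by blast
        show "?a x \<in> (?a ^^ Suc m) ` L" if x: "x \<in> (?a ^^ Suc m) ` L" for x
        proof -
          obtain y where y: "y \<in> L" "x = (?a ^^ Suc m) y" using x by blast
          have "?a x = (?a ^^ Suc m) (?a y)"
            unfolding y by (metis funpow_swap1)
          then show ?thesis using y(1) A L_bracket by blast
        qed
      qed
      then have "l (mat_exp (- A) ** C ** mat_exp A - C - ?a C) = 0" using IH by auto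
      then have "l (mat_exp (- A) ** C ** mat_exp A) - l C - l (?a C) = 0"
        using D C L_bracket[OF C A] mat_space.subspace_diff[OF L_subspace] l by (simp add: dual_diff)
      moreover have "l (mat_exp (- A) ** C ** mat_exp A) = l C"
        using fun_cong[OF fixed, of C] A C l by (simp add: coadjoint_apply matrix_inv_exp)
      ultimately show "l ((?a ^^ m) B) = 0" using aC by simp
    qed
  qed
  from this[of 1] show "\<forall>B\<in>L. l (lie_bracket B A) = 0" by simp
qed

end

subsection \<open>Polarizations\<close>

locale polarized = nilpotent_lie L for L :: "('k::{field,finite}, 'n::{finite,linorder}) sqmat set" +
  fixes l :: "('k, 'n) sqmat \<Rightarrow> 'k" and p :: "('k, 'n) sqmat set"
  assumes l: "l \<in> dual L" and pol: "polarization L l p"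
begin

lemma p_L: "A \<in> p \<Longrightarrow> A \<in> L"
  using pol by (auto simp: polarization_def isotropic_def)

lemma p_isotropic: "A \<in> p \<Longrightarrow> B \<in> p \<Longrightarrow> l (lie_bracket A B) = 0"
  using pol by (auto simp: polarization_def isotropic_def)

sublocale P: nilpotent_lie p
proof
  show "lie_subalgebra p strict_upper"
    using pol L by (auto simp: polarization_def lie_subalgebra_def)
qed (rule char_ge)

lemma l_add: "A \<in> L \<Longrightarrow> B \<in> L \<Longrightarrow> l (A + B) = l A + l B"
  using linear_map_on_add[OF dual_linear[OF l]] .

lemma l_scale: "A \<in> L \<Longrightarrow> l (mat_scale c A) = c * l A"
  using linear_map_on_scale[OF dual_linear[OF l]] .

lemma l_bracket_swap: "A \<in> L \<Longrightarrow> B \<in> L \<Longrightarrow> l (lie_bracket A B) = - l (lie_bracket B A)"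
  using dual_uminus[OF l L_bracket, of B A] by (simp add: lie_bracket_swap[of A B])

text \<open>Adjoining B to p gives a subspace \<open>W\<close> that is still isotropic, as [B, B] =
  0; by maximality it equals p.\<close>

lemma p_perp:
  assumes B: "B \<in> L" and perp: "\<And>A. A \<in> p \<Longrightarrow> l (lie_bracket A B) = 0"
  shows "B \<in> p"
proof -
  define W where "W = {A + mat_scale c B | A c. A \<in> p}"
  have sL: "mat_scale c A \<in> L" if "A \<in> L" for c A
    using mat_space.subspace_scale[OF L_subspace that] .
  have aL: "A + A' \<in> L" if "A \<in> L" "A' \<in> L" for A A'
    using mat_space.subspace_add[OF L_subspace that] .
  have "isotropic L l W"
    unfolding isotropic_def
  proof (intro conjI ballI)
    show "mat_space.subspace W"
      unfolding mat_space.subspace_def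
    proof (intro conjI ballI allI)
      show "0 \<in> W"
        using mat_space.subspace_0[OF P.L_subspace] mat_space.scale_zero_left[of B]
        unfolding W_def by force
      show "x + y \<in> W" if xy: "x \<in> W" "y \<in> W" for x y
      proof -
        obtain A c A' c' where "x = A + mat_scale c B" "y = A' + mat_scale c' B" "A \<in> p" "A' \<in> p"
          using xy unfolding W_def by blast
        moreover from this have "x + y = (A + A') + mat_scale (c + c') B"
          by (simp add: mat_space.scale_left_distrib)
        ultimately show ?thesis using mat_space.subspace_add[OF P.L_subspace] unfolding W_def by blast
      qed
      show "mat_scale a x \<in> W" if x: "x \<in> W" for a x
      proof -
        obtain A c where "x = A + mat_scale c B" "A \<in> p"
          using x unfolding W_def by blast
        moreover from this have "mat_scale a x = mat_scale a A + mat_scale (a * c) B"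
          by (simp add: mat_space.scale_right_distrib)
        ultimately show ?thesis using mat_space.subspace_scale[OF P.L_subspace] unfolding W_def by blast
      qed
    qed
    show "W \<subseteq> L" using p_L B sL aL by (auto simp: W_def)
    show "l (lie_bracket x y) = 0" if xy: "x \<in> W" "y \<in> W" for x y
    proof -
      obtain A c A' c' where *: "x = A + mat_scale c B" "y = A' + mat_scale c' B" "A \<in> p" "A' \<in> p"
        using xy unfolding W_def by blast
      have "lie_bracket x y = lie_bracket A A' + mat_scale c' (lie_bracket A B)
          + mat_scale c (lie_bracket B A')"
        unfolding * by (simp add: lie_bracket_bilinear lie_bracket_self algebra_simps)
      then have "l (lie_bracket x y) = l (lie_bracket A A') + c' * l (lie_bracket A B)
          + c * l (lie_bracket B A')"
        using * p_L B L_bracket by (simp add: l_add l_scale sL aL)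
      then show ?thesis
        using * perp p_isotropic l_bracket_swap[OF B p_L[OF *(4)]] by simp
    qed
  qed
  moreover have "p \<subseteq> W"
  proof
    fix A assume "A \<in> p"
    moreover have "A = A + mat_scale 0 B" by simp
    ultimately show "A \<in> W" unfolding W_def by blast
  qed
  ultimately have "W = p" using pol by (simp add: polarization_def)
  moreover have "B \<in> W"
    using mat_space.subspace_0[OF P.L_subspace] unfolding W_def
    by (intro CollectI exI[of _ 0] exI[of _ 1]) auto
  ultimately show ?thesis by simp
qed

text \<open>By \<open>p_perp\<close> the forms l([A, _]) with A in p have common kernel V \<inter> p
  on V, so f is a linear combination of them, and the coefficients combine to a single element of p.
  The finite set p itself is the index set.\<close>

lemma form_represented:
  assumes V: "mat_space.subspace V" "V \<subseteq> L" and f: "linear_map_on mat_scale (*) V f"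
    and zero: "\<And>v. v \<in> V \<Longrightarrow> v \<in> p \<Longrightarrow> f v = 0"
  shows "\<exists>A\<in>p. \<forall>v\<in>V. f v = l (lie_bracket A v)"
proof -
  have "\<exists>c. \<forall>v\<in>V. f v = (\<Sum>A\<in>p. c A * l (lie_bracket A v))"
  proof (rule in_span_of_forms[OF _ V(1) f])
    show "linear_map_on mat_scale (*) V (\<lambda>v. l (lie_bracket A v))" if "A \<in> p" for A
      using that p_L V(2) L_bracket
      by (auto simp: linear_map_on_def lie_bracket_bilinear l_add l_scale subset_iff)
    show "f v = 0" if v: "v \<in> V" "\<And>A. A \<in> p \<Longrightarrow> l (lie_bracket A v) = 0" for v
      using p_perp[of v] v V(2) zero by blast
  qed simp
  then obtain c where c: "\<And>v. v \<in> V \<Longrightarrow> f v = (\<Sum>A\<in>p. c A * l (lie_bracket A v))" by blast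
  have "(\<Sum>A\<in>I. mat_scale (c A) A) \<in> p \<and>
      (\<forall>v\<in>L. l (lie_bracket (\<Sum>A\<in>I. mat_scale (c A) A) v) = (\<Sum>A\<in>I. c A * l (lie_bracket A v)))"
    if "I \<subseteq> p" for I
    using finite[of I] that
  proof (induction I rule: finite_induct)
    case empty
    then show ?case
      using mat_space.subspace_0[OF P.L_subspace] dual_zero[OF l] by (simp add: lie_bracket_def)
  next
    case (insert A I)
    then have A: "A \<in> p" "A \<in> L" and I: "(\<Sum>A\<in>I. mat_scale (c A) A) \<in> p" "(\<Sum>A\<in>I. mat_scale (c A) A) \<in> L"
      using p_L by auto
    have "l (lie_bracket (mat_scale (c A) A + (\<Sum>A\<in>I. mat_scale (c A) A)) v)
        = c A * l (lie_bracket A v) + (\<Sum>A\<in>I. c A * l (lie_bracket A v))" if v: "v \<in> L" for v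
      using insert v A I L_bracket mat_space.subspace_scale[OF L_subspace]
      by (simp add: lie_bracket_bilinear l_add l_scale)
    then show ?case
      using insert A I mat_space.subspace_add[OF P.L_subspace] mat_space.subspace_scale[OF P.L_subspace]
      by simp
  qed
  from this[of p] show ?thesis using c V(2) by (intro bexI[of _ "\<Sum>A\<in>p. mat_scale (c A) A"]) auto
qed

text \<open>The stabilizer comes from the radical, which lies in p by \<open>p_perp\<close>.\<close>

lemma stabilizer_in_P:
  assumes g: "g \<in> G" and fixed: "coadjoint L g l = l"
  shows "g \<in> P.G"
proof -
  obtain A where A: "A \<in> L" "g = mat_exp A" using g by blast
  have "\<forall>B\<in>L. l (lie_bracket B A) = 0"
    using coadjoint_exp_fixed_iff[OF l A(1)] fixed A(2) by simp
  then show ?thesis using p_perp[OF A(1)] p_L A by blast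
qed

definition forms_above :: "(('k, 'n) sqmat \<Rightarrow> 'k) set"
  where "forms_above = {\<nu> \<in> dual L. \<forall>A\<in>p. \<nu> A = l A}"

text \<open>The kernel of l on p contains [p, p], so conjugation by P changes elements of p only
  within that kernel.\<close>

lemma coadjoint_in_forms_above:
  assumes "h \<in> P.G"
  shows "coadjoint L h l \<in> forms_above"
proof -
  obtain A where A: "A \<in> p" "h = mat_exp A" using assms by blast
  let ?J = "{B \<in> p. l B = 0}"
  have J: "mat_space.subspace ?J"
    using P.L_subspace dual_zero[OF l] p_L
    by (auto simp: mat_space.subspace_def l_add l_scale)
  have "coadjoint L h l B = l B" if B: "B \<in> p" for B
  proof -
    have "mat_exp (- A) ** B ** mat_exp A - B \<in> ?J"
      using A B P.L_bracket p_isotropic by (intro P.Ad_exp_congruent J) auto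
    then have "l (mat_exp (- A) ** B ** mat_exp A - B) = 0" by simp
    moreover have "mat_exp (- A) ** B ** mat_exp A \<in> p"
      using P.Ad_in_L(1)[of "mat_exp A" B] A B by (simp add: P.matrix_inv_exp)
    ultimately show ?thesis
      using A B l p_L dual_diff[OF l, of "mat_exp (- A) ** B ** mat_exp A" B]
      by (simp add: coadjoint_apply matrix_inv_exp)
  qed
  then show ?thesis
    using coadjoint_in_dual[OF _ l, of h] A p_L by (auto simp: forms_above_def)
qed

text \<open>Both \<open>P\<close> and \<open>p\<close> map to the set of forms above \<open>l\<close>, by the orbit map and by
  \<open>A \<mapsto> l + l [A, _]\<close>. The second map is onto, and the fibres of both have the size of the radical.\<close>

theorem coadjoint_transitive:
  assumes \<nu>: "\<nu> \<in> forms_above"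
  obtains h where "h \<in> P.G" "coadjoint L h l = \<nu>"
proof -
  define rad where "rad = {A \<in> p. \<forall>B\<in>L. l (lie_bracket A B) = 0}"
  define tr where "tr A = (\<lambda>B\<in>L. l B + l (lie_bracket A B))" for A
  define co where "co A = coadjoint L (mat_exp A) l" for A
  have rad_iff: "A \<in> rad \<longleftrightarrow> coadjoint L (mat_exp A) l = l" if A: "A \<in> p" for A
  proof -
    have "l (lie_bracket A B) = 0 \<longleftrightarrow> l (lie_bracket B A) = 0" if "B \<in> L" for B
      using l_bracket_swap[OF p_L[OF A] that] by simp
    then show ?thesis using A by (simp add: rad_def coadjoint_exp_fixed_iff[OF l p_L[OF A]])
  qed
  have rad_p: "R \<in> p" if "R \<in> rad" for R using that by (simp add: rad_def)
  have "tr ` p = forms_above"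
  proof (intro equalityI subsetI)
    fix \<mu> assume "\<mu> \<in> tr ` p"
    then obtain A where A: "A \<in> p" "\<mu> = tr A" by blast
    then have "tr A \<in> dual L"
      using p_L[OF A(1)] L_bracket mat_space.subspace_add[OF L_subspace] mat_space.subspace_scale[OF L_subspace]
      by (auto simp: tr_def dual_def linear_map_on_def l_add l_scale lie_bracket_bilinear algebra_simps)
    then show "\<mu> \<in> forms_above"
      using A p_L p_isotropic by (auto simp: forms_above_def tr_def)
  next
    fix \<mu> assume "\<mu> \<in> forms_above"
    then have \<mu>: "\<mu> \<in> dual L" "\<And>A. A \<in> p \<Longrightarrow> \<mu> A = l A" by (auto simp: forms_above_def)
    \<comment> \<open>Surjectivity of \<open>tr\<close>: the difference \<mu> - l vanishes on p,
      hence has the form l([A, _]).\<close>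
    have "\<exists>A\<in>p. \<forall>v\<in>L. \<mu> v - l v = l (lie_bracket A v)"
    proof (rule form_represented[OF L_subspace])
      show "linear_map_on mat_scale (*) L (\<lambda>v. \<mu> v - l v)"
        using dual_linear[OF \<mu>(1)] dual_linear[OF l] by (auto simp: linear_map_on_def algebra_simps)
    qed (use \<mu> in auto)
    then obtain A where A: "A \<in> p" "\<And>v. v \<in> L \<Longrightarrow> \<mu> v - l v = l (lie_bracket A v)" by blast
    have "\<mu> = tr A"
    proof (rule extensionalityI[of _ L])
      show "\<mu> v = tr A v" if "v \<in> L" for v using A(2)[OF that] that by (simp add: tr_def diff_eq_eq)
    qed (use \<mu> in \<open>auto simp: dual_def tr_def\<close>)
    then show "\<mu> \<in> tr ` p" using A(1) by blast
  qed
  moreover have "card p = card (tr ` p) * card rad"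
  proof (rule card_uniform_fibres)
    fix A assume A: "A \<in> p"
    have "{A' \<in> p. tr A' = tr A} = (\<lambda>R. A + R) ` rad"
    proof (intro equalityI subsetI)
      fix A' assume "A' \<in> {A' \<in> p. tr A' = tr A}"
      then have A': "A' \<in> p" "tr A' = tr A" by auto
      have "l (lie_bracket (A' - A) B) = 0" if B: "B \<in> L" for B
      proof -
        have "l (lie_bracket A' B) = l (lie_bracket A B)"
          using fun_cong[OF A'(2), of B] B by (simp add: tr_def)
        moreover have "lie_bracket A' B = lie_bracket (A' - A) B + lie_bracket A B"
          by (simp flip: lie_bracket_bilinear(1))
        moreover have "A' - A \<in> L" using mat_space.subspace_diff[OF L_subspace] A A' p_L by simp
        ultimately show ?thesis using l_add A p_L L_bracket B by simp
      qed
      then have "A' - A \<in> rad"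
        using mat_space.subspace_diff[OF P.L_subspace] A A' by (simp add: rad_def)
      then show "A' \<in> (\<lambda>R. A + R) ` rad" by (intro image_eqI[of _ _ "A' - A"]) auto
    next
      fix A' assume "A' \<in> (\<lambda>R. A + R) ` rad"
      then obtain R where R: "R \<in> rad" "A' = A + R" by blast
      have "l (lie_bracket A' B) = l (lie_bracket A B)" if B: "B \<in> L" for B
        using l_add[OF L_bracket[OF p_L[OF A] B] L_bracket[OF p_L[OF rad_p[OF R(1)]] B]] R B
        by (simp add: rad_def lie_bracket_bilinear)
      then have "tr A' = tr A" unfolding tr_def by (intro restrict_ext) simp
      then show "A' \<in> {A' \<in> p. tr A' = tr A}"
        using R A rad_p mat_space.subspace_add[OF P.L_subspace] by simp
    qed
    then show "card {A' \<in> p. tr A' = tr A} = card rad" by (simp add: card_image)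
  qed simp
  moreover have "card p = card (co ` p) * card rad"
  proof (rule card_uniform_fibres)
    fix A assume A: "A \<in> p"
    let ?F = "{A' \<in> p. co A' = co A}"
    have gA: "mat_exp A \<in> P.G" "mat_exp A \<in> G" using A p_L by auto
    \<comment> \<open>The fibre is described in the group, where it is a left translate of the
      exponential of the radical; injectivity of \<open>mat_exp\<close> on p carries the count
      back.\<close>
    have "mat_exp ` ?F = (\<lambda>R. mat_exp A ** mat_exp R) ` rad"
    proof (intro equalityI subsetI)
      fix g assume "g \<in> mat_exp ` ?F"
      then obtain A' where A': "A' \<in> p" "co A' = co A" "g = mat_exp A'" by blast
      have "matrix_inv (mat_exp A) ** mat_exp A' \<in> P.G"
        using P.G_mult P.G_inv gA(1) A'(1) by blast
      then obtain R where R: "R \<in> p" "mat_exp R = matrix_inv (mat_exp A) ** mat_exp A'" by auto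
      have "coadjoint L (mat_exp R) l = coadjoint L (matrix_inv (mat_exp A)) (co A')"
        unfolding R(2) co_def using G_inv[OF gA(2)] A'(1) p_L l by (intro coadjoint_mult) auto
      also have "\<dots> = l" unfolding A'(2) by (simp only: co_def coadjoint_inv[OF gA(2) l])
      finally have "R \<in> rad" using rad_iff R(1) by simp
      moreover have "g = mat_exp A ** mat_exp R"
        using G_inverse(2)[OF gA(2)] A'(3) R(2) by (simp add: matrix_mul_assoc)
      ultimately show "g \<in> (\<lambda>R. mat_exp A ** mat_exp R) ` rad" by blast
    next
      fix g assume "g \<in> (\<lambda>R. mat_exp A ** mat_exp R) ` rad"
      then obtain R where R: "R \<in> rad" "g = mat_exp A ** mat_exp R" by blast
      then have "g \<in> P.G" using P.G_mult[OF gA(1)] rad_p by blast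
      then obtain A' where A': "A' \<in> p" "g = mat_exp A'" by blast
      have "co A' = coadjoint L (mat_exp A) (coadjoint L (mat_exp R) l)"
        unfolding co_def A'(2)[symmetric] R(2) using gA(2) R(1) rad_p p_L l by (intro coadjoint_mult) auto
      also have "\<dots> = co A" using iffD1[OF rad_iff[OF rad_p[OF R(1)]] R(1)] by (simp add: co_def)
      finally show "g \<in> mat_exp ` ?F" using A' by blast
    qed
    then have "card (mat_exp ` ?F) = card ((\<lambda>R. mat_exp A ** mat_exp R) ` rad)" by simp
    moreover have "inj_on mat_exp ?F" by (rule inj_on_subset[OF P.exp_inj]) auto
    moreover have "inj_on (\<lambda>R. mat_exp A ** mat_exp R) rad"
    proof (rule inj_onI)
      fix R R' assume R: "R \<in> rad" "R' \<in> rad" "mat_exp A ** mat_exp R = mat_exp A ** mat_exp R'"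
      then have "matrix_inv (mat_exp A) ** mat_exp A ** mat_exp R = matrix_inv (mat_exp A) ** mat_exp A ** mat_exp R'"
        by (simp flip: matrix_mul_assoc)
      then show "R = R'"
        using R rad_p inj_onD[OF P.exp_inj] by (simp add: G_inverse(1)[OF gA(2)])
    qed
    ultimately show "card ?F = card rad" by (simp add: card_image)
  qed simp
  moreover have "card rad \<noteq> 0"
  proof -
    have "0 \<in> rad"
      using mat_space.subspace_0[OF P.L_subspace] dual_zero[OF l] by (simp add: rad_def lie_bracket_def)
    then show ?thesis by (metis card_0_eq empty_iff finite)
  qed
  \<comment> \<open>Equal fibre sizes give the orbit of P as many elements as
    \<open>forms_above\<close>, and it lies in that finite set.\<close>
  ultimately have "card (co ` p) = card forms_above" by simp
  moreover have "co ` p \<subseteq> forms_above"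
    using coadjoint_in_forms_above by (auto simp: co_def)
  ultimately have "co ` p = forms_above" by (intro card_subset_eq) auto
  then obtain A where "A \<in> p" "\<nu> = co A" using \<nu> by blast
  then show ?thesis using that by (auto simp: co_def)
qed

end

section \<open>Characters of polarizations and irreducibility of the induced representations\<close>

lemma additive_character_kernel:
  assumes "nontrivial_additive_character \<psi>" "\<And>c. \<psi> (c * a) = 1"
  shows "a = (0 :: 'k::field)"
proof (rule ccontr)
  assume "a \<noteq> 0"
  obtain x where "\<psi> x \<noteq> 1" using assms(1) by (auto simp: nontrivial_additive_character_def)
  then show False using assms(2)[of "x / a"] \<open>a \<noteq> 0\<close> by simp
qed

locale polarized_character = polarized L l p
  for L :: "('k::{field,finite}, 'n::{finite,linorder}) sqmat set" and l p +
  fixes \<psi> :: "'k \<Rightarrow> complex"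
  assumes \<psi>: "nontrivial_additive_character \<psi>"
begin

lemma \<psi>_add: "\<psi> (a + b) = \<psi> a * \<psi> b"
  using \<psi> by (simp add: nontrivial_additive_character_def)

lemma \<psi>_nonzero: "\<psi> a \<noteq> 0"
  using \<psi> by (simp add: nontrivial_additive_character_def)

abbreviation "\<xi> \<equiv> exp_character \<psi> p l"

lemma \<xi>_exp: "A \<in> p \<Longrightarrow> \<xi> (mat_exp A) = \<psi> (l A)"
  by (simp add: exp_character_def the_inv_into_f_f[OF P.exp_inj])

text \<open>This is \<open>mat_exp_mult\<close> with D the kernel of l on p. By isotropy D contains
  [p, p], and the correction C is invisible to \<open>\<xi>\<close>.\<close>

lemma \<xi>_mult:
  assumes "g \<in> P.G" "h \<in> P.G"
  shows "\<xi> (g ** h) = \<xi> g * \<xi> h"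
proof -
  obtain A B where AB: "A \<in> p" "B \<in> p" "g = mat_exp A" "h = mat_exp B" using assms by blast
  let ?J = "{B \<in> p. l B = 0}"
  have J: "mat_space.subspace ?J"
    using P.L_subspace dual_zero[OF l] p_L
    by (auto simp: mat_space.subspace_def l_add l_scale)
  obtain C where C: "C \<in> ?J" "mat_exp A ** mat_exp B = mat_exp (A + B + C)"
    using mat_exp_mult[OF char_ge P.L J _ _ AB(1,2)] P.L_bracket p_isotropic by blast
  have ABp: "A + B \<in> p" "A + B + C \<in> p"
    using AB C mat_space.subspace_add[OF P.L_subspace] by auto
  have "l (A + B + C) = l A + l B"
    using AB C ABp p_L l_add by simp
  then show ?thesis using AB C ABp by (simp add: \<xi>_exp \<psi>_add)
qed

lemma subgroup_P: "subgroup P.G (exp_group L)"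
proof (rule group.subgroupI[OF group_G])
  show "P.G \<subseteq> carrier (exp_group L)" using p_L by (auto simp: exp_group_def)
  show "P.G \<noteq> {}" using P.G_one by blast
  show "inv\<^bsub>exp_group L\<^esub> g \<in> P.G" if "g \<in> P.G" for g
    using that P.G_inv p_L by (subst inv_G) auto
  show "g \<otimes>\<^bsub>exp_group L\<^esub> h \<in> P.G" if "g \<in> P.G" "h \<in> P.G" for g h
    using P.G_mult[OF that] by (simp add: exp_group_def)
qed

lemma linear_character: "linear_character (exp_group L) P.G \<xi>"
  using group_G subgroup_P \<xi>_mult \<xi>_exp \<psi>_nonzero
  by (auto simp: linear_character_def linear_character_axioms_def exp_group_def)

text \<open>On V, the conjugate of q by x, let f be the transported \<open>\<mu>\<close> minus l.
  The characters agree at all multiples of a vector of V \<inter> p, so f vanishes there and equals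
  l([A, _]) on V for some A in p. The form l + l([A, _]) then has the wanted values on V and agrees
  with l on p, so it is a translate of l by P.\<close>

lemma agree_after_translation:
  assumes x: "x \<in> G" and q: "mat_space.subspace q" "q \<subseteq> L" and \<mu>: "linear_map_on mat_scale (*) q \<mu>"
    and compat: "\<And>B. B \<in> q \<Longrightarrow> x ** mat_exp B ** matrix_inv x \<in> P.G \<Longrightarrow>
      \<xi> (x ** mat_exp B ** matrix_inv x) = \<psi> (\<mu> B)"
  shows "\<exists>h\<in>P.G. \<forall>B\<in>q. coadjoint L (matrix_inv x ** h) l B = \<mu> B"
proof -
  let ?x' = "matrix_inv x"
  define V where "V = (\<lambda>B. x ** B ** ?x') ` q"
  define f where "f v = \<mu> (?x' ** v ** x) - l v" for v
  have conj_back: "?x' ** (x ** B ** ?x') ** x = B" for B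
  proof -
    have "?x' ** (x ** B ** ?x') ** x = (?x' ** x) ** B ** (?x' ** x)" by (simp only: matrix_mul_assoc)
    then show ?thesis using G_inverse(1)[OF x] by simp
  qed
  have VL: "V \<subseteq> L" using q(2) Ad_in_L(2)[OF x] by (auto simp: V_def)
  have "\<exists>A\<in>p. \<forall>v\<in>V. f v = l (lie_bracket A v)"
  proof (rule form_represented[OF _ VL])
    show "mat_space.subspace V"
      unfolding mat_space.subspace_def V_def
    proof (intro conjI ballI allI)
      show "0 \<in> (\<lambda>B. x ** B ** ?x') ` q"
        using mat_space.subspace_0[OF q(1)] by (intro image_eqI[of _ _ 0]) auto
      show "v + w \<in> (\<lambda>B. x ** B ** ?x') ` q"
        if "v \<in> (\<lambda>B. x ** B ** ?x') ` q" "w \<in> (\<lambda>B. x ** B ** ?x') ` q" for v w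
        using that mat_space.subspace_add[OF q(1)] by (auto simp flip: conj_linear(1))
      show "mat_scale c v \<in> (\<lambda>B. x ** B ** ?x') ` q" if "v \<in> (\<lambda>B. x ** B ** ?x') ` q" for c v
        using that mat_space.subspace_scale[OF q(1)] by (auto simp flip: conj_linear(2))
    qed
    show "linear_map_on mat_scale (*) V f"
      unfolding linear_map_on_def
    proof (intro conjI ballI allI)
      show "f (v + w) = f v + f w" if vw: "v \<in> V" "w \<in> V" for v w
      proof -
        obtain B C where BC: "B \<in> q" "C \<in> q" "v = x ** B ** ?x'" "w = x ** C ** ?x'"
          using vw by (auto simp: V_def)
        have "l (v + w) = l v + l w" using vw VL l_add by blast
        moreover have "\<mu> (?x' ** (v + w) ** x) = \<mu> B + \<mu> C"
          using BC linear_map_on_add[OF \<mu>] by (simp add: conj_linear conj_back)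
        ultimately show ?thesis using BC by (simp add: f_def conj_back)
      qed
      show "f (mat_scale c v) = c * f v" if v: "v \<in> V" for c v
      proof -
        obtain B where B: "B \<in> q" "v = x ** B ** ?x'" using v by (auto simp: V_def)
        have "l (mat_scale c v) = c * l v" using v VL l_scale by blast
        moreover have "\<mu> (?x' ** mat_scale c v ** x) = c * \<mu> B"
          using B linear_map_on_scale[OF \<mu>] by (simp add: conj_linear conj_back)
        ultimately show ?thesis using B by (simp add: f_def conj_back right_diff_distrib)
      qed
    qed
    show "f v = 0" if v: "v \<in> V" "v \<in> p" for v
    proof -
      obtain B where B: "B \<in> q" "v = x ** B ** ?x'" using v by (auto simp: V_def)
      \<comment> \<open>Both q and p are closed under scalars, so compatibility applies to every
        multiple of v; a single value of \<open>\<psi>\<close> would not determine f v.\<close>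
      have "\<psi> (c * f v) = 1" for c
      proof -
        have cv: "mat_scale c v = x ** mat_scale c B ** ?x'" "mat_scale c v \<in> p" "mat_scale c B \<in> q"
          using v B mat_space.subspace_scale[OF P.L_subspace] mat_space.subspace_scale[OF q(1)]
          by (simp_all add: conj_linear)
        have e: "x ** mat_exp (mat_scale c B) ** ?x' = mat_exp (mat_scale c v)"
          unfolding cv(1) by (rule exp_Ad[OF x, symmetric])
        have "\<xi> (mat_exp (mat_scale c v)) = \<psi> (\<mu> (mat_scale c B))"
          using compat[OF cv(3)] cv(2) unfolding e by blast
        then have "\<psi> (c * l v) = \<psi> (c * \<mu> B)"
          unfolding \<xi>_exp[OF cv(2)] l_scale[OF p_L[OF v(2)]] linear_map_on_scale[OF \<mu> B(1)] .
        moreover have "\<psi> (c * \<mu> B) = \<psi> (c * f v) * \<psi> (c * l v)"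
          using B by (simp add: f_def conj_back right_diff_distrib flip: \<psi>_add)
        ultimately show ?thesis using \<psi>_nonzero[of "c * l v"] by simp
      qed
      then show ?thesis using additive_character_kernel[OF \<psi>] by blast
    qed
  qed
  then obtain A where A: "A \<in> p" "\<And>v. v \<in> V \<Longrightarrow> f v = l (lie_bracket A v)" by blast
  define \<nu> where "\<nu> = (\<lambda>B\<in>L. l B + l (lie_bracket A B))"
  have "\<nu> \<in> dual L"
    using p_L[OF A(1)] L_bracket mat_space.subspace_add[OF L_subspace] mat_space.subspace_scale[OF L_subspace]
    by (auto simp: \<nu>_def dual_def linear_map_on_def l_add l_scale lie_bracket_bilinear algebra_simps)
  then have "\<nu> \<in> forms_above"
    using A p_L p_isotropic by (auto simp: forms_above_def \<nu>_def)
  then obtain h where h: "h \<in> P.G" "coadjoint L h l = \<nu>" by (rule coadjoint_transitive)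
  have hG: "h \<in> G" using h p_L by auto
  have "coadjoint L (?x' ** h) l B = \<mu> B" if B: "B \<in> q" for B
  proof -
    have "coadjoint L (?x' ** h) l = coadjoint L ?x' \<nu>"
      using coadjoint_mult[OF G_inv[OF x] hG l] h by simp
    then have "coadjoint L (?x' ** h) l B = \<nu> (x ** B ** ?x')"
      using coadjoint_apply[OF \<open>\<nu> \<in> dual L\<close>, of B ?x'] B q(2) G_inv_inv[OF x] by auto
    also have "\<dots> = l (x ** B ** ?x') + f (x ** B ** ?x')"
      using A(2)[of "x ** B ** ?x'"] B VL by (auto simp: \<nu>_def V_def)
    also have "\<dots> = \<mu> B" by (simp add: f_def conj_back)
    finally show ?thesis .
  qed
  then show ?thesis using h(1) by blast
qed

text \<open>If f is covariant on both sides and nonzero at x, then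
  \<open>agree_after_translation\<close> with q = p gives h in P such that x^-1 h moves l to a form
  above l, which equals the translate of l by some k in P. Then k^-1 x^-1 h fixes l and lies in P,
  hence so does x.\<close>

lemma induced_irreducible:
  assumes "complex_rep (exp_group L) (induced_rep (exp_group L) P.G \<xi>)"
  shows "irreducible_rep (exp_group L) (induced_rep (exp_group L) P.G \<xi>)"
proof -
  interpret C: linear_character "exp_group L" P.G \<xi> by (rule linear_character)
  show ?thesis
  proof (rule C.irreducible[OF assms])
    fix f x assume f: "f \<in> C.V" and fq: "\<And>y q. y \<in> carrier (exp_group L) \<Longrightarrow> q \<in> P.G \<Longrightarrow>
        f (y \<otimes>\<^bsub>exp_group L\<^esub> q) = f y * \<xi> q"
      and x: "x \<in> carrier (exp_group L)" "f x \<noteq> 0"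
    have xG: "x \<in> G" using x by (simp add: exp_group_def)
    have "\<exists>h\<in>P.G. \<forall>B\<in>p. coadjoint L (matrix_inv x ** h) l B = l B"
    proof (rule agree_after_translation[OF xG P.L_subspace])
      show "p \<subseteq> L" using p_L by blast
      then show "linear_map_on mat_scale (*) p l"
        by (rule linear_map_on_subset[OF dual_linear[OF l]])
      show "\<xi> (x ** mat_exp B ** matrix_inv x) = \<psi> (l B)"
        if B: "B \<in> p" "x ** mat_exp B ** matrix_inv x \<in> P.G" for B
      proof -
        have "f (x ** mat_exp B ** matrix_inv x ** x) = \<xi> (x ** mat_exp B ** matrix_inv x) * f x"
          using C.V_mult[OF f B(2) x(1)] by (simp add: exp_group_def)
        moreover have "x ** mat_exp B ** matrix_inv x ** x = x ** mat_exp B"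
          using G_inverse(1)[OF xG] by (simp flip: matrix_mul_assoc)
        moreover have "f (x ** mat_exp B) = f x * \<xi> (mat_exp B)"
          using fq[OF x(1), of "mat_exp B"] B(1) by (simp add: exp_group_def)
        ultimately show ?thesis using x(2) B(1) by (simp add: \<xi>_exp)
      qed
    qed
    then obtain h where h: "h \<in> P.G" "\<forall>B\<in>p. coadjoint L (matrix_inv x ** h) l B = l B" by blast
    have hG: "h \<in> G" using h(1) p_L by auto
    have xh: "matrix_inv x ** h \<in> G" using G_mult[OF G_inv[OF xG] hG] .
    then have "coadjoint L (matrix_inv x ** h) l \<in> forms_above"
      using h(2) coadjoint_in_dual[OF _ l] by (simp add: forms_above_def)
    then obtain k where k: "k \<in> P.G" "coadjoint L k l = coadjoint L (matrix_inv x ** h) l"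
      by (rule coadjoint_transitive)
    have kG: "k \<in> G" using k(1) p_L by auto
    let ?g = "matrix_inv k ** (matrix_inv x ** h)"
    have "coadjoint L ?g l = l"
      using coadjoint_mult[OF G_inv[OF kG] xh l] k(2) coadjoint_inv[OF kG l] by simp
    then have g: "?g \<in> P.G"
      using stabilizer_in_P[OF G_mult[OF G_inv[OF kG] xh]] by blast
    have "x = h ** matrix_inv (k ** ?g)"
    proof -
      have "k ** ?g = (k ** matrix_inv k) ** (matrix_inv x ** h)" by (simp only: matrix_mul_assoc)
      then have "k ** ?g = matrix_inv x ** h" using G_inverse(2)[OF kG] by simp
      then have "h ** matrix_inv (k ** ?g) = (h ** matrix_inv h) ** x"
        using G_inv_mult[OF G_inv[OF xG] hG] G_inv_inv[OF xG] by (simp add: matrix_mul_assoc)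
      then show ?thesis using G_inverse(2)[OF hG] by simp
    qed
    then show "x \<in> P.G" using P.G_mult P.G_inv h(1) k(1) g by metis
  qed
qed

end

text \<open>T and t come with forms and polarizations of their own, l with P and m with Q. These
  stay fixed throughout, and \<open>orbit_eq\<close> allows both forms to serve as base points of
  their orbits.\<close>

theorem corollary11:
  fixes p :: nat
    and \<gg> \<hh> :: "('k::{field,finite}, 'n::{finite,linorder}) sqmat set"
    and \<psi> :: "'k \<Rightarrow> complex"
    and \<Omega> \<omega> :: "(('k, 'n) sqmat \<Rightarrow> 'k) set"
    and T :: "(('k, 'n) sqmat, 'a) rep"
    and t :: "(('k, 'n) sqmat, 'b) rep"
  assumes "p = CHAR('k)" and "p \<ge> CARD('n)"
    and "lie_subalgebra \<gg> strict_upper" and "lie_subalgebra \<hh> \<gg>"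
    and "nontrivial_additive_character \<psi>"
    and "\<Omega> \<in> coadjoint_orbits \<gg>" and "\<omega> \<in> coadjoint_orbits \<hh>"
    and "orbit_rep \<psi> \<gg> \<Omega> T" and "orbit_rep \<psi> \<hh> \<omega> t"
  shows "occurs_in (exp_group \<hh>) t (restrict_rep (exp_group \<hh>) T) \<longleftrightarrow>
    \<omega> \<subseteq> dual_projection \<hh> ` \<Omega>"
proof -
  have char_ge: "CARD('n) \<le> CHAR('k)" using assms(1,2) by simp
  have \<hh>_sub: "\<hh> \<subseteq> \<gg>" and \<hh>: "lie_subalgebra \<hh> strict_upper"
    using assms(3,4) by (auto simp: lie_subalgebra_def)
  obtain l P where l: "l \<in> \<Omega>" and P: "polarization \<gg> l P"
    and T: "equivalent_rep (exp_group \<gg>) T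
      (induced_rep (exp_group \<gg>) (mat_exp ` P) (exp_character \<psi> P l))"
    using assms(8) by (auto simp: orbit_rep_def)
  obtain m Q where m: "m \<in> \<omega>" and Q: "polarization \<hh> m Q"
    and t: "equivalent_rep (exp_group \<hh>) t
      (induced_rep (exp_group \<hh>) (mat_exp ` Q) (exp_character \<psi> Q m))"
    using assms(9) by (auto simp: orbit_rep_def)
  interpret g: nilpotent_lie \<gg> by unfold_locales (use char_ge assms(3) in auto)
  interpret h: nilpotent_lie \<hh> by unfold_locales (use char_ge \<hh> in auto)
  interpret g: polarized_character \<gg> l P \<psi>
    by unfold_locales (use g.orbit_eq(1)[OF assms(6) l] P assms(5) in auto)
  interpret h: polarized_character \<hh> m Q \<psi>
    by unfold_locales (use h.orbit_eq(1)[OF assms(7) m] Q assms(5) in auto)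
  interpret subgroup_characters "exp_group \<gg>" g.P.G g.\<xi> "exp_group \<hh>" h.P.G h.\<xi>
    using g.linear_character h.linear_character \<hh>_sub
    by (auto simp: subgroup_characters_def subgroup_characters_axioms_def exp_group_def)
  have hg: "x \<in> g.G" if "x \<in> h.G" for x using that \<hh>_sub by auto
  have Qh: "Q \<subseteq> \<hh>" using h.p_L by blast
  have proj_in: "restrict \<nu> \<hh> \<in> dual \<hh>" if "\<nu> \<in> dual \<gg>" for \<nu>
    using that h.L_subspace \<hh>_sub mat_space.subspace_add[OF h.L_subspace] mat_space.subspace_scale[OF h.L_subspace]
    by (auto simp: dual_def linear_map_on_def subset_iff)
  \<comment> \<open>Equivariance of the restriction makes the image of \<open>\<Omega>\<close>
    stable under H, so it contains \<open>\<omega>\<close> as soon as it meets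
    \<open>\<omega>\<close>.\<close>
  have proj_coadjoint: "coadjoint \<hh> x (restrict \<nu> \<hh>) = restrict (coadjoint \<gg> x \<nu>) \<hh>"
    if x: "x \<in> h.G" and \<nu>: "\<nu> \<in> dual \<gg>" for x \<nu>
  proof (rule extensionalityI[of _ \<hh>])
    show "coadjoint \<hh> x (restrict \<nu> \<hh>) \<in> extensional \<hh>"
      using h.coadjoint_in_dual[OF x proj_in[OF \<nu>]] by (simp add: dual_def)
    show "coadjoint \<hh> x (restrict \<nu> \<hh>) A = restrict (coadjoint \<gg> x \<nu>) \<hh> A" if A: "A \<in> \<hh>" for A
      using h.coadjoint_apply[OF proj_in[OF \<nu>] A] g.coadjoint_apply[OF \<nu>, of A x] h.Ad_in_L(1)[OF x A]
        A \<hh>_sub by auto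
  qed simp
  have "occurs_in (exp_group \<hh>) t (restrict_rep (exp_group \<hh>) T) \<longleftrightarrow>
      (\<exists>x\<in>g.G. \<forall>q\<in>h.P.G. x ** q ** matrix_inv x \<in> g.P.G \<longrightarrow> g.\<xi> (x ** q ** matrix_inv x) = h.\<xi> q)"
  proof -
    have "complex_rep (exp_group \<hh>) (induced_rep (exp_group \<hh>) h.P.G h.\<xi>)"
      using t by (simp add: equivalent_rep_def)
    then have "irreducible_rep (exp_group \<hh>) (induced_rep (exp_group \<hh>) h.P.G h.\<xi>)"
      by (rule h.induced_irreducible)
    from occurs_in_induced_iff[OF T t this] show ?thesis
      by (simp add: exp_group_def g.inv_G[unfolded exp_group_def])
  qed
  also have "\<dots> \<longleftrightarrow> \<omega> \<subseteq> dual_projection \<hh> ` \<Omega>"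
  proof
    assume "\<exists>x\<in>g.G. \<forall>q\<in>h.P.G. x ** q ** matrix_inv x \<in> g.P.G \<longrightarrow> g.\<xi> (x ** q ** matrix_inv x) = h.\<xi> q"
    then obtain x where x: "x \<in> g.G"
      "\<And>q. q \<in> h.P.G \<Longrightarrow> x ** q ** matrix_inv x \<in> g.P.G \<Longrightarrow> g.\<xi> (x ** q ** matrix_inv x) = h.\<xi> q"
      by blast
    have "\<exists>k\<in>g.P.G. \<forall>B\<in>Q. coadjoint \<gg> (matrix_inv x ** k) l B = m B"
    proof (rule g.agree_after_translation[OF x(1) h.P.L_subspace])
      show "Q \<subseteq> \<gg>" using Qh \<hh>_sub by blast
      show "linear_map_on mat_scale (*) Q m"
        using h.dual_linear[OF h.l] Qh by (rule linear_map_on_subset)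
    qed (use x(2) h.\<xi>_exp in auto)
    then obtain k where k: "k \<in> g.P.G" "\<And>B. B \<in> Q \<Longrightarrow> coadjoint \<gg> (matrix_inv x ** k) l B = m B"
      by blast
    have "k \<in> g.G" using k(1) g.p_L by auto
    then have y: "matrix_inv x ** k \<in> g.G" using g.G_mult g.G_inv x(1) by blast
    define \<nu> where "\<nu> = coadjoint \<gg> (matrix_inv x ** k) l"
    have \<nu>: "\<nu> \<in> \<Omega>" "\<nu> \<in> dual \<gg>"
      using g.orbit_eq(2)[OF assms(6) l] y g.coadjoint_in_dual[OF y g.l] by (auto simp: \<nu>_def)
    \<comment> \<open>So far \<open>\<nu>\<close> matches m only on Q. Transitivity for H shows that
      this already places its restriction in the orbit of m.\<close>
    have "restrict \<nu> \<hh> \<in> h.forms_above"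
      using proj_in[OF \<nu>(2)] k(2) Qh by (auto simp: h.forms_above_def \<nu>_def)
    then obtain j where j: "j \<in> h.P.G" "coadjoint \<hh> j m = restrict \<nu> \<hh>"
      by (rule h.coadjoint_transitive)
    have "j \<in> h.G" using j(1) Qh by auto
    then have r\<omega>: "restrict \<nu> \<hh> \<in> \<omega>"
      using h.orbit_eq(2)[OF assms(7) m] j(2)[symmetric] by blast
    show "\<omega> \<subseteq> dual_projection \<hh> ` \<Omega>"
    proof
      fix \<mu> assume "\<mu> \<in> \<omega>"
      then obtain i where i: "i \<in> h.G" "\<mu> = coadjoint \<hh> i (restrict \<nu> \<hh>)"
        using h.orbit_eq(2)[OF assms(7) r\<omega>] by blast
      then have "\<mu> = dual_projection \<hh> (coadjoint \<gg> i \<nu>)"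
        using proj_coadjoint[OF i(1) \<nu>(2)] by (simp add: dual_projection_def)
      moreover have "coadjoint \<gg> i \<nu> \<in> \<Omega>"
        using g.orbit_eq(2)[OF assms(6) \<nu>(1)] hg[OF i(1)] by blast
      ultimately show "\<mu> \<in> dual_projection \<hh> ` \<Omega>" by blast
    qed
  next
    assume "\<omega> \<subseteq> dual_projection \<hh> ` \<Omega>"
    then obtain \<nu> where \<nu>: "\<nu> \<in> \<Omega>" "m = restrict \<nu> \<hh>"
      using m by (auto simp: dual_projection_def)
    then obtain y where y: "y \<in> g.G" "\<nu> = coadjoint \<gg> y l"
      using g.orbit_eq(2)[OF assms(6) l] by blast
    \<comment> \<open>The witness is y^-1 because the coadjoint action of y evaluates l at y^-1 B y,
      which is the conjugate of B by this element.\<close>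
    let ?x = "matrix_inv y"
    have x: "?x \<in> g.G" "matrix_inv ?x = y" using g.G_inv g.G_inv_inv y(1) by auto
    have "g.\<xi> (?x ** q ** y) = h.\<xi> q" if q: "q \<in> h.P.G" "?x ** q ** y \<in> g.P.G" for q
    proof -
      obtain B where B: "B \<in> Q" "q = mat_exp B" using q(1) by blast
      obtain A where A: "A \<in> P" "?x ** q ** y = mat_exp A" using q(2) by blast
      have Bg: "B \<in> \<hh>" "B \<in> \<gg>" using B(1) Qh \<hh>_sub by auto
      have "mat_exp (?x ** B ** y) = mat_exp A"
        using g.exp_Ad[OF x(1), of B] A(2) B(2) x(2) by simp
      then have "?x ** B ** y = A"
        using inj_onD[OF g.exp_inj] g.Ad_in_L(1)[OF y(1) Bg(2)] g.p_L[OF A(1)] by blast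
      then have "m B = l A"
        using \<nu>(2) y(2) Bg g.coadjoint_apply[OF g.l Bg(2), of y] by simp
      then show ?thesis using A B by (simp add: g.\<xi>_exp h.\<xi>_exp)
    qed
    then show "\<exists>x\<in>g.G. \<forall>q\<in>h.P.G. x ** q ** matrix_inv x \<in> g.P.G \<longrightarrow>
        g.\<xi> (x ** q ** matrix_inv x) = h.\<xi> q"
      using x by (intro bexI[of _ ?x]) auto
  qed
  finally show ?thesis .
qed

end
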